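(* Let $\delta=(\lambda,v)$ be a purely balanced tangent to the symmetrized bidisc $G$, and let $\omega_1,\omega_2$ be the two points $\omega\in\mathbb{T}$ for which $\Phi_\omega$ solves the Carathéodory extremal problem $\mathrm{Car}\,\delta$. For $j=1,2$ let $m_j\in\mathrm{Aut}\,\mathbb{D}$ be such that $m_j\circ\Phi_{\omega_j}$ is well aligned at $\delta$, and let $\varphi_j=m_j\circ\Phi_{\omega_j}$. Suppose that $m_j$ is given by $$m_j(z)=c_j\,\frac{z-\alpha_j}{1-\overline{\alpha_j}z}\quad\text{for all } z\in\mathbb{D},$$ where $|c_j|=1$ and $\alpha_j\in\mathbb{D}$. Then for any well-aligned Carathéodory extremal function $F$ for $\delta$ there exist holomorphic functions $u_1,u_2:G\to\mathbb{C}$ satisfying, for all $\mu=(s,p)\in G$, $$\sum_{j=1}^2\frac{(1-|\alpha_j|^2)^{1/2}\,u_j(\mu)}{1+\overline{\alpha_j}\,\overline{c_j}\,\varphi_j(\mu)}=1$$ and $$|u_1(\mu)|^2+|u_2(\mu)|^2\le\frac{(4-|s|^2)^2}{(4-|s|^2)^2-\left(2|s-\bar s p|+|s^2-4p|\right)^2},$$ such that, for all $\mu\in G$, $$F(\mu)=\sum_{j=1}^2\frac{(1-|\alpha_j|^2)^{1/2}\,\varphi_j(\mu)\,u_j(\mu)}{1+\overline{\alpha_j}\,\overline{c_j}\,\varphi_j(\mu)}.$$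
   Context: $\mathbb{D}$ is the open unit disc, $\mathbb{T}$ the unit circle, $\mathrm{Aut}\,\mathbb{D}$ the group of holomorphic automorphisms of $\mathbb{D}$. The symmetrized bidisc is the domain $G=\{(z+w,zw): |z|<1,\ |w|<1\}\subset\mathbb{C}^2$, whose points are written $(s,p)$. $\mathrm{Hol}(G,\mathbb{D})$ is the set of holomorphic maps $G\to\mathbb{D}$. A tangent to $G$ is a pair $\delta=(\lambda,v)$ with $\lambda\in G$, $v\in\mathbb{C}^2$; it is nondegenerate if $v\neq0$. With $D_vF(\lambda)$ the directional derivative of $F$ at $\lambda$ in the direction $v$, put $$|\delta|_{\rm car}=\sup_{F\in\mathrm{Hol}(G,\mathbb{D})}\frac{|D_vF(\lambda)|}{1-|F(\lambda)|^2}.$$ A function $F\in\mathrm{Hol}(G,\mathbb{D})$ is a Carathéodory extremal function for $\delta$ (equivalently, $F$ solves $\mathrm{Car}\,\delta$) if the supremum is attained at $F$. A Carathéodory extremal function $F$ for $\delta$ is well aligned at $\delta$ if $F(\lambda)=0$ and $D_vF(\lambda)>0$ (equivalently $F(\lambda)=0$ and $D_vF(\lambda)=|\delta|_{\rm car}$). For $\omega\in\mathbb{T}$, $\Phi_\omega\in\mathrm{Hol}(G,\mathbb{D})$ is given by $\Phi_\omega(s,p)=\dfrac{2\omega p-s}{2-\omega s}$. A nondegenerate tangent $\delta$ is purely balanced if $\Phi_\omega$ solves $\mathrm{Car}\,\delta$ for exactly two values of $\omega$ in $\mathbb{T}$. (Purely balanced tangents are by definition nondegenerate.) *)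

theory Defs
  imports "HOL-Complex_Analysis.Complex_Analysis"
begin

definition symm_bidisc :: "(complex \<times> complex) set" where
  "symm_bidisc = {(z + w, z * w) | z w. norm z < 1 \<and> norm w < 1}"

(* Holomorphy in two variables: Frechet differentiability with a complex-linear derivative.
   For open S only, since the derivative is taken at x and not within S. *)
definition holomorphic2_on :: "(complex \<times> complex \<Rightarrow> complex) \<Rightarrow> (complex \<times> complex) set \<Rightarrow> bool"
  where
  "holomorphic2_on f S \<longleftrightarrow>
     (\<forall>x\<in>S. \<exists>a b. (f has_derivative (\<lambda>h. a * fst h + b * snd h)) (at x))"

definition Hol_symm_bidisc_disc :: "(complex \<times> complex \<Rightarrow> complex) set" where
  "Hol_symm_bidisc_disc = {F. holomorphic2_on F symm_bidisc \<and> F ` symm_bidisc \<subseteq> ball 0 1}"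

definition Aut_disc :: "(complex \<Rightarrow> complex) set" where
  "Aut_disc = {m. bij_betw m (ball 0 1) (ball 0 1) \<and> m holomorphic_on ball 0 1 \<and>
                  inv_into (ball 0 1) m holomorphic_on ball 0 1}"

definition dir_deriv ::
  "(complex \<times> complex \<Rightarrow> complex) \<Rightarrow> complex \<times> complex \<Rightarrow> complex \<times> complex \<Rightarrow> complex" where
  "dir_deriv F l v = deriv (\<lambda>t. F (fst l + t * fst v, snd l + t * snd v)) 0"

type_synonym tangent = "(complex \<times> complex) \<times> (complex \<times> complex)"

definition is_tangent :: "tangent \<Rightarrow> bool" where
  "is_tangent \<delta> \<longleftrightarrow> fst \<delta> \<in> symm_bidisc"

definition nondegenerate :: "tangent \<Rightarrow> bool" where
  "nondegenerate \<delta> \<longleftrightarrow> snd \<delta> \<noteq> 0"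

definition car_quotient :: "(complex \<times> complex \<Rightarrow> complex) \<Rightarrow> tangent \<Rightarrow> real" where
  "car_quotient F \<delta> = norm (dir_deriv F (fst \<delta>) (snd \<delta>)) / (1 - (norm (F (fst \<delta>)))\<^sup>2)"

(* The supremum is finite for every tangent (Schwarz-Pick on a small disc through fst delta in
   the direction snd delta), so the real-valued SUP is the genuine one. *)
definition car_norm :: "tangent \<Rightarrow> real" where
  "car_norm \<delta> = (SUP F\<in>Hol_symm_bidisc_disc. car_quotient F \<delta>)"

definition car_extremal :: "(complex \<times> complex \<Rightarrow> complex) \<Rightarrow> tangent \<Rightarrow> bool" where
  "car_extremal F \<delta> \<longleftrightarrow> F \<in> Hol_symm_bidisc_disc \<and> car_quotient F \<delta> = car_norm \<delta>"

definition well_aligned :: "(complex \<times> complex \<Rightarrow> complex) \<Rightarrow> tangent \<Rightarrow> bool" where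
  "well_aligned F \<delta> \<longleftrightarrow> car_extremal F \<delta> \<and> F (fst \<delta>) = 0 \<and>
     dir_deriv F (fst \<delta>) (snd \<delta>) \<in> \<real> \<and> Re (dir_deriv F (fst \<delta>) (snd \<delta>)) > 0"

definition Phi :: "complex \<Rightarrow> complex \<times> complex \<Rightarrow> complex" where
  "Phi \<omega> = (\<lambda>(s, p). (2 * \<omega> * p - s) / (2 - \<omega> * s))"

definition purely_balanced :: "tangent \<Rightarrow> bool" where
  "purely_balanced \<delta> \<longleftrightarrow> is_tangent \<delta> \<and> nondegenerate \<delta> \<and>
     card {\<omega> \<in> sphere 0 1. car_extremal (Phi \<omega>) \<delta>} = 2"

end

theory Submission
  imports Defs
begin

text \<open>Write $z_j = \varphi_j(\mu)$ and $F(\mu) = t z_1 + (1-t) z_2$. The heart of the matter is the inequality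
  $(|t| \sqrt{1-|z_1|^2} + |1-t| \sqrt{1-|z_2|^2})^2 \le 1-|F(\mu)|^2$. It shows that
  $t = (F - \varphi_2)/(\varphi_1 - \varphi_2)$ is locally bounded, hence extends holomorphically over
  $\varphi_1 = \varphi_2$, and dividing $t$ and $1-t$ by the weights of $\varphi_1$ and $\varphi_2$ gives $u_1$
  and $u_2$; their bound follows from $1-|\varphi_j|^2$ being a multiple of $1-|\Phi_{\omega_j}|^2$ and from the
  formula for $\max_\omega |\Phi_\omega|$.

  The inequality comes from a von Neumann inequality for $G$, applied to multiplication by the coordinates
  $s$, $p$ on the three-dimensional algebra of jets at $\lambda$ (in the direction $v$) and values at $\mu$. The
  inner product is a large multiple of the one that certifies the Schwarz-Pick inequality at $\delta$, plus a
  perturbation that only has to be controlled at $\omega_1$ and $\omega_2$, by compactness of the circle. For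
  $F$ the large multiple cancels, as $F$ has the same jet at $\delta$ as $\varphi_1$ and $\varphi_2$.

  In the von Neumann inequality, a commuting pair $(S,P)$ with $\|(2\omega P - S)x\| < \|(2-\omega S)x\|$ satisfies
  $S = A + A'P$, where for $|z| = 1$ the operator $A + zA'$ is normal with spectrum in $\{s : (s,z) \in \overline{G}\}$;
  a Parseval argument transfers the bound for polynomials from these normal operators to $(S,P)$.\<close>

section \<open>Positive definite matrices\<close>

no_notation fps_nth (infixl "$" 75)

text \<open>Why three nodes and why this perturbation: the jet of F at the tangent has to restrict
  the value of F at a further point \<mu>, and a Hermitian form on three coordinates tests exactly
  that. The form is N (|x1|^2 + |x2|^2) plus \<open>hmat 1 0 1 A B\<close>. In the directions where
  the first summand gives only equality for an extremal Phi, the second is strictly decreased when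
  |A - B z_j|^2 < 1 - |z_j|^2. The jet of F, normalised to (0, 1), moves the first coordinate to the
  second, so N cancels and the same inequality results, non-strictly, for F(\<mu>). As A - B z is
  affine in z, its value at F(\<mu>) = t z_1 + (1-t) z_2 combines its values at z_1 and z_2, and
  those can be prescribed: moduli just below sqrt (1 - |z_j|^2), phases that align the two summands.
  That is the origin of the left-hand side of the main inequality. Two obstacles shape the details.
  The von Neumann inequality is run with strict hypotheses, hence the compactness arguments and a
  factor q < 1. Prescribing both values needs z_1 \<noteq> z_2, so estimates are first obtained off
  the zeros of \<phi>_1 - \<phi>_2 and then extended; those zeros lie on a nontrivial conic, whose
  complement is dense.\<close>

definition hdot :: "complex^'n \<Rightarrow> complex^'n \<Rightarrow> complex" where
  "hdot x y = (\<Sum>i\<in>UNIV. x $ i * cnj (y $ i))"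

definition adj :: "complex^'n^'m \<Rightarrow> complex^'m^'n" where
  "adj M = (\<chi> i j. cnj (M $ j $ i))"

lemma hdot_add_left: "hdot (x + y) z = hdot x z + hdot y z"
  by (simp add: hdot_def sum.distrib algebra_simps)

lemma hdot_add_right: "hdot x (y + z) = hdot x y + hdot x z"
  by (simp add: hdot_def sum.distrib algebra_simps)

lemma hdot_diff_left: "hdot (x - y) z = hdot x z - hdot y z"
  by (simp add: hdot_def sum_subtractf algebra_simps)

lemma hdot_scale_left: "hdot (c *s x) y = c * hdot x y"
  by (simp add: hdot_def sum_distrib_left algebra_simps)

lemma hdot_scale_right: "hdot x (c *s y) = cnj c * hdot x y"
  by (simp add: hdot_def sum_distrib_left algebra_simps)

lemma cnj_hdot: "cnj (hdot x y) = hdot y x"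
  by (simp add: hdot_def algebra_simps)

lemma hdot_zero [simp]: "hdot 0 y = 0" "hdot x 0 = 0"
  by (simp_all add: hdot_def)

lemma hdot_sum_left: "hdot (sum f I) y = (\<Sum>i\<in>I. hdot (f i) y)"
  by (induction I rule: infinite_finite_induct) (simp_all add: hdot_add_left)

lemma hdot_sum_right: "hdot y (sum f I) = (\<Sum>i\<in>I. hdot y (f i))"
  by (induction I rule: infinite_finite_induct) (simp_all add: hdot_add_right)

lemma adj_adj [simp]: "adj (adj M) = M"
  by (simp add: adj_def vec_eq_iff)

lemma adj_mult: "adj (A ** B) = adj B ** adj A"
  by (simp add: adj_def vec_eq_iff matrix_matrix_mult_def algebra_simps)

lemma adj_add: "adj (A + B) = adj A + adj B"
  by (simp add: adj_def vec_eq_iff)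

lemma adj_diff: "adj (A - B) = adj A - adj B"
  by (simp add: adj_def vec_eq_iff)

lemma hdot_adj: "hdot (M *v x) y = hdot x (adj M *v y)"
proof -
  have "hdot (M *v x) y = (\<Sum>i\<in>UNIV. \<Sum>j\<in>UNIV. M $ i $ j * x $ j * cnj (y $ i))"
    by (simp add: hdot_def matrix_vector_mult_def sum_distrib_right)
  also have "\<dots> = (\<Sum>j\<in>UNIV. \<Sum>i\<in>UNIV. M $ i $ j * x $ j * cnj (y $ i))"
    by (rule sum.swap)
  also have "\<dots> = hdot x (adj M *v y)"
    by (simp add: hdot_def matrix_vector_mult_def adj_def sum_distrib_left algebra_simps)
  finally show ?thesis .
qed

lemma hdot_adj': "hdot x (M *v y) = hdot (adj M *v x) y"
  by (simp add: hdot_adj)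

definition herm :: "complex^'n^'n \<Rightarrow> complex^'n \<Rightarrow> real" where
  "herm M x = Re (hdot (M *v x) x)"

text \<open>A positive definite \<open>M\<close> serves as an inner product with squared norm
  \<open>herm M\<close>. Adjoints and contractions below are taken relative to such an
  \<open>M\<close>, which avoids square roots of matrices.\<close>

definition pos_def :: "complex^'n^'n \<Rightarrow> bool" where
  "pos_def M \<longleftrightarrow> adj M = M \<and> (\<forall>x. x \<noteq> 0 \<longrightarrow> herm M x > 0)"

lemma herm_zero [simp]: "herm M 0 = 0"
  by (simp add: herm_def)

lemma herm_scale: "herm M (c *s x) = (norm c)^2 * herm M x"
proof -
  have "hdot (M *v (c *s x)) (c *s x) = complex_of_real ((norm c)^2) * hdot (M *v x) x"
    unfolding complex_norm_square
    by (simp add: vector_scalar_commute hdot_scale_left hdot_scale_right mult_ac)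
  then show ?thesis by (simp add: herm_def)
qed

lemma herm_add:
  assumes "adj M = M"
  shows "herm M (x + y) = herm M x + herm M y + 2 * Re (hdot (M *v x) y)"
proof -
  have "hdot (M *v y) x = cnj (hdot (M *v x) y)"
    using assms by (simp add: hdot_adj cnj_hdot)
  then show ?thesis
    by (simp add: herm_def matrix_vector_right_distrib hdot_add_left hdot_add_right)
qed

lemma pos_def_nonneg: "pos_def M \<Longrightarrow> herm M x \<ge> 0"
  by (cases "x = 0") (auto simp: pos_def_def less_imp_le)

lemma pos_def_invertible:
  assumes "pos_def M" shows "invertible M"
proof -
  have "inj ((*v) M)"
  proof (rule injI)
    fix x y assume "M *v x = M *v y"
    then have "M *v (x - y) = 0" by (simp add: matrix_vector_mult_diff_distrib)
    then have "herm M (x - y) = 0" by (simp add: herm_def)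
    then show "x = y" using assms unfolding pos_def_def by (metis eq_iff_diff_eq_0 less_irrefl)
  qed
  then show ?thesis
    by (metis invertible_def matrix_left_invertible_injective matrix_left_right_inverse)
qed

lemma continuous_on_herm [continuous_intros]:
  assumes "continuous_on X f"
  shows "continuous_on X (\<lambda>x. herm M (f x))"
  unfolding herm_def hdot_def matrix_vector_mult_def
  by (simp, intro continuous_intros assms)

lemma scaleR_eq_smult: "r *\<^sub>R (x :: complex^'n) = complex_of_real r *s x"
  unfolding vec_eq_iff by (simp, simp add: scaleR_conv_of_real)

text \<open>The maximiser \<^term>\<open>y\<close> of the Rayleigh quotient on \<^term>\<open>E\<close> is an eigenvector, because the
  nonnegative form \<^term>\<open>\<lambda>x. \<tau> * herm M x - herm (M ** H) x\<close> vanishes at \<^term>\<open>y\<close>.\<close>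
lemma max_eigenvector:
  fixes M H :: "complex^'n^'n"
  assumes M: "pos_def M" and H: "adj (M ** H) = M ** H"
    and E0: "0 \<in> E" and Eadd: "\<And>x y. x \<in> E \<Longrightarrow> y \<in> E \<Longrightarrow> x + y \<in> E"
    and Esc: "\<And>c x. x \<in> E \<Longrightarrow> c *s x \<in> E" and EH: "\<And>x. x \<in> E \<Longrightarrow> H *v x \<in> E"
    and ne: "x0 \<in> E" "x0 \<noteq> 0"
  obtains y \<tau> where "y \<in> E" "y \<noteq> 0" "H *v y = complex_of_real \<tau> *s y"
    "\<And>x. x \<in> E \<Longrightarrow> herm (M ** H) x \<le> \<tau> * herm M x"
proof -
  have sub: "subspace E"
    unfolding subspace_def using E0 Eadd Esc by (simp add: scaleR_eq_smult)
  define C where "C = E \<inter> sphere 0 1"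
  have "compact C"
    unfolding C_def using closed_subspace[OF sub] by (simp add: closed_Int_compact)
  moreover have "(1 / norm x0) *\<^sub>R x0 \<in> C"
    using ne sub by (auto simp: C_def intro: subspace_scale)
  moreover have "continuous_on C (\<lambda>x. herm (M ** H) x / herm M x)"
  proof (intro continuous_intros ballI)
    fix x assume "x \<in> C"
    then have "x \<noteq> 0" by (auto simp: C_def)
    then show "herm M x \<noteq> 0" using M by (metis less_irrefl pos_def_def)
  qed
  ultimately obtain y where y: "y \<in> C"
    and ymax: "\<And>x. x \<in> C \<Longrightarrow> herm (M ** H) x / herm M x \<le> herm (M ** H) y / herm M y"
    using continuous_attains_sup[of C "\<lambda>x. herm (M ** H) x / herm M x"] by auto
  define \<tau> where "\<tau> = herm (M ** H) y / herm M y"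
  have y0: "y \<in> E" "y \<noteq> 0" using y by (auto simp: C_def)
  then have My: "herm M y > 0" using M by (auto simp: pos_def_def)
  have le: "herm (M ** H) x \<le> \<tau> * herm M x" if "x \<in> E" for x
  proof (cases "x = 0")
    case False
    define x' where "x' = complex_of_real (1 / norm x) *s x"
    have "x' \<in> C"
    proof -
      have "x' = (1 / norm x) *\<^sub>R x" by (simp add: x'_def scaleR_eq_smult)
      then show ?thesis using that False sub by (auto simp: C_def intro: subspace_scale)
    qed
    then have "herm (M ** H) x' / herm M x' \<le> \<tau>" using ymax \<tau>_def by blast
    moreover have "herm (M ** H) x' / herm M x' = herm (M ** H) x / herm M x"
      using False by (simp add: x'_def herm_scale)
    ultimately show ?thesis using M False by (simp add: pos_def_def pos_divide_le_eq)
  qed simp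
  \<comment> \<open>The residual of the eigenvalue equation. The form \<open>g\<close> below
    vanishes at \<open>y\<close> and has slope \<open>- 2 * herm M d\<close> there in the direction
    \<open>- d\<close>, so its nonnegativity forces \<open>d = 0\<close>.\<close>
  define d where "d = complex_of_real \<tau> *s y - H *v y"
  have dE: "d \<in> E"
    unfolding d_def using sub y0 Esc EH by (auto intro: subspace_diff)
  have d0: "d = 0"
  proof (rule ccontr)
    assume "d \<noteq> 0"
    then have Md: "herm M d > 0" using M by (auto simp: pos_def_def)
    define g where "g x = \<tau> * herm M x - herm (M ** H) x" for x
    have gy: "g y = 0" using My by (simp add: g_def \<tau>_def)
    have g0: "g d \<ge> 0" using le[OF dE] by (simp add: g_def)
    have cross: "g (y + complex_of_real (- e) *s d) = e^2 * g d - 2 * e * herm M d" for e :: real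
    proof -
      have 1: "Re (hdot (M *v y) (complex_of_real (-e) *s d)) = - e * Re (hdot (M *v y) d)"
        unfolding hdot_scale_right by simp
      have 2: "Re (hdot ((M ** H) *v y) (complex_of_real (-e) *s d)) = - e * Re (hdot ((M ** H) *v y) d)"
        unfolding hdot_scale_right by simp
      have 3: "\<tau> * Re (hdot (M *v y) d) - Re (hdot ((M ** H) *v y) d) = herm M d"
        by (simp add: herm_def d_def matrix_vector_mult_diff_distrib hdot_diff_left
            vector_scalar_commute hdot_scale_left matrix_vector_mul_assoc)
      have adjM: "adj M = M" using M by (simp add: pos_def_def)
      have "g (y + complex_of_real (- e) *s d) = g y + e^2 * g d
          - 2 * e * (\<tau> * Re (hdot (M *v y) d) - Re (hdot ((M ** H) *v y) d))"
        unfolding g_def herm_add[OF adjM] herm_add[OF H] herm_scale 1 2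
        by (simp add: algebra_simps)
      then show ?thesis using gy 3 by simp
    qed
    have pos: "g (y + complex_of_real (- e) *s d) \<ge> 0" for e
      using le[OF Eadd[OF y0(1) Esc[OF dE, of "complex_of_real (- e)"]]] unfolding g_def by linarith
    \<comment> \<open>A step short enough for the linear term to win; the summand 1 covers
      \<open>g d = 0\<close>.\<close>
    define e where "e = herm M d / (g d + 1)"
    have e: "e > 0" using Md g0 by (simp add: e_def)
    have "e * g d \<le> e * (g d + 1)" using e by simp
    also have "\<dots> = herm M d" using g0 by (simp add: e_def)
    finally have "e * g d < 2 * herm M d" using Md by linarith
    then have "e * (e * g d) < e * (2 * herm M d)" using e by simp
    then show False using pos[of e] cross[of e] by (simp add: power2_eq_square algebra_simps)
  qed
  show thesis using that[OF y0 _ le] d0 by (simp add: d_def)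
qed

lemma mat_mult_vec: "mat c *v x = c *s (x :: complex^'n)"
proof -
  have "(\<Sum>j\<in>UNIV. (if i = j then c else 0) * x $ j) = (\<Sum>j\<in>UNIV. if i = j then c * x $ j else 0)" for i
    by (intro sum.cong) auto
  then show ?thesis
    by (simp add: vec_eq_iff matrix_vector_mult_def mat_def if_distrib cong: if_cong)
qed

lemma mat_eqI: "(\<And>x. A *v x = B *v x) \<Longrightarrow> A = (B :: complex^'n^'m)"
  by (simp add: matrix_eq)

lemma matrix_add_rdistrib: "(A + B) ** C = A ** C + B ** (C :: complex^'n^'k)"
  by (rule mat_eqI) (simp add: matrix_vector_mult_add_rdistrib flip: matrix_vector_mul_assoc)

lemma mat_commute: "mat c ** M = M ** (mat c :: complex^'n^'n)"
  by (rule mat_eqI) (simp add: mat_mult_vec vector_scalar_commute flip: matrix_vector_mul_assoc)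

lemma mat_left_commute: "M ** (mat c ** A) = mat c ** (M ** (A :: complex^'n^'n))"
  by (simp only: matrix_mul_assoc mat_commute[of c M])

lemma adj_mat: "adj (mat c :: complex^'n^'n) = mat (cnj c)"
  by (auto simp: adj_def mat_def vec_eq_iff)

lemma herm_mult:
  "herm (adj C ** M ** C) x = herm M (C *v x)"
  by (simp add: herm_def hdot_adj flip: matrix_vector_mul_assoc)

lemma pos_def_inverse:
  assumes "pos_def M"
  obtains M' where "M ** M' = mat 1" "M' ** M = mat 1"
  using pos_def_invertible[OF assms] unfolding invertible_def by blast

text \<open>An operator commuting with a self-adjoint \<^term>\<open>B\<close> attains its norm at an eigenvector of
  \<^term>\<open>B\<close>: the eigenspace of \<^term>\<open>C\<close> adjoint times \<^term>\<open>C\<close> for the largest eigenvalue is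
  invariant under \<^term>\<open>B\<close>.\<close>
lemma commuting_contraction:
  fixes M B C :: "complex^'n^'n"
  assumes M: "pos_def M" and B: "adj (M ** B) = M ** B" and comm: "C ** B = B ** C"
    and joint: "\<And>y \<tau>. y \<noteq> 0 \<Longrightarrow> B *v y = complex_of_real \<tau> *s y \<Longrightarrow>
                  \<exists>\<gamma>. C *v y = \<gamma> *s y \<and> norm \<gamma> \<le> c"
  shows "herm M (C *v x) \<le> c^2 * herm M x"
proof -
  obtain M' where M': "M ** M' = mat 1" "M' ** M = mat 1"
    using pos_def_inverse[OF M] .
  have adjM: "adj M = M" using M by (simp add: pos_def_def)
  \<comment> \<open>The adjoint of \<open>C\<close> for the inner product \<open>M\<close>. It
    commutes with \<open>B\<close> as well, because \<open>B\<close> is self-adjoint for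
    \<open>M\<close>.\<close>
  define C' where "C' = M' ** adj C ** M"
  define H where "H = C' ** C"
  have MH: "M ** H = adj C ** M ** C"
    by (simp add: H_def C'_def matrix_mul_assoc M')
  have HMH: "herm (M ** H) x = herm M (C *v x)" for x
    by (simp add: MH herm_mult)
  have MB: "M ** B = adj B ** M"
    using B by (simp add: adj_mult adjM)
  have "B ** C' = (M' ** M) ** B ** C'" by (simp add: M')
  also have "\<dots> = M' ** (M ** B) ** C'" by (simp add: matrix_mul_assoc)
  also have "\<dots> = M' ** adj B ** (M ** M') ** adj C ** M" by (simp add: MB C'_def matrix_mul_assoc)
  also have "\<dots> = M' ** adj (C ** B) ** M" by (simp add: M' adj_mult matrix_mul_assoc)
  also have "\<dots> = M' ** adj C ** (adj B ** M)" by (simp add: comm adj_mult matrix_mul_assoc)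
  also have "\<dots> = C' ** B" by (simp add: MB[symmetric] C'_def matrix_mul_assoc)
  finally have BC': "B ** C' = C' ** B" .
  have BH: "B ** H = H ** B"
    by (metis BC' H_def comm matrix_mul_assoc)
  have "adj (M ** H) = M ** H"
    by (simp add: MH adj_mult adjM matrix_mul_assoc)
  then obtain y0 \<tau>0 where y0: "y0 \<noteq> 0" "H *v y0 = complex_of_real \<tau>0 *s y0"
    and max0: "\<And>x. herm (M ** H) x \<le> \<tau>0 * herm M x"
    using max_eigenvector[OF M, of H UNIV "1 :: complex^'n"] by auto
  define E where "E = {x. H *v x = complex_of_real \<tau>0 *s x}"
  obtain y \<tau> where y: "y \<in> E" "y \<noteq> 0" "B *v y = complex_of_real \<tau> *s y"
  proof (rule max_eigenvector[OF M B, of E y0])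
    show "B *v x \<in> E" if "x \<in> E" for x
      using that BH by (simp add: E_def matrix_vector_mul_assoc) 
        (simp add: vector_scalar_commute flip: BH matrix_vector_mul_assoc)
  qed (use y0 in \<open>auto simp: E_def matrix_vector_right_distrib vector_scalar_commute
        vector_add_ldistrib mult_ac\<close>)
  obtain \<gamma> where \<gamma>: "C *v y = \<gamma> *s y" "norm \<gamma> \<le> c"
    using joint y by blast
  have My: "herm M y > 0" using M y by (simp add: pos_def_def)
  have "\<tau>0 * herm M y = herm (M ** H) y"
    using y by (simp add: E_def herm_def vector_scalar_commute hdot_scale_left flip: matrix_vector_mul_assoc)
  also have "\<dots> = (norm \<gamma>)^2 * herm M y"
    by (simp add: HMH \<gamma> herm_scale)
  finally have "\<tau>0 = (norm \<gamma>)^2" using My by simp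
  then have "\<tau>0 \<le> c^2" using \<gamma> by (simp add: power_mono)
  then show ?thesis
    using max0[of x] pos_def_nonneg[OF M, of x] HMH[of x]
    by (smt (verit) mult_right_mono)
qed

section \<open>Polynomials in two variables, evaluated at points and at pairs of matrices\<close>

datatype bpoly = One | MulS bpoly | MulP bpoly | Add bpoly bpoly | Scl complex bpoly

primrec bev :: "bpoly \<Rightarrow> complex \<times> complex \<Rightarrow> complex" where
  "bev One x = 1"
| "bev (MulS q) x = fst x * bev q x"
| "bev (MulP q) x = snd x * bev q x"
| "bev (Add q r) x = bev q x + bev r x"
| "bev (Scl c q) x = c * bev q x"

primrec bop :: "bpoly \<Rightarrow> complex^'n^'n \<Rightarrow> complex^'n^'n \<Rightarrow> complex^'n^'n" where
  "bop One S P = mat 1"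
| "bop (MulS q) S P = S ** bop q S P"
| "bop (MulP q) S P = P ** bop q S P"
| "bop (Add q r) S P = bop q S P + bop r S P"
| "bop (Scl c q) S P = mat c ** bop q S P"

text \<open>Only an upper bound for the degree, as cancellation is ignored. It counts how many low
  coefficients are spoiled when the pencil replaces the pair (S, P).\<close>

primrec bdeg :: "bpoly \<Rightarrow> nat" where
  "bdeg One = 0"
| "bdeg (MulS q) = Suc (bdeg q)"
| "bdeg (MulP q) = Suc (bdeg q)"
| "bdeg (Add q r) = max (bdeg q) (bdeg r)"
| "bdeg (Scl c q) = bdeg q"

lemma continuous_on_bev [continuous_intros]:
  assumes "continuous_on X f"
  shows "continuous_on X (\<lambda>x. bev q (f x))"
  by (induction q) (auto intro!: continuous_intros assms)

lemma bop_commute: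
  assumes "X ** S = S ** X" "X ** P = P ** X"
  shows "X ** bop q S P = bop q S P ** X"
proof (induction q)
  case (Scl c q)
  then show ?case by (metis bop.simps(5) mat_commute matrix_mul_assoc)
qed (auto simp: matrix_mul_assoc assms matrix_add_ldistrib matrix_add_rdistrib,
     (metis matrix_mul_assoc assms)+)

lemma bop_eigen:
  assumes "S *v y = s *s y" "P *v y = p *s y"
  shows "bop q S P *v y = bev q (s, p) *s y"
  using assms
  by (induction q)
     (simp_all add: vector_scalar_commute matrix_vector_mult_add_rdistrib vector_sadd_rdistrib
       mat_mult_vec mult_ac flip: matrix_vector_mul_assoc)

text \<open>With \<tau> = 2 cos \<psi> the point consists of the sum and the product of \<eta> e^(i
  \<psi>) and \<eta> e^(-i \<psi>), so it lies on the distinguished boundary and is a radial limit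
  of points of the domain.\<close>

lemma bev_bound_boundary:
  assumes bnd: "\<And>x. x \<in> symm_bidisc \<Longrightarrow> norm (bev q x) \<le> c"
    and \<eta>: "norm \<eta> = 1" and \<tau>: "\<bar>\<tau>\<bar> \<le> 2"
  shows "norm (bev q (\<eta> * complex_of_real \<tau>, \<eta>^2)) \<le> c"
proof -
  define \<psi> where "\<psi> = arccos (\<tau> / 2)"
  have c: "2 * cos \<psi> = \<tau>" using \<tau> by (simp add: \<psi>_def cos_arccos_abs)
  define f where "f r = norm (bev q (complex_of_real r * \<eta> * \<tau>, (complex_of_real r * \<eta>)^2))" for r
  have "continuous_on UNIV f"
    unfolding f_def by (intro continuous_intros)
  then have "(f \<longlongrightarrow> f 1) (at_left 1)"
    by (auto simp: continuous_on_def intro: filterlim_mono at_le)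
  moreover have "eventually (\<lambda>r. f r \<le> c) (at_left 1)"
  proof (rule eventually_mono[OF eventually_at_left_real[of 0 1]])
    fix r :: real assume r: "r \<in> {0<..<1}"
    define z w where "z = complex_of_real r * \<eta> * cis \<psi>" and "w = complex_of_real r * \<eta> * cis (-\<psi>)"
    have "norm z < 1" "norm w < 1" using r \<eta> by (auto simp: z_def w_def norm_mult)
    moreover have "z + w = complex_of_real r * \<eta> * \<tau>"
      by (simp add: z_def w_def complex_eq_iff flip: c distrib_left)
    moreover have "z * w = (complex_of_real r * \<eta>)^2"
      using cis_mult[of \<psi> "-\<psi>"] by (simp add: z_def w_def power2_eq_square mult_ac)
    ultimately show "f r \<le> c"
      unfolding f_def symm_bidisc_def by (intro bnd) (metis (mono_tags, lifting) mem_Collect_eq symm_bidisc_def)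
  qed simp
  ultimately have "f 1 \<le> c"
    by (rule tendsto_upperbound) simp
  then show ?thesis by (simp add: f_def)
qed

text \<open>For \<^term>\<open>norm z = 1\<close> the matrix \<^term>\<open>A + mat z ** A'\<close> is a unimodular multiple of an
  operator that is self-adjoint for \<^term>\<open>M\<close> with numerical range in $[-2,2]$, so its joint
  eigenvalues with \<^term>\<open>z\<close> lie in the closure of the symmetrized bidisc.\<close>
lemma pencil_contraction:
  fixes M A A' :: "complex^'n^'n"
  assumes M: "pos_def M" and A': "M ** A' = adj (M ** A)"
    and num: "\<And>x. norm (hdot ((M ** A) *v x) x) \<le> herm M x"
    and z: "norm z = 1" and bnd: "\<And>x. x \<in> symm_bidisc \<Longrightarrow> norm (bev q x) \<le> c"
  shows "herm M (bop q (A + mat z ** A') (mat z) *v x) \<le> c^2 * herm M x"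
proof -
  \<comment> \<open>A square root of the conjugate of \<open>z\<close>, so that
    \<open>\<omega> * z = cnj \<omega>\<close>. Multiplying the pencil by it gives \<omega> A plus
    its adjoint for \<open>M\<close>.\<close>
  define \<omega> where "\<omega> = cnj (csqrt z)"
  have \<omega>: "norm \<omega> = 1" "(cnj \<omega>)^2 = z" "\<omega> * cnj \<omega> = 1" 
  proof -
    show 1: "norm \<omega> = 1" "(cnj \<omega>)^2 = z" using z by (simp_all add: \<omega>_def)
    show "\<omega> * cnj \<omega> = 1" using complex_norm_square[of \<omega>] 1 by simp
  qed
  have \<omega>z: "\<omega> * z = cnj \<omega>" using \<omega> by (metis mult.assoc mult.left_neutral power2_eq_square)
  define B where "B = mat \<omega> ** (A + mat z ** A')"
  have B: "B = mat \<omega> ** A + mat (cnj \<omega>) ** A'"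
    unfolding B_def \<omega>z[symmetric]
    by (rule mat_eqI) (simp add: matrix_vector_mult_add_rdistrib mat_mult_vec vector_add_ldistrib
        vector_smult_assoc flip: matrix_vector_mul_assoc)
  have MB: "M ** B = mat \<omega> ** (M ** A) + mat (cnj \<omega>) ** adj (M ** A)"
    unfolding B A'[symmetric] by (simp add: matrix_add_ldistrib mat_left_commute)
  have MBadj: "adj (M ** B) = M ** B"
    unfolding MB by (simp add: adj_add adj_mult adj_mat mat_commute add.commute)
  have comm: "X ** B = B ** X" if "X = bop q (A + mat z ** A') (mat z)" for X
  proof -
    have "(A + mat z ** A') ** X = X ** (A + mat z ** A')"
      unfolding that by (rule bop_commute) (simp_all add: mat_commute)
    then show ?thesis
      unfolding B_def by (simp add: mat_left_commute flip: matrix_mul_assoc)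
  qed
  show ?thesis
  proof (rule commuting_contraction[OF M MBadj comm[OF refl]])
    fix y \<tau> assume y: "y \<noteq> 0" "B *v y = complex_of_real \<tau> *s y"
    have "(A + mat z ** A') *v y = cnj \<omega> *s (B *v y)"
      using \<omega> unfolding B_def
      by (simp add: mat_mult_vec vector_smult_assoc mult.commute[of "cnj \<omega>"] flip: matrix_vector_mul_assoc)
    then have 1: "(A + mat z ** A') *v y = (cnj \<omega> * complex_of_real \<tau>) *s y"
      by (simp add: y vector_smult_assoc)
    have My: "herm M y > 0" using M y by (simp add: pos_def_def)
    have "\<tau> * herm M y = herm (M ** B) y"
      using y by (simp add: herm_def vector_scalar_commute hdot_scale_left flip: matrix_vector_mul_assoc)
    also have "\<dots> = 2 * Re (\<omega> * hdot ((M ** A) *v y) y)"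
    proof -
      have "hdot (adj (M ** A) *v y) y = cnj (hdot ((M ** A) *v y) y)"
        by (simp only: cnj_hdot hdot_adj adj_adj)
      then have "hdot ((M ** B) *v y) y = \<omega> * hdot ((M ** A) *v y) y + cnj (\<omega> * hdot ((M ** A) *v y) y)"
        unfolding MB by (simp add: matrix_vector_mult_add_rdistrib hdot_add_left mat_mult_vec
            hdot_scale_left del: cnj_hdot adj_mult flip: matrix_vector_mul_assoc[of "mat _"])
      then show ?thesis by (simp add: herm_def)
    qed
    finally have "\<bar>\<tau>\<bar> * herm M y = 2 * \<bar>Re (\<omega> * hdot ((M ** A) *v y) y)\<bar>"
      using My by (metis abs_mult abs_numeral abs_of_pos)
    also have "\<dots> \<le> 2 * norm (hdot ((M ** A) *v y) y)"
      using abs_Re_le_cmod[of "\<omega> * hdot ((M ** A) *v y) y"] \<omega> by (simp add: norm_mult)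
    also have "\<dots> \<le> 2 * herm M y" using num by simp
    finally have "\<bar>\<tau>\<bar> \<le> 2" using My by simp
    then have "norm (bev q (cnj \<omega> * complex_of_real \<tau>, (cnj \<omega>)^2)) \<le> c"
      using bev_bound_boundary[OF bnd, of "cnj \<omega>" \<tau>] \<omega> by simp
    then show "\<exists>\<gamma>. bop q (A + mat z ** A') (mat z) *v y = \<gamma> *s y \<and> norm \<gamma> \<le> c"
      using bop_eigen[OF 1 mat_mult_vec[of z y], of q] \<omega> by auto
  qed
qed

section \<open>A von Neumann inequality for the symmetrized bidisc\<close>

lemma matrix_vector_mult_sum:
  "M *v (\<Sum>i\<in>I. f i) = (\<Sum>i\<in>I. M *v (f i :: complex^'n))"
  by (induction I rule: infinite_finite_induct) (simp_all add: matrix_vector_right_distrib)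

lemma root_unity_sum:
  assumes "m < n" "m' < n"
  shows "(\<Sum>l<n. cis (2 * pi * real l / real n) ^ m * cnj (cis (2 * pi * real l / real n) ^ m')) =
    (if m = m' then of_nat n else (0 :: complex))"
proof (cases "m = m'")
  case True
  have "cis (2 * pi * real l / real n) ^ m * cnj (cis (2 * pi * real l / real n) ^ m) = 1" for l
    using complex_norm_square[of "cis (2 * pi * real l / real n) ^ m"] by (simp add: norm_power)
  then show ?thesis using True by simp
next
  case False
  define w where "w = cis (2 * pi * (real m - real m') / n)"
  have n: "n > 0" using assms by simp
  have pw: "cis (2 * pi * real l / real n) ^ m * cnj (cis (2 * pi * real l / real n) ^ m') = w ^ l" for l
    using n by (simp add: w_def Complex.DeMoivre cis_mult cis_cnj field_simps)
  have wn: "w ^ n = 1"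
  proof -
    have "w ^ n = cis (2 * pi * of_int (int m - int m'))"
      using n by (simp add: w_def Complex.DeMoivre)
    also have "\<dots> = 1" by (rule cis_multiple_2pi) simp
    finally show ?thesis .
  qed
  have "w \<noteq> 1"
  proof
    assume "w = 1"
    then have "cos (2 * pi * (real m - real m') / n) = 1"
      by (metis w_def cis.simps(1) one_complex.simps(1))
    then obtain k :: int where "2 * pi * (real m - real m') / n = of_int k * 2 * pi"
      unfolding cos_one_2pi_int by blast
    then have "(2 * pi) * (real m - real m') = (2 * pi) * (of_int k * n)"
      using n by (simp add: divide_eq_eq mult_ac)
    then have "real m - real m' = of_int k * n" by simp
    then have "real_of_int (int m - int m') = real_of_int (k * int n)" by simp
    then have k: "int m - int m' = k * int n" unfolding of_int_eq_iff .
    have "\<bar>int m - int m'\<bar> < int n" using assms by auto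
    then have "\<bar>k * int n\<bar> < int n" using k by simp
    then have "\<bar>k\<bar> * int n < 1 * int n" by (simp add: abs_mult)
    then have "k = 0" using n by (simp add: mult_less_cancel_right)
    then show False using False k by simp
  qed
  then have "(\<Sum>l<n. w ^ l) = 0" by (simp add: geometric_sum wn)
  then show ?thesis using False unfolding pw by simp
qed

text \<open>A polynomial of degree below \<open>n\<close> is sampled at the \<open>n\<close>-th
  roots of unity; the identity is then exact and no integral over the circle is involved.\<close>

lemma parseval:
  assumes M: "adj M = (M :: complex^'n^'n)"
  shows "(\<Sum>l<n. herm M (\<Sum>m<n. cis (2 * pi * real l / real n) ^ m *s c m)) = real n * (\<Sum>m<n. herm M (c m))"
proof -
  define \<zeta> where "\<zeta> l = cis (2 * pi * real l / real n)" for l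
  have "hdot (M *v (\<Sum>m<n. \<zeta> l ^ m *s c m)) (\<Sum>m<n. \<zeta> l ^ m *s c m) =
      (\<Sum>m<n. \<Sum>m'<n. (\<zeta> l ^ m * cnj (\<zeta> l ^ m')) * hdot (M *v c m) (c m'))" for l
    by (simp add: matrix_vector_mult_sum hdot_sum_left hdot_sum_right vector_scalar_commute
        hdot_scale_left hdot_scale_right sum_distrib_left mult_ac) (rule sum.swap)
  then have "(\<Sum>l<n. hdot (M *v (\<Sum>m<n. \<zeta> l ^ m *s c m)) (\<Sum>m<n. \<zeta> l ^ m *s c m)) =
      (\<Sum>l<n. \<Sum>m<n. \<Sum>m'<n. (\<zeta> l ^ m * cnj (\<zeta> l ^ m')) * hdot (M *v c m) (c m'))"
    by simp
  also have "\<dots> = (\<Sum>m<n. \<Sum>m'<n. (\<Sum>l<n. \<zeta> l ^ m * cnj (\<zeta> l ^ m')) * hdot (M *v c m) (c m'))"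
    by (subst sum.swap, rule sum.cong[OF refl], subst sum.swap) (simp add: sum_distrib_right)
  also have "\<dots> = (\<Sum>m<n. \<Sum>m'<n. (if m = m' then of_nat n else 0) * hdot (M *v c m) (c m'))"
    using root_unity_sum[of _ n] by (intro sum.cong refl) (simp add: \<zeta>_def)
  also have "\<dots> = (\<Sum>m<n. of_nat n * hdot (M *v c m) (c m))"
    by (intro sum.cong refl) (simp add: if_distrib[of "\<lambda>x. x * _"] cong: if_cong)
  finally have "Re (\<Sum>l<n. hdot (M *v (\<Sum>m<n. \<zeta> l ^ m *s c m)) (\<Sum>m<n. \<zeta> l ^ m *s c m)) =
      Re (\<Sum>m<n. of_nat n * hdot (M *v c m) (c m))" by simp
  then show ?thesis
    by (simp add: herm_def \<zeta>_def sum_distrib_left)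
qed

abbreviation mpow :: "complex^'n^'n \<Rightarrow> nat \<Rightarrow> complex^'n \<Rightarrow> complex^'n" where
  "mpow P k x \<equiv> ((\<lambda>v. P *v v) ^^ k) x"

lemma mpow_commute: "X ** P = P ** X \<Longrightarrow> X *v mpow P k x = mpow P k (X *v x)"
  by (induction k) (simp_all add: matrix_vector_mul_assoc, metis matrix_vector_mul_assoc)

text \<open>Vanishing of the top coefficient leaves room for the shift within \<open>n\<close>
  coefficients.\<close>

lemma shift_polynomial:
  assumes "n > 0" "c (n - 1) = 0"
  shows "(\<Sum>m<n. z ^ m *s (if m = 0 then 0 else c (m - 1))) = z *s (\<Sum>m<n. z ^ m *s (c m :: complex^'n))"
proof -
  obtain k where k: "n = Suc k" using assms(1) by (cases n) auto
  have "(\<Sum>m<n. z ^ m *s (if m = 0 then 0 else c (m - 1))) = (\<Sum>m<k. z ^ Suc m *s c m)"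
    unfolding k sum.lessThan_Suc_shift by simp
  also have "\<dots> = (\<Sum>m<n. z ^ Suc m *s c m)"
    using assms(2) by (simp add: k)
  also have "\<dots> = z *s (\<Sum>m<n. z ^ m *s c m)"
    by (simp add: vec.scale_sum_right vector_smult_assoc)
  finally show ?thesis .
qed

text \<open>Evaluating the pencil \<^term>\<open>A + mat z ** A'\<close> on a polynomial in \<^term>\<open>z\<close> with coefficients
  \<^term>\<open>mpow P k x\<close> reproduces \<^term>\<open>S\<close> on all coefficients except for the lowest ones, whose number
  is the degree of \<^term>\<open>q\<close>.\<close>
lemma bop_pencil_coeffs:
  fixes A A' S P :: "complex^'n^'n"
  assumes S: "S = A + A' ** P" and comm: "S ** P = P ** S"
    and d: "bdeg q \<le> d" and n: "K + d < n"
  shows "\<exists>c. (\<forall>z. bop q (A + mat z ** A') (mat z) *v (\<Sum>m\<le>K. z ^ m *s mpow P (K - m) x) =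
                   (\<Sum>m<n. z ^ m *s c m)) \<and>
             (\<forall>m>K + d. c m = 0) \<and>
             (\<forall>m. d \<le> m \<longrightarrow> m \<le> K \<longrightarrow> c m = bop q S P *v mpow P (K - m) x)"
proof -
  let ?rep = "\<lambda>q d c. (\<forall>z. bop q (A + mat z ** A') (mat z) *v (\<Sum>m\<le>K. z ^ m *s mpow P (K - m) x) =
                   (\<Sum>m<n. z ^ m *s c m)) \<and>
             (\<forall>m>K + d. c m = 0) \<and>
             (\<forall>m. d \<le> m \<longrightarrow> m \<le> K \<longrightarrow> c m = bop q S P *v mpow P (K - m) x)"
  have step: "c (m - 1) = P *v (bop q S P *v mpow P (K - m) x)"
    if "?rep q d c" "Suc d \<le> m" "m \<le> K" for q d c m
  proof -
    have "K - (m - 1) = Suc (K - m)" using that by simp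
    then have "c (m - 1) = bop q S P *v (P *v mpow P (K - m) x)"
      using that by simp
    also have "P ** bop q S P = bop q S P ** P" by (rule bop_commute) (simp_all add: comm)
    then have "bop q S P *v (P *v mpow P (K - m) x) = P *v (bop q S P *v mpow P (K - m) x)"
      by (simp add: matrix_vector_mul_assoc)
    finally show ?thesis .
  qed
  show "\<exists>c. ?rep q d c"
    using d n
  proof (induction q arbitrary: d)
    case One
    have "(\<Sum>m\<le>K. z ^ m *s mpow P (K - m) x) =
        (\<Sum>m<n. z ^ m *s (if m \<le> K then mpow P (K - m) x else 0))" for z
      using One by (intro sum.mono_neutral_cong_left) auto
    then show ?case
      by (intro exI[of _ "\<lambda>m. if m \<le> K then mpow P (K - m) x else 0"]) auto
  next
    case (MulS q)
    obtain d' where d': "d = Suc d'" using MulS.prems by (cases d) auto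
    obtain c where c: "?rep q d' c" using MulS.IH[of d'] MulS.prems d' by auto
    have 0: "n > 0" "c (n - 1) = 0" using MulS.prems d' c by auto
    define c' where "c' m = A *v c m + (if m = 0 then 0 else A' *v c (m - 1))" for m
    have "bop (MulS q) (A + mat z ** A') (mat z) *v (\<Sum>m\<le>K. z ^ m *s mpow P (K - m) x) =
        (\<Sum>m<n. z ^ m *s c' m)" for z
      using shift_polynomial[of n "\<lambda>m. A' *v c m" z] 0
      unfolding bop.simps matrix_vector_mul_assoc[symmetric] conjunct1[OF c, rule_format]
      by (simp add: matrix_vector_mult_add_rdistrib mat_mult_vec c'_def vector_add_ldistrib
          sum.distrib matrix_vector_mult_sum vector_scalar_commute vec.scale_sum_right mult.commute
          flip: matrix_vector_mul_assoc)
    moreover have "c' m = 0" if "m > K + d" for m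
      using that d' c by (simp add: c'_def)
    moreover have "c' m = bop (MulS q) S P *v mpow P (K - m) x" if m: "d \<le> m" "m \<le> K" for m
    proof -
      have "c' m = A *v (bop q S P *v mpow P (K - m) x) + A' *v (P *v (bop q S P *v mpow P (K - m) x))"
        using m d' c step[OF c, of m] by (simp add: c'_def)
      then show ?thesis
        by (subst bop.simps, subst S) (simp add: matrix_vector_mult_add_rdistrib flip: matrix_vector_mul_assoc)
    qed
    ultimately show ?case by blast
  next
    case (MulP q)
    obtain d' where d': "d = Suc d'" using MulP.prems by (cases d) auto
    obtain c where c: "?rep q d' c" using MulP.IH[of d'] MulP.prems d' by auto
    have 0: "n > 0" "c (n - 1) = 0" using MulP.prems d' c by auto
    define c' where "c' m = (if m = 0 then 0 else c (m - 1))" for m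
    have "bop (MulP q) (A + mat z ** A') (mat z) *v (\<Sum>m\<le>K. z ^ m *s mpow P (K - m) x) =
        (\<Sum>m<n. z ^ m *s c' m)" for z
      unfolding bop.simps matrix_vector_mul_assoc[symmetric] conjunct1[OF c, rule_format] c'_def
        shift_polynomial[of n c, OF 0] mat_mult_vec ..
    moreover have "c' m = 0" if "m > K + d" for m
      using that d' c by (simp add: c'_def)
    moreover have "c' m = bop (MulP q) S P *v mpow P (K - m) x" if m: "d \<le> m" "m \<le> K" for m
      using m d' step[OF c, of m] by (simp add: c'_def flip: matrix_vector_mul_assoc)
    ultimately show ?case by blast
  next
    case (Add q r)
    obtain c where "?rep q d c" using Add.IH(1)[of d] Add.prems by auto
    moreover obtain e where "?rep r d e" using Add.IH(2)[of d] Add.prems by auto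
    ultimately show ?case
      by (intro exI[of _ "\<lambda>m. c m + e m"])
         (simp add: matrix_vector_mult_add_rdistrib vector_add_ldistrib sum.distrib)
  next
    case (Scl a q)
    obtain c where "?rep q d c" using Scl.IH[of d] Scl.prems by auto
    then show ?case
      by (intro exI[of _ "\<lambda>m. a *s c m"])
         (simp add: mat_mult_vec vec.scale_sum_right vector_smult_assoc mult.commute
           flip: matrix_vector_mul_assoc)
  qed
qed

text \<open>In finite dimension a strict decrease at each vector is uniform: the largest eigenvalue
  \<rho> of the \<open>L\<close>-adjoint of \<open>P\<close> times \<open>P\<close> is below
  1.\<close>

lemma mpow_herm_tendsto_0:
  fixes L P :: "complex^'n^'n"
  assumes L: "pos_def L" and P: "\<And>x. x \<noteq> 0 \<Longrightarrow> herm L (P *v x) < herm L x"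
  shows "(\<lambda>k. herm L (mpow P k x)) \<longlonglongrightarrow> 0"
proof -
  obtain L' where L': "L ** L' = mat 1" using pos_def_inverse[OF L] by metis
  have adjL: "adj L = L" using L by (simp add: pos_def_def)
  define H where "H = L' ** (adj P ** L ** P)"
  have LH: "L ** H = adj P ** L ** P"
    unfolding H_def by (subst matrix_mul_assoc) (simp add: L')
  have "adj (L ** H) = L ** H" by (simp add: LH adj_mult adjL matrix_mul_assoc)
  then obtain y \<rho> where y: "y \<noteq> 0" "H *v y = complex_of_real \<rho> *s y"
    and max: "\<And>x. herm (L ** H) x \<le> \<rho> * herm L x"
    using max_eigenvector[OF L, of H UNIV "1 :: complex^'n"] by auto
  have Ly: "herm L y > 0" using L y by (simp add: pos_def_def)
  have "\<rho> * herm L y = herm (L ** H) y"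
    using y by (simp add: herm_def vector_scalar_commute hdot_scale_left flip: matrix_vector_mul_assoc)
  also have "\<dots> = herm L (P *v y)" by (simp add: LH herm_mult)
  finally have \<rho>y: "\<rho> * herm L y = herm L (P *v y)" .
  then have "\<rho> * herm L y < 1 * herm L y" "\<rho> * herm L y \<ge> 0"
    using P[OF y(1)] pos_def_nonneg[OF L] by simp_all
  then have \<rho>: "\<rho> < 1" "\<rho> \<ge> 0"
    using Ly by (simp_all only: mult_less_cancel_right_pos zero_le_mult_iff) auto
  have step: "herm L (P *v x) \<le> \<rho> * herm L x" for x
    using max[of x] by (simp add: LH herm_mult)
  have bound: "herm L (mpow P k x) \<le> \<rho> ^ k * herm L x" for k
  proof (induction k)
    case (Suc k)
    show ?case
      using step[of "mpow P k x"] mult_left_mono[OF Suc \<rho>(2)] by (simp add: mult.assoc)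
  qed simp
  have "(\<lambda>k. \<rho> ^ k * herm L x) \<longlonglongrightarrow> 0"
    using \<rho> by (intro tendsto_mult_left_zero LIMSEQ_power_zero) auto
  then show ?thesis
    by (rule tendsto_sandwich[rotated 3, where f = "\<lambda>_. 0"])
       (auto simp: pos_def_nonneg[OF L] bound)
qed

text \<open>The strict hypothesis says that \<open>Phi \<omega>\<close> of the pair is a strict
  contraction for every unimodular \<omega>. Expanded, it becomes a numerical range bound for
  \<open>N\<close> against the defect form \<open>M\<close>, and the quotient \<open>A\<close> of
  the two is the fundamental operator of the pair.\<close>

theorem von_neumann_symm_bidisc:
  fixes L S P :: "complex^'n^'n"
  assumes L: "pos_def L" and comm: "S ** P = P ** S"
    and strict: "\<And>\<omega> x. norm \<omega> = 1 \<Longrightarrow> x \<noteq> 0 \<Longrightarrow>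
      herm L ((2 * \<omega>) *s (P *v x) - S *v x) < herm L (2 *s x - \<omega> *s (S *v x))"
    and bnd: "\<And>x. x \<in> symm_bidisc \<Longrightarrow> norm (bev q x) \<le> c"
  shows "herm L (bop q S P *v x) \<le> c^2 * herm L x"
proof -
  have adjL: "adj L = L" using L by (simp add: pos_def_def)
  define M where "M = L - adj P ** L ** P"
  define N where "N = L ** S - adj S ** L ** P"
  have adjM: "adj M = M"
    by (simp add: M_def adj_diff adj_mult adjL matrix_mul_assoc)
  have hM: "herm M x = herm L x - herm L (P *v x)" for x
  proof -
    have "herm M x = herm L x - herm (adj P ** L ** P) x"
      by (simp add: M_def herm_def matrix_vector_mult_diff_rdistrib hdot_diff_left)
    then show ?thesis by (simp add: herm_mult)
  qed
  \<comment> \<open>In the expansion of both sides of \<open>strict\<close> the terms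
    \<open>herm L (S *v x)\<close> cancel, and four times this inequality is left.\<close>
  have num_lt: "Re (\<omega> * hdot (N *v x) x) < herm M x" if \<omega>: "norm \<omega> = 1" and x: "x \<noteq> 0" for \<omega> x
  proof -
    have 1: "hdot (L *v (S *v x)) x = cnj (hdot (L *v x) (S *v x))"
      by (simp add: cnj_hdot hdot_adj adjL)
    have 2: "hdot (adj S *v (L *v (P *v x))) x = hdot (L *v (P *v x)) (S *v x)"
      by (simp add: hdot_adj)
    have N: "hdot (N *v x) x = cnj (hdot (L *v x) (S *v x)) - hdot (L *v (P *v x)) (S *v x)"
      by (simp add: N_def matrix_vector_mult_diff_rdistrib hdot_diff_left 1 2 flip: matrix_vector_mul_assoc)
    have a: "herm L (2 *s x - \<omega> *s (S *v x)) =
        4 * herm L x + herm L (S *v x) - 4 * Re (cnj \<omega> * hdot (L *v x) (S *v x))"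
    proof -
      have "2 *s x - \<omega> *s (S *v x) = 2 *s x + (-\<omega>) *s (S *v x)" by simp
      then show ?thesis
        unfolding \<open>2 *s x - \<omega> *s (S *v x) = 2 *s x + (-\<omega>) *s (S *v x)\<close> herm_add[OF adjL] herm_scale hdot_scale_right
        by (simp add: \<omega> vector_scalar_commute hdot_scale_left del: vector_smult_lneg)
    qed
    have b: "herm L ((2 * \<omega>) *s (P *v x) - S *v x) =
        4 * herm L (P *v x) + herm L (S *v x) - 4 * Re (\<omega> * hdot (L *v (P *v x)) (S *v x))"
    proof -
      have e: "(2 * \<omega>) *s (P *v x) - S *v x = (2 * \<omega>) *s (P *v x) + (-1) *s (S *v x)"
        by (simp add: vec_eq_iff)
      show ?thesis
        unfolding e herm_add[OF adjL] herm_scale hdot_scale_right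
        by (simp add: \<omega> norm_mult power_mult_distrib vector_scalar_commute hdot_scale_left mult.assoc del: vector_smult_lneg)
    qed
    have "Re (cnj \<omega> * hdot (L *v x) (S *v x)) = Re (\<omega> * cnj (hdot (L *v x) (S *v x)))"
      by simp
    then have "4 * Re (\<omega> * hdot (N *v x) x) < 4 * herm M x"
      using strict[OF \<omega> x] unfolding a b N hM right_diff_distrib minus_complex.sel by linarith
    then show ?thesis by simp
  qed
  have M: "pos_def M"
    unfolding pos_def_def
  proof (intro conjI allI impI adjM)
    fix x :: "complex^'n" assume "x \<noteq> 0"
    \<comment> \<open>Adding the cases \<omega> = 1 and \<omega> = -1 removes the numerical range
      term.\<close>
    then show "herm M x > 0" using num_lt[of 1 x] num_lt[of "-1" x] by simp
  qed
  have num: "norm (hdot (N *v x) x) \<le> herm M x" for x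
  proof (cases "hdot (N *v x) x = 0")
    case True
    then show ?thesis using pos_def_nonneg[OF M] by simp
  next
    case False
    define h where "h = hdot (N *v x) x"
    have "cnj h / norm h * h = of_real (norm h)"
      using False complex_norm_square[of h] by (simp add: h_def field_simps power2_eq_square)
    moreover have "x \<noteq> 0" using False by auto
    moreover have "norm (cnj h / norm h) = 1" using False by (simp add: h_def norm_divide)
    ultimately show ?thesis using num_lt[of "cnj h / norm h" x] by (simp add: h_def)
  qed
  obtain M' where M': "M ** M' = mat 1" "M' ** M = mat 1"
    using pos_def_inverse[OF M] .
  define A where "A = M' ** N"
  define A' where "A' = M' ** adj N"
  have MA: "M ** A = N" "M ** A' = adj N"
    by (simp_all add: A_def A'_def matrix_mul_assoc M')
  \<comment> \<open>The two terms in which \<open>L\<close> stands between the adjoint of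
    \<open>S\<close> and \<open>P\<close> cancel; commutativity matches the rest.\<close>
  have "M ** S = N + adj N ** P"
  proof (rule mat_eqI)
    fix x
    show "M ** S *v x = (N + adj N ** P) *v x"
      using arg_cong[OF comm, of "\<lambda>X. X *v x"]
      by (simp add: M_def N_def adj_diff adj_mult adjL matrix_vector_mult_diff_rdistrib
          matrix_vector_mult_add_rdistrib flip: matrix_vector_mul_assoc)
  qed
  then have "M' ** (M ** S) = A + A' ** P"
    by (simp add: A_def A'_def matrix_add_ldistrib matrix_mul_assoc)
  then have S: "S = A + A' ** P"
    by (simp add: matrix_mul_assoc M')
  define d where "d = bdeg q"
  define Q where "Q = bop q S P"
  have PQ: "Q *v mpow P k x = mpow P k (Q *v x)" for k x
    unfolding Q_def by (rule mpow_commute, rule bop_commute[symmetric]) (simp_all add: comm)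
  have telescope: "(\<Sum>k\<le>K. herm M (mpow P k y)) = herm L y - herm L (mpow P (Suc K) y)" for K y
    by (induction K) (simp_all add: hM)
  have key: "herm L (Q *v x) - herm L (mpow P (Suc j) (Q *v x)) \<le> c^2 * herm L x" for j
  proof -
    \<comment> \<open>The coefficients with index from \<open>d\<close> to \<open>K\<close> are
      reliable; they belong to the powers 0 to \<open>j\<close> of \<open>P\<close>. The choice of
      \<open>n\<close> exceeds the degree bound \<open>K + d\<close>, which makes Parseval
      exact.\<close>
    define K where "K = j + d"
    define n where "n = K + d + 1"
    have n: "n > 0" "K + d < n" by (simp_all add: n_def)
    define Y where "Y z = (\<Sum>m\<le>K. z ^ m *s mpow P (K - m) x)" for z
    obtain e where e: "\<And>z. bop q (A + mat z ** A') (mat z) *v Y z = (\<Sum>m<n. z ^ m *s e m)"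
      and eP: "\<And>m. d \<le> m \<Longrightarrow> m \<le> K \<Longrightarrow> e m = Q *v mpow P (K - m) x"
      using bop_pencil_coeffs[OF S comm, of q d K n x] n unfolding d_def Y_def Q_def by auto
    define y where "y m = (if m \<le> K then mpow P (K - m) x else 0)" for m
    have Yy: "Y z = (\<Sum>m<n. z ^ m *s y m)" for z
      unfolding Y_def by (intro sum.mono_neutral_cong_left) (auto simp: y_def n_def)
    have "real n * (\<Sum>m<n. herm M (e m)) =
        (\<Sum>l<n. herm M (bop q (A + mat (cis (2 * pi * real l / real n)) ** A')
            (mat (cis (2 * pi * real l / real n))) *v Y (cis (2 * pi * real l / real n))))"
      unfolding e parseval[OF adjM, symmetric] by simp
    also have "\<dots> \<le> (\<Sum>l<n. c^2 * herm M (Y (cis (2 * pi * real l / real n))))"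
      using num by (intro sum_mono pencil_contraction[OF M] bnd) (auto simp: MA)
    also have "\<dots> = real n * (c^2 * (\<Sum>m<n. herm M (y m)))"
      unfolding Yy sum_distrib_left[symmetric] parseval[OF adjM] by simp
    finally have "(\<Sum>m<n. herm M (e m)) \<le> c^2 * (\<Sum>m<n. herm M (y m))"
      using n by simp
    moreover have "(\<Sum>m<n. herm M (y m)) \<le> herm L x"
    proof -
      have "(\<Sum>m<n. herm M (y m)) = (\<Sum>m\<le>K. herm M (mpow P (K - m) x))"
        by (rule sum.mono_neutral_cong_right) (auto simp: y_def n_def)
      also have "\<dots> = (\<Sum>k\<le>K. herm M (mpow P k x))"
        using sum.nat_diff_reindex[of "\<lambda>k. herm M (mpow P k x)" "Suc K"]
        by (simp flip: lessThan_Suc_atMost)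
      finally show ?thesis
        using pos_def_nonneg[OF L] by (simp only: telescope) (simp add: le_diff_eq)
    qed
    \<comment> \<open>The reliable coefficients telescope; the others contribute nonnegative terms
      and are dropped.\<close>
    moreover have "herm L (Q *v x) - herm L (mpow P (Suc j) (Q *v x)) \<le> (\<Sum>m<n. herm M (e m))"
    proof -
      have "(\<Sum>k\<le>j. herm M (mpow P k (Q *v x))) = (\<Sum>m\<in>{d..K}. herm M (e m))"
        by (rule sum.reindex_bij_witness[of _ "\<lambda>m. K - m" "\<lambda>k. K - k"])
           (auto simp: K_def eP PQ)
      also have "\<dots> \<le> (\<Sum>m<n. herm M (e m))"
        by (rule sum_mono2) (auto simp: n_def pos_def_nonneg[OF M])
      finally show ?thesis by (simp only: telescope)
    qed
    ultimately show ?thesis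
      by (smt (verit) mult_left_mono zero_le_power2)
  qed
  have contr: "herm L (P *v x) < herm L x" if "x \<noteq> 0" for x
    using M that unfolding pos_def_def hM by auto
  have "(\<lambda>j. herm L (Q *v x) - herm L (mpow P (Suc j) (Q *v x))) \<longlonglongrightarrow> herm L (Q *v x) - 0"
    by (intro tendsto_diff tendsto_const
        filterlim_compose[OF mpow_herm_tendsto_0[OF L contr] filterlim_Suc])
  then have "herm L (Q *v x) - 0 \<le> c^2 * herm L x"
    by (rule LIMSEQ_le_const2) (use key in blast)
  then show ?thesis by (simp add: Q_def)
qed

section \<open>Holomorphic functions of two variables\<close>

definition pd1 :: "(complex \<times> complex \<Rightarrow> complex) \<Rightarrow> complex \<times> complex \<Rightarrow> complex" where
  "pd1 f x = deriv (\<lambda>z. f (z, snd x)) (fst x)"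

definition pd2 :: "(complex \<times> complex \<Rightarrow> complex) \<Rightarrow> complex \<times> complex \<Rightarrow> complex" where
  "pd2 f x = deriv (\<lambda>z. f (fst x, z)) (snd x)"

lemma has_derivative_line:
  fixes f :: "complex \<times> complex \<Rightarrow> complex"
  assumes "(f has_derivative (\<lambda>h. A * fst h + B * snd h)) (at (a + t * fst e, b + t * snd e))"
  shows "((\<lambda>t. f (a + t * fst e, b + t * snd e)) has_field_derivative (A * fst e + B * snd e)) (at t)"
proof -
  have line: "((\<lambda>t. (a + t * fst e, b + t * snd e)) has_derivative (\<lambda>h. (h * fst e, h * snd e))) (at t)"
    by (auto intro!: derivative_eq_intros)
  moreover have "(\<lambda>h. A * (h * fst e) + B * (h * snd e)) = (*) (A * fst e + B * snd e)"
    by (auto simp: fun_eq_iff algebra_simps)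
  ultimately show ?thesis
    using has_derivative_compose[OF line assms] by (simp add: has_field_derivative_def)
qed

lemma has_derivative_pd:
  fixes f :: "complex \<times> complex \<Rightarrow> complex"
  assumes "(f has_derivative (\<lambda>h. A * fst h + B * snd h)) (at x)"
  shows "A = pd1 f x" "B = pd2 f x"
proof -
  show "A = pd1 f x"
    using has_derivative_line[of f A B 0 "fst x" "(1, 0)" "snd x", THEN DERIV_imp_deriv] assms
    by (simp add: pd1_def)
  show "B = pd2 f x"
    using has_derivative_line[of f A B "fst x" "snd x" "(0, 1)" 0, THEN DERIV_imp_deriv] assms
    by (simp add: pd2_def)
qed

lemma holomorphic2_has_derivative:
  assumes "holomorphic2_on f S" "x \<in> S"
  shows "(f has_derivative (\<lambda>h. pd1 f x * fst h + pd2 f x * snd h)) (at x)"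
proof -
  obtain a b where ab: "(f has_derivative (\<lambda>h. a * fst h + b * snd h)) (at x)"
    using assms unfolding holomorphic2_on_def by blast
  then show ?thesis using has_derivative_pd[OF ab] by simp
qed

lemma holomorphic2_line:
  assumes "holomorphic2_on f S" "(a + t * u, b + t * v) \<in> S"
  shows "((\<lambda>t. f (a + t * u, b + t * v)) has_field_derivative
      (pd1 f (a + t * u, b + t * v) * u + pd2 f (a + t * u, b + t * v) * v)) (at t)"
  using has_derivative_line[of f _ _ a t "(u, v)" b] holomorphic2_has_derivative[OF assms] by simp

lemma holomorphic2_slice:
  assumes "holomorphic2_on f S" "(s, p) \<in> S"
  shows "((\<lambda>z. f (z, p)) has_field_derivative pd1 f (s, p)) (at s)"
    and "((\<lambda>z. f (s, z)) has_field_derivative pd2 f (s, p)) (at p)"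
  using holomorphic2_line[of f S 0 s 1 p 0] holomorphic2_line[of f S s p 0 0 1] assms by simp_all

lemma holomorphic2_continuous: "holomorphic2_on f S \<Longrightarrow> continuous_on S f"
  unfolding holomorphic2_on_def
  by (meson continuous_at_imp_continuous_on has_derivative_continuous)

lemma holomorphic2_subset: "holomorphic2_on f S \<Longrightarrow> T \<subseteq> S \<Longrightarrow> holomorphic2_on f T"
  unfolding holomorphic2_on_def by blast

lemma polydisc_subset:
  assumes "open S" "(s, p) \<in> S"
  obtains r where "r > 0" "cball s r \<times> cball p r \<subseteq> S"
proof -
  obtain A B where AB: "open A" "open B" "s \<in> A" "p \<in> B" "A \<times> B \<subseteq> S"
    using assms open_prod_elim by (metis mem_Sigma_iff)
  obtain r1 r2 where "r1 > 0" "cball s r1 \<subseteq> A" "r2 > 0" "cball p r2 \<subseteq> B"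
    using AB by (meson open_contains_cball)
  then have "cball s (min r1 r2) \<times> cball p (min r1 r2) \<subseteq> S"
    using AB by (auto simp: subset_iff)
  then show thesis using that \<open>r1 > 0\<close> \<open>r2 > 0\<close> by (metis min_less_iff_conj)
qed

section \<open>Cauchy integrals over circles and holomorphy in two variables\<close>

definition unitexp :: "real \<Rightarrow> complex" where
  "unitexp t = exp (2 * of_real pi * \<i> * of_real t)"

lemma continuous_on_unitexp [continuous_intros]: "continuous_on X unitexp"
  unfolding unitexp_def by (intro continuous_intros)

lemma norm_unitexp [simp]: "norm (unitexp t) = 1"
  by (simp add: unitexp_def)

lemma unitexp_nonzero [simp]: "unitexp t \<noteq> 0"
  by (simp add: unitexp_def)

lemma cauchy_mean_value:
  assumes "f holomorphic_on cball z r" "r > 0"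
  shows "f z = integral {0..1} (\<lambda>t. f (z + of_real r * unitexp t))"
proof -
  have "((\<lambda>u. f u / (u - z)) has_contour_integral 2 * of_real pi * \<i> * f z) (circlepath z r)"
    using assms by (intro Cauchy_integral_circlepath_simple) auto
  then have "2 * of_real pi * \<i> * f z =
      integral {0..1} (\<lambda>t. f (circlepath z r t) / (circlepath z r t - z) * vector_derivative (circlepath z r) (at t))"
    using contour_integral_unique contour_integral_integral[of "circlepath z r" "\<lambda>u. f u / (u - z)"]
    by (metis (mono_tags, lifting))
  also have "\<dots> = integral {0..1} (\<lambda>t. 2 * of_real pi * \<i> * f (z + of_real r * unitexp t))"
    using assms unfolding vector_derivative_circlepath by (simp add: circlepath unitexp_def field_simps)
  finally show ?thesis by simp
qed

lemma cauchy_deriv_mean_value: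
  assumes "f holomorphic_on cball z r" "r > 0"
  shows "deriv f z = integral {0..1} (\<lambda>t. inverse (of_real r * unitexp t) * f (z + of_real r * unitexp t))"
proof -
  have "(f has_field_derivative (1 / (2 * of_real pi * \<i>) * contour_integral(circlepath z r) (\<lambda>u. f u / (u-z)^2))) (at z)"
    using assms
    by (intro Cauchy_derivative_integral_circlepath(2) holomorphic_on_imp_continuous_on)
       (auto intro: holomorphic_on_subset)
  then have "2 * of_real pi * \<i> * deriv f z = contour_integral(circlepath z r) (\<lambda>u. f u / (u-z)^2)"
    by (simp add: DERIV_imp_deriv)
  also have "\<dots> = 
      integral {0..1} (\<lambda>t. f (circlepath z r t) / (circlepath z r t - z)^2 * vector_derivative (circlepath z r) (at t))"
    by (simp add: contour_integral_integral)
  also have "\<dots> = integral {0..1} (\<lambda>t. 2 * of_real pi * \<i> * (inverse (of_real r * unitexp t) * f (z + of_real r * unitexp t)))"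
    using assms unfolding vector_derivative_circlepath
    by (simp add: circlepath unitexp_def field_simps power2_eq_square)
  finally show ?thesis by simp
qed

text \<open>The radius \<rho> is the same for all points of \<open>U\<close>, so that circles of one
  radius represent a function and its derivatives on all of \<open>U\<close> at once.\<close>

lemma polydisc_neighbourhood:
  fixes x :: "complex \<times> complex"
  assumes "open S" "x \<in> S"
  obtains U \<rho> where "open U" "x \<in> U" "\<rho> > 0"
    "\<And>y z. y \<in> U \<Longrightarrow> dist (fst y) z \<le> \<rho> \<Longrightarrow> (z, snd y) \<in> S"
    "\<And>y z. y \<in> U \<Longrightarrow> dist (snd y) z \<le> \<rho> \<Longrightarrow> (fst y, z) \<in> S"
proof -
  obtain r where r: "r > 0" "cball (fst x) r \<times> cball (snd x) r \<subseteq> S"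
    using polydisc_subset[of S "fst x" "snd x"] assms by (metis prod.collapse)
  have near: "c \<in> cball a r" if "b \<in> ball a (r / 2)" "dist b c \<le> r / 2" for a b c :: complex
    using that dist_triangle[of a c b] by simp
  show thesis
  proof (rule that[of "ball (fst x) (r / 2) \<times> ball (snd x) (r / 2)" "r / 2"])
    show "x \<in> ball (fst x) (r / 2) \<times> ball (snd x) (r / 2)" using r(1) by (simp add: mem_Times_iff)
    fix y z assume y: "y \<in> ball (fst x) (r / 2) \<times> ball (snd x) (r / 2)"
    have near': "fst y \<in> cball (fst x) r" "snd y \<in> cball (snd x) r"
      using y r(1) near[of "fst y" "fst x" "fst y"] near[of "snd y" "snd x" "snd y"]
      by (simp_all add: mem_Times_iff)
    show "(z, snd y) \<in> S" if "dist (fst y) z \<le> r / 2"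
      using y that near[of "fst y" "fst x" z] near'
      by (intro subsetD[OF r(2)] SigmaI) (simp_all add: mem_Times_iff)
    show "(fst y, z) \<in> S" if "dist (snd y) z \<le> r / 2"
      using y that near[of "snd y" "snd x" z] near'
      by (intro subsetD[OF r(2)] SigmaI) (simp_all add: mem_Times_iff)
  qed (use r(1) in \<open>auto intro: open_Times\<close>)
qed

lemma pd2_mean_value:
  assumes diff: "\<And>s p. (s, p) \<in> S \<Longrightarrow> (\<lambda>z. f (s, z)) field_differentiable at p"
    and S: "\<And>z. dist (snd y) z \<le> \<rho> \<Longrightarrow> (fst y, z) \<in> S" and \<rho>: "\<rho> > 0"
  shows "pd2 f y = integral {0..1} (\<lambda>t. inverse (of_real \<rho> * unitexp t) * f (y + (0, of_real \<rho> * unitexp t)))"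
proof -
  have "(\<lambda>z. f (fst y, z)) holomorphic_on cball (snd y) \<rho>"
    unfolding holomorphic_on_def using field_differentiable_at_within[OF diff[OF S]] by simp
  from cauchy_deriv_mean_value[OF this \<rho>] show ?thesis
    by (simp add: pd2_def plus_prod_def)
qed

text \<open>Cauchy's formula writes the derivative as an integral over a circle of fixed radius,
  which depends continuously on its centre.\<close>

lemma continuous_on_pd2:
  fixes f :: "complex \<times> complex \<Rightarrow> complex"
  assumes S: "open S" and cont: "continuous_on S f"
    and diff: "\<And>s p. (s, p) \<in> S \<Longrightarrow> (\<lambda>z. f (s, z)) field_differentiable at p"
  shows "continuous_on S (pd2 f)"
proof (intro continuous_at_imp_continuous_on ballI)
  fix x assume "x \<in> S"
  then obtain U \<rho> where U: "open U" "x \<in> U" and \<rho>: "\<rho> > 0"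
    and inS: "\<And>y z. y \<in> U \<Longrightarrow> dist (snd y) z \<le> \<rho> \<Longrightarrow> (fst y, z) \<in> S"
    using polydisc_neighbourhood[OF S] by metis
  define \<gamma> where "\<gamma> t = (0 :: complex, of_real \<rho> * unitexp t)" for t
  have "continuous_on (U \<times> cbox 0 1) (\<lambda>x. fst x + \<gamma> (snd x))"
    unfolding \<gamma>_def by (intro continuous_intros continuous_on_compose2[OF continuous_on_unitexp[of UNIV]]) auto
  moreover have "fst x + \<gamma> (snd x) \<in> S" if "x \<in> U \<times> cbox 0 1" for x
    using inS[of "fst x"] that \<rho> by (auto simp: \<gamma>_def plus_prod_def dist_norm norm_mult)
  ultimately have "continuous_on (U \<times> cbox 0 1) (\<lambda>x. f (fst x + \<gamma> (snd x)))"
    by (intro continuous_on_compose2[OF cont]) auto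
  then have "continuous_on (U \<times> cbox 0 1) (\<lambda>(y, t). inverse (of_real \<rho> * unitexp t) * f (y + \<gamma> t))"
    using \<rho> unfolding split_beta
    by (intro continuous_intros continuous_on_compose2[OF continuous_on_unitexp[of UNIV]]) auto
  then have "continuous_on U (\<lambda>y. integral {0..1} (\<lambda>t. inverse (of_real \<rho> * unitexp t) * f (y + \<gamma> t)))"
    unfolding cbox_interval[symmetric] by (rule integral_continuous_on_param)
  then have "continuous_on U (pd2 f)"
    using pd2_mean_value[OF diff inS \<rho>] by (simp add: \<gamma>_def cong: continuous_on_cong)
  then show "isCont (pd2 f) x" using U by (simp add: continuous_on_eq_continuous_at)
qed

text \<open>Partial derivatives together with continuity of one of them give total
  differentiability; Cauchy's formula supplies that continuity for \<open>pd2 f\<close>.\<close>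

theorem osgood:
  fixes f :: "complex \<times> complex \<Rightarrow> complex"
  assumes S: "open S" and cont: "continuous_on S f"
    and d1: "\<And>s p. (s, p) \<in> S \<Longrightarrow> (\<lambda>z. f (z, p)) field_differentiable at s"
    and d2: "\<And>s p. (s, p) \<in> S \<Longrightarrow> (\<lambda>z. f (s, z)) field_differentiable at p"
  shows "holomorphic2_on f S"
  unfolding holomorphic2_on_def
proof
  fix x assume x: "x \<in> S"
  obtain s p where sp: "x = (s, p)" by fastforce
  obtain r where r: "r > 0" "cball s r \<times> cball p r \<subseteq> S"
    using polydisc_subset[OF S x[unfolded sp]] .
  define X Y where "X = ball s r" and "Y = ball p r"
  have XY: "X \<times> Y \<subseteq> S" "open X" "open Y" "s \<in> X" "p \<in> Y" "convex Y"
    using r by (auto simp: X_def Y_def)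
  have "((\<lambda>(x, y). f (x, y)) has_derivative
      (\<lambda>(tx, ty). pd1 f x * tx + blinfun_apply (blinfun_mult_right (pd2 f (s, p))) ty)) (at (s, p) within X \<times> Y)"
  proof (rule has_derivative_partialsI)
    have "((\<lambda>x. f (x, p)) has_field_derivative pd1 f x) (at s)"
      using field_differentiable_derivI[OF d1[of s p]] x by (simp add: sp pd1_def)
    then show "((\<lambda>x. f (x, p)) has_derivative (\<lambda>tx. pd1 f x * tx)) (at s within X)"
      by (rule has_field_derivative_imp_has_derivative[OF has_field_derivative_at_within])
    show "((\<lambda>y. f (x, y)) has_derivative blinfun_apply (blinfun_mult_right (pd2 f (x, y)))) (at y within Y)"
      if "x \<in> X" "y \<in> Y" for x y
    proof -
      have "(x, y) \<in> S" using XY(1) that by (intro subsetD[OF XY(1)] SigmaI)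
      then have "((\<lambda>y. f (x, y)) has_field_derivative pd2 f (x, y)) (at y)"
        using field_differentiable_derivI[OF d2[of x y]] by (simp add: pd2_def)
      then show ?thesis
        unfolding blinfun_mult_right.rep_eq
        by (rule has_field_derivative_imp_has_derivative[OF has_field_derivative_at_within])
    qed
    have "continuous_on (X \<times> Y) (pd2 f)"
      by (rule continuous_on_subset[OF continuous_on_pd2[OF S cont d2] XY(1)])
    then have "continuous (at (s, p) within X \<times> Y) (pd2 f)"
      using XY by (auto simp: continuous_on_eq_continuous_within)
    then show "continuous (at (s, p) within X \<times> Y) (\<lambda>(x, y). blinfun_mult_right (pd2 f (x, y)))"
      unfolding split_beta prod.collapse
      by (rule bounded_linear.continuous[OF bounded_linear_blinfun_mult_right])
  qed (use XY in auto)
  then have "(f has_derivative (\<lambda>h. pd1 f x * fst h + pd2 f x * snd h)) (at x within X \<times> Y)"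
    by (simp add: split_beta' sp)
  moreover have "at x within X \<times> Y = at x"
    using XY by (intro at_within_open) (auto simp: sp open_Times)
  ultimately show "\<exists>a b. (f has_derivative (\<lambda>h. a * fst h + b * snd h)) (at x)" by (intro exI[of _ "pd1 f x"] exI[of _ "pd2 f x"]) simp
qed

lemma continuous_on_pd2_holomorphic2:
  assumes "open S" "holomorphic2_on f S"
  shows "continuous_on S (pd2 f)"
  using assms
  by (intro continuous_on_pd2 holomorphic2_continuous) (auto simp: field_differentiable_def intro: holomorphic2_slice)

lemma holomorphic2_on_swap:
  assumes "holomorphic2_on f S"
  shows "holomorphic2_on (\<lambda>x. f (snd x, fst x)) ((\<lambda>x. (snd x, fst x)) -` S)"
  unfolding holomorphic2_on_def
proof
  fix x assume "x \<in> (\<lambda>x. (snd x, fst x)) -` S"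
  then have f: "(f has_derivative (\<lambda>h. pd1 f (snd x, fst x) * fst h + pd2 f (snd x, fst x) * snd h)) (at (snd x, fst x))"
    by (intro holomorphic2_has_derivative[OF assms]) simp
  have "((\<lambda>x. (snd x, fst x)) has_derivative (\<lambda>h. (snd h, fst h))) (at x)"
    by (auto intro!: derivative_eq_intros)
  from has_derivative_compose[OF this f]
  show "\<exists>a b. ((\<lambda>x. f (snd x, fst x)) has_derivative (\<lambda>h. a * fst h + b * snd h)) (at x)"
    by (intro exI[of _ "pd2 f (snd x, fst x)"] exI[of _ "pd1 f (snd x, fst x)"]) (simp add: add.commute)
qed

lemma open_swap: "open S \<Longrightarrow> open ((\<lambda>x :: complex \<times> complex. (snd x, fst x)) -` S)"
  by (intro open_vimage continuous_intros)

lemma pd1_swap: "pd1 f = (\<lambda>x. pd2 (\<lambda>x. f (snd x, fst x)) (snd x, fst x))"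
  by (simp add: pd1_def pd2_def fun_eq_iff)

lemma continuous_on_pd1_holomorphic2:
  assumes "open S" "holomorphic2_on f S"
  shows "continuous_on S (pd1 f)"
  unfolding pd1_swap
  by (rule continuous_on_compose2[OF continuous_on_pd2_holomorphic2[OF open_swap holomorphic2_on_swap]])
     (use assms in \<open>auto intro!: continuous_intros\<close>)

text \<open>The weight \<open>w\<close> and the path \<gamma> are left general because two integrals
  need it: Cauchy's formula for a derivative, and the circle means that fill in removable
  singularities.\<close>

lemma holomorphic2_integral:
  fixes g :: "complex \<times> complex \<Rightarrow> complex" and \<gamma> :: "real \<Rightarrow> complex \<times> complex"
  assumes S: "open S" and g: "holomorphic2_on g S"
    and \<gamma>: "continuous_on {0..1} \<gamma>" and w: "continuous_on {0..1} w"
    and U: "open U" and sub: "\<And>y t. y \<in> U \<Longrightarrow> t \<in> {0..1} \<Longrightarrow> y + \<gamma> t \<in> S"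
  shows "holomorphic2_on (\<lambda>y. integral {0..1} (\<lambda>t. w t * g (y + \<gamma> t))) U"
proof -
  have comp: "continuous_on (X \<times> {0..1}) (\<lambda>(x, t). w t * h (f x + \<gamma> t))"
    if "continuous_on S h" "continuous_on X f" "\<And>x. x \<in> X \<Longrightarrow> f x \<in> U"
    for h :: "complex \<times> complex \<Rightarrow> complex" and f :: "'c :: topological_space \<Rightarrow> complex \<times> complex" and X
  proof -
    have "continuous_on (X \<times> {0..1}) (\<lambda>x. w (snd x))"
      by (rule continuous_on_compose2[OF w continuous_on_snd[OF continuous_on_id]]) auto
    moreover have "continuous_on (X \<times> {0..1}) (\<lambda>x. \<gamma> (snd x))"
      by (rule continuous_on_compose2[OF \<gamma> continuous_on_snd[OF continuous_on_id]]) auto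
    moreover have "continuous_on (X \<times> {0..1}) (\<lambda>x. f (fst x))"
      by (rule continuous_on_compose2[OF that(2) continuous_on_fst[OF continuous_on_id]]) auto
    ultimately show ?thesis
      unfolding split_beta
      by (intro continuous_on_mult continuous_on_compose2[OF that(1)] continuous_on_add) (auto intro!: sub that)
  qed
  have int: "(\<lambda>t. w t * g (y + \<gamma> t)) integrable_on {0..1}" if "y \<in> U" for y
  proof (rule integrable_continuous_interval)
    have "continuous_on {0..1} (\<lambda>t. g (y + \<gamma> t))"
      by (rule continuous_on_compose2[OF holomorphic2_continuous[OF g]])
         (auto intro!: continuous_intros \<gamma> sub that)
    then show "continuous_on {0..1} (\<lambda>t. w t * g (y + \<gamma> t))"
      by (intro continuous_on_mult w)
  qed
  \<comment> \<open>One argument for both variables: \<open>L\<close> parametrises a line parallel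
    to an axis, and \<open>dg\<close> is the derivative of \<open>g\<close> along it.\<close>
  have deriv: "(\<lambda>z. integral {0..1} (\<lambda>t. w t * g (L z + \<gamma> t))) field_differentiable at x0"
    if r: "r > 0" and L: "continuous_on (ball x0 r) L" and LU: "\<And>x. x \<in> ball x0 r \<Longrightarrow> L x \<in> U"
      and dg: "continuous_on S dg" and d: "\<And>x t. L x + \<gamma> t \<in> S \<Longrightarrow>
        ((\<lambda>z. g (L z + \<gamma> t)) has_field_derivative dg (L x + \<gamma> t)) (at x)"
    for x0 r and L :: "complex \<Rightarrow> complex \<times> complex" and dg
  proof -
    have "((\<lambda>z. integral (cbox 0 1) (\<lambda>t. w t * g (L z + \<gamma> t))) has_field_derivative
        integral (cbox 0 1) (\<lambda>t. w t * dg (L x0 + \<gamma> t))) (at x0 within ball x0 r)"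
    proof (rule leibniz_rule_field_derivative)
      fix x t assume "x \<in> ball x0 r" and "t \<in> cbox 0 (1::real)"
      then have "((\<lambda>z. w t * g (L z + \<gamma> t)) has_field_derivative w t * dg (L x + \<gamma> t)) (at x)"
        by (intro DERIV_cmult d sub LU) (simp_all add: cbox_interval)
      then show "((\<lambda>z. w t * g (L z + \<gamma> t)) has_field_derivative w t * dg (L x + \<gamma> t)) (at x within ball x0 r)"
        by (rule has_field_derivative_at_within)
    next
      show "(\<lambda>t. w t * g (L x + \<gamma> t)) integrable_on cbox 0 1" if "x \<in> ball x0 r" for x
        using int[OF LU[OF that]] by (simp add: cbox_interval)
    next
      show "continuous_on (ball x0 r \<times> cbox 0 1) (\<lambda>(x, t). w t * dg (L x + \<gamma> t))"
        unfolding cbox_interval by (rule comp[OF dg L LU])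
    qed (use r in auto)
    then have "((\<lambda>z. integral {0..1} (\<lambda>t. w t * g (L z + \<gamma> t))) has_field_derivative
        integral {0..1} (\<lambda>t. w t * dg (L x0 + \<gamma> t))) (at x0)"
      using r by (simp add: cbox_interval at_within_open[of x0 "ball x0 r"])
    then show ?thesis by (auto simp: field_differentiable_def)
  qed
  show ?thesis
  proof (rule osgood[OF U])
    show "continuous_on U (\<lambda>y. integral {0..1} (\<lambda>t. w t * g (y + \<gamma> t)))"
      using integral_continuous_on_param[OF comp[OF holomorphic2_continuous[OF g] continuous_on_id, unfolded cbox_interval[symmetric]]]
      by (simp add: cbox_interval)
  next
    fix s p assume sp: "(s, p) \<in> U"
    obtain r where r: "r > 0" "cball s r \<times> cball p r \<subseteq> U"
      using polydisc_subset[OF U sp] .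
    have inU: "(a, b) \<in> U" if "a \<in> ball s r" "b \<in> ball p r" for a b
      using that r(2) ball_subset_cball by (intro subsetD[OF r(2)] SigmaI) auto
    show "(\<lambda>z. integral {0..1} (\<lambda>t. w t * g ((z, p) + \<gamma> t))) field_differentiable at s"
    proof (rule deriv[OF r(1) _ _ continuous_on_pd1_holomorphic2[OF S g]])
      fix x t assume "(x, p) + \<gamma> t \<in> S"
      then have "((\<lambda>z. g (z, p + snd (\<gamma> t))) has_field_derivative pd1 g ((x, p) + \<gamma> t)) (at (x + fst (\<gamma> t)))"
        using holomorphic2_slice(1)[OF g, of "x + fst (\<gamma> t)" "p + snd (\<gamma> t)"] by (simp add: plus_prod_def)
      then show "((\<lambda>z. g ((z, p) + \<gamma> t)) has_field_derivative pd1 g ((x, p) + \<gamma> t)) (at x)"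
        by (simp add: DERIV_shift plus_prod_def)
    qed (use r in \<open>auto intro!: continuous_intros inU\<close>)
    show "(\<lambda>z. integral {0..1} (\<lambda>t. w t * g ((s, z) + \<gamma> t))) field_differentiable at p"
    proof (rule deriv[OF r(1) _ _ continuous_on_pd2_holomorphic2[OF S g]])
      fix x t assume "(s, x) + \<gamma> t \<in> S"
      then have "((\<lambda>z. g (s + fst (\<gamma> t), z)) has_field_derivative pd2 g ((s, x) + \<gamma> t)) (at (x + snd (\<gamma> t)))"
        using holomorphic2_slice(2)[OF g, of "s + fst (\<gamma> t)" "x + snd (\<gamma> t)"] by (simp add: plus_prod_def)
      then show "((\<lambda>z. g ((s, z) + \<gamma> t)) has_field_derivative pd2 g ((s, x) + \<gamma> t)) (at x)"
        by (simp add: DERIV_shift plus_prod_def)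
    qed (use r in \<open>auto intro!: continuous_intros inU\<close>)
  qed
qed

lemma holomorphic2_cong:
  assumes "open U" "x \<in> U" "holomorphic2_on f U" "\<And>y. y \<in> U \<Longrightarrow> f y = g y"
  shows "\<exists>a b. (g has_derivative (\<lambda>h. a * fst h + b * snd h)) (at x)"
  using assms unfolding holomorphic2_on_def by (meson has_derivative_transform_within_open)

theorem holomorphic2_on_pd2:
  assumes S: "open S" and f: "holomorphic2_on f S"
  shows "holomorphic2_on (pd2 f) S"
  unfolding holomorphic2_on_def
proof
  fix x assume "x \<in> S"
  then obtain U \<rho> where U: "open U" "x \<in> U" and \<rho>: "\<rho> > 0"
    and inS: "\<And>y z. y \<in> U \<Longrightarrow> dist (snd y) z \<le> \<rho> \<Longrightarrow> (fst y, z) \<in> S"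
    using polydisc_neighbourhood[OF S] by metis
  have "holomorphic2_on (\<lambda>y. integral {0..1} (\<lambda>t. inverse (of_real \<rho> * unitexp t) * f (y + (0, of_real \<rho> * unitexp t)))) U"
    using inS \<rho> by (intro holomorphic2_integral[OF S f _ _ U(1)])
      (auto intro!: continuous_intros simp: plus_prod_def dist_norm norm_mult)
  moreover have "(\<lambda>z. f (s, z)) field_differentiable at p" if "(s, p) \<in> S" for s p
    using holomorphic2_slice(2)[OF f that] by (auto simp: field_differentiable_def)
  ultimately show "\<exists>a b. (pd2 f has_derivative (\<lambda>h. a * fst h + b * snd h)) (at x)"
    using holomorphic2_cong[OF U] pd2_mean_value[OF _ inS \<rho>] by simp
qed

theorem holomorphic2_on_pd1:
  assumes "open S" "holomorphic2_on f S"
  shows "holomorphic2_on (pd1 f) S"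
  unfolding pd1_swap
  using holomorphic2_on_swap[OF holomorphic2_on_pd2[OF open_swap holomorphic2_on_swap], of S f] assms
  by (simp add: vimage_def)

section \<open>Geometry of the symmetrized bidisc\<close>

lemma norm_sum_defect_le:
  assumes "norm z < 1" "norm w < 1"
  shows "norm (z + w - cnj (z + w) * (z * w)) \<le> norm z * (1 - (norm w)^2) + norm w * (1 - (norm z)^2)"
proof -
  have "z + w - cnj (z + w) * (z * w) = z * (1 - w * cnj w) + w * (1 - z * cnj z)"
    by (simp add: algebra_simps)
  also have "\<dots> = z * of_real (1 - (norm w)^2) + w * of_real (1 - (norm z)^2)"
    by (simp add: complex_norm_square[symmetric])
  finally have eq: "z + w - cnj (z + w) * (z * w) = z * of_real (1 - (norm w)^2) + w * of_real (1 - (norm z)^2)" .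
  have "norm (z + w - cnj (z + w) * (z * w)) \<le> norm (z * of_real (1 - (norm w)^2)) + norm (w * of_real (1 - (norm z)^2))"
    unfolding eq by (rule norm_triangle_ineq)
  also have "\<dots> = norm z * (1 - (norm w)^2) + norm w * (1 - (norm z)^2)"
    using assms power_le_one[of "norm z" 2] power_le_one[of "norm w" 2]
    unfolding norm_mult norm_of_real by simp
  finally show ?thesis .
qed

text \<open>Let a, b be the moduli of the two roots. Both directions compare |s - cnj s p| with (a +
  b)(1 - ab): the triangle inequality bounds it above if both roots lie in the disc, and the reverse
  one bounds it below if a \<ge> 1 > b. What remains is the sign of (1 - ab)(1 - a)(1 - b). Openness
  of the domain is immediate from this description.\<close>

lemma symm_bidisc_iff:
  "(s, p) \<in> symm_bidisc \<longleftrightarrow> norm (s - cnj s * p) < 1 - (norm p)^2"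
proof
  assume "(s, p) \<in> symm_bidisc"
  then obtain z w where zw: "s = z + w" "p = z * w" "norm z < 1" "norm w < 1"
    by (auto simp: symm_bidisc_def)
  define a b where "a = norm z" and "b = norm w"
  have ab: "0 \<le> a" "a < 1" "0 \<le> b" "b < 1" using zw by (auto simp: a_def b_def)
  have "norm (s - cnj s * p) \<le> a * (1 - b^2) + b * (1 - a^2)"
    using norm_sum_defect_le[OF zw(3,4)] unfolding zw(1,2) a_def b_def .
  also have "\<dots> = 1 - (a * b)^2 - (1 - a * b) * ((1 - a) * (1 - b))"
    by (simp add: algebra_simps power2_eq_square)
  also have "\<dots> < 1 - (a * b)^2"
  proof -
    have "a * b < 1" using ab mult_left_le[of b a] by linarith
    then have "(1 - a * b) * ((1 - a) * (1 - b)) > 0" using ab by simp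
    then show ?thesis by simp
  qed
  finally show "norm (s - cnj s * p) < 1 - (norm p)^2"
    by (simp add: zw a_def b_def norm_mult)
next
  assume le: "norm (s - cnj s * p) < 1 - (norm p)^2"
  define d where "d = csqrt (s^2 - 4 * p)"
  have d2: "d * d = s^2 - 4 * p" by (simp add: d_def flip: power2_eq_square)
  have roots: "s = (s + d) / 2 + (s - d) / 2" "p = ((s + d) / 2) * ((s - d) / 2)"
    using d2 by (simp_all add: field_simps power2_eq_square)
  have bound: "norm z < 1" if zw: "s = z + w" "p = z * w" for z w
  proof (rule ccontr)
    assume "\<not> norm z < 1"
    define a b where "a = norm z" and "b = norm w"
    have a: "a \<ge> 1" "b \<ge> 0" using \<open>\<not> norm z < 1\<close> by (auto simp: a_def b_def)
    have "(norm p)^2 < 1" using le norm_ge_zero[of "s - cnj s * p"] by linarith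
    then have "(a * b)^2 < 1^2" by (simp add: zw(2) a_def b_def norm_mult)
    then have ab: "a * b < 1" by (rule power2_less_imp_less) simp
    then have b: "b < 1" using a mult_right_mono[of 1 a b] by linarith
    have "s - cnj s * p = z * (1 - w * cnj w) - w * (z * cnj z - 1)"
      by (simp add: zw algebra_simps)
    also have "\<dots> = z * of_real (1 - b^2) - w * of_real (a^2 - 1)"
      by (simp add: a_def b_def complex_norm_square[symmetric])
    finally have eq: "s - cnj s * p = z * of_real (1 - b^2) - w * of_real (a^2 - 1)" .
    have "norm (z * of_real (1 - b^2)) - norm (w * of_real (a^2 - 1)) \<le> norm (s - cnj s * p)"
      unfolding eq by (rule norm_triangle_ineq2)
    moreover have "norm (z * of_real (1 - b^2)) = a * (1 - b^2)"
      using a b power_le_one[of b 2] unfolding norm_mult norm_of_real a_def[symmetric] by simp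
    moreover have "norm (w * of_real (a^2 - 1)) = b * (a^2 - 1)"
      using a b one_le_power[of a 2] unfolding norm_mult norm_of_real b_def[symmetric] by simp
    ultimately have "a * (1 - b^2) - b * (a^2 - 1) \<le> norm (s - cnj s * p)"
      by simp
    then have "a * (1 - b^2) - b * (a^2 - 1) < 1 - (a * b)^2"
    proof -
      have "(norm p)^2 = (a * b)^2" by (simp add: zw(2) a_def b_def norm_mult)
      with \<open>a * (1 - b^2) - b * (a^2 - 1) \<le> norm (s - cnj s * p)\<close> le show ?thesis by linarith
    qed
    then have "(1 - a * b) * ((a - 1) * (1 - b)) < 0"
      by (simp add: algebra_simps power2_eq_square)
    moreover have "(1 - a * b) * ((a - 1) * (1 - b)) \<ge> 0"
      using a b ab by simp
    ultimately show False by simp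
  qed
  have "norm ((s + d) / 2) < 1" using bound[OF roots] .
  moreover have "norm ((s - d) / 2) < 1"
    using bound[of "(s - d) / 2" "(s + d) / 2"] roots by (metis add.commute mult.commute)
  ultimately show "(s, p) \<in> symm_bidisc"
    unfolding symm_bidisc_def using roots by blast
qed

lemma open_symm_bidisc: "open symm_bidisc"
proof -
  have "symm_bidisc = {x. norm (fst x - cnj (fst x) * snd x) < 1 - (norm (snd x))^2}"
    using symm_bidisc_iff by auto
  moreover have "open \<dots>"
    by (intro open_Collect_less continuous_intros)
  ultimately show ?thesis by simp
qed

lemma symm_bidisc_scale:
  assumes "(s, p) \<in> symm_bidisc" "norm \<zeta> \<le> 1"
  shows "(\<zeta> * s, \<zeta>^2 * p) \<in> symm_bidisc"
proof -
  obtain z w where zw: "s = z + w" "p = z * w" "norm z < 1" "norm w < 1"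
    using assms(1) by (auto simp: symm_bidisc_def)
  have "norm (\<zeta> * z) < 1" "norm (\<zeta> * w) < 1"
    using zw assms(2) mult_left_le_one_le[of "norm z" "norm \<zeta>"] mult_left_le_one_le[of "norm w" "norm \<zeta>"]
    by (auto simp: norm_mult)
  then show ?thesis
    unfolding symm_bidisc_def zw
    by (intro CollectI exI[of _ "\<zeta> * z"] exI[of _ "\<zeta> * w"]) (auto simp: algebra_simps power2_eq_square)
qed

lemma zero_in_symm_bidisc: "(0, 0) \<in> symm_bidisc"
  by (simp add: symm_bidisc_iff)

section \<open>Uniform polynomial approximation of dilates\<close>

lemma holomorphic2_scale:
  assumes "holomorphic2_on H S" "(\<zeta> * s, \<zeta>^2 * p) \<in> S"
  shows "((\<lambda>\<zeta>. H (\<zeta> * s, \<zeta>^2 * p)) has_field_derivative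
     (pd1 H (\<zeta> * s, \<zeta>^2 * p) * s + pd2 H (\<zeta> * s, \<zeta>^2 * p) * (2 * \<zeta> * p))) (at \<zeta>)"
proof -
  have *: "((\<lambda>\<zeta>. (\<zeta> * s, \<zeta>^2 * p)) has_derivative (\<lambda>h. (h * s, h * (2 * \<zeta> * p)))) (at \<zeta>)"
    by (auto intro!: derivative_eq_intros simp: fun_eq_iff algebra_simps)
  have "(\<lambda>h. pd1 H (\<zeta> * s, \<zeta>^2 * p) * (h * s) + pd2 H (\<zeta> * s, \<zeta>^2 * p) * (h * (2 * \<zeta> * p))) =
      (*) (pd1 H (\<zeta> * s, \<zeta>^2 * p) * s + pd2 H (\<zeta> * s, \<zeta>^2 * p) * (2 * \<zeta> * p))"
    by (auto simp: fun_eq_iff algebra_simps)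
  then show ?thesis
    using has_derivative_compose[OF * holomorphic2_has_derivative[OF assms]]
    by (simp add: has_field_derivative_def)
qed

text \<open>Along the curves \<^term>\<open>\<lambda>\<zeta>. (\<zeta> * s, \<zeta>\<^sup>2 * p)\<close> the Taylor coefficients of a holomorphic function
  are polynomials in $s$ and $p$; the factor \<^term>\<open>\<zeta> ^ m\<close> makes the induction go through.\<close>
lemma taylor_coeff_bpoly:
  assumes "holomorphic2_on H symm_bidisc"
  shows "\<exists>q. \<forall>s p. (deriv ^^ n) (\<lambda>\<zeta>. \<zeta> ^ m * H (\<zeta> * s, \<zeta>^2 * p)) 0 = bev q (s, p)"
  using assms
proof (induction n arbitrary: m H)
  case 0
  show ?case by (intro exI[of _ "Scl (0 ^ m * H (0, 0)) One"]) simp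
next
  case (Suc n)
  note pd = holomorphic2_on_pd1[OF open_symm_bidisc Suc.prems] holomorphic2_on_pd2[OF open_symm_bidisc Suc.prems]
  \<comment> \<open>For \<open>m = 0\<close> the truncated exponent \<open>m - 1\<close> is
    harmless, since this term carries the factor \<open>of_nat m\<close>.\<close>
  obtain q0 where q0: "\<And>s p. (deriv ^^ n) (\<lambda>\<zeta>. \<zeta> ^ (m - 1) * H (\<zeta> * s, \<zeta>^2 * p)) 0 = bev q0 (s, p)"
    using Suc.IH[OF Suc.prems] by blast
  obtain q1 where q1: "\<And>s p. (deriv ^^ n) (\<lambda>\<zeta>. \<zeta> ^ m * pd1 H (\<zeta> * s, \<zeta>^2 * p)) 0 = bev q1 (s, p)"
    using Suc.IH[OF pd(1)] by blast
  \<comment> \<open>The inner derivative \<open>2 * \<zeta> * p\<close> of the second coordinate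
    raises the power of \<zeta> by one.\<close>
  obtain q2 where q2: "\<And>s p. (deriv ^^ n) (\<lambda>\<zeta>. \<zeta> ^ (m + 1) * pd2 H (\<zeta> * s, \<zeta>^2 * p)) 0 = bev q2 (s, p)"
    using Suc.IH[OF pd(2)] by blast
  have "(deriv ^^ Suc n) (\<lambda>\<zeta>. \<zeta> ^ m * H (\<zeta> * s, \<zeta>^2 * p)) 0 =
      of_nat m * bev q0 (s, p) + s * bev q1 (s, p) + 2 * (p * bev q2 (s, p))" for s p
  proof -
    define U where "U = (\<lambda>\<zeta>. (\<zeta> * s, \<zeta>^2 * p)) -` symm_bidisc"
    have U: "open U" "0 \<in> U"
      unfolding U_def by (auto intro!: open_vimage open_symm_bidisc continuous_intros simp: zero_in_symm_bidisc)
    have hol: "(\<lambda>\<zeta>. K (\<zeta> * s, \<zeta>^2 * p)) holomorphic_on U" if "holomorphic2_on K symm_bidisc" for K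
      using holomorphic2_scale[OF that] U by (auto simp: holomorphic_on_open U_def)
    define f0 f1 f2 where "f0 = (\<lambda>\<zeta>. of_nat m * (\<zeta> ^ (m - 1) * H (\<zeta> * s, \<zeta>^2 * p)))"
      and "f1 = (\<lambda>\<zeta>. s * (\<zeta> ^ m * pd1 H (\<zeta> * s, \<zeta>^2 * p)))"
      and "f2 = (\<lambda>\<zeta>. (2 * p) * (\<zeta> ^ (m + 1) * pd2 H (\<zeta> * s, \<zeta>^2 * p)))"
    have f: "f0 holomorphic_on U" "f1 holomorphic_on U" "f2 holomorphic_on U"
      unfolding f0_def f1_def f2_def by (intro holomorphic_intros hol Suc.prems pd)+
    have "deriv (\<lambda>\<zeta>. \<zeta> ^ m * H (\<zeta> * s, \<zeta>^2 * p)) \<zeta> = (f0 \<zeta> + f1 \<zeta>) + f2 \<zeta>" if "\<zeta> \<in> U" for \<zeta>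
    proof (rule DERIV_imp_deriv)
      show "((\<lambda>\<zeta>. \<zeta> ^ m * H (\<zeta> * s, \<zeta>^2 * p)) has_field_derivative (f0 \<zeta> + f1 \<zeta>) + f2 \<zeta>) (at \<zeta>)"
      proof (rule DERIV_cong[OF DERIV_mult[OF _ holomorphic2_scale[OF Suc.prems]]])
        show "((\<lambda>\<zeta>. \<zeta> ^ m) has_field_derivative of_nat m * \<zeta> ^ (m - 1)) (at \<zeta>)"
          by (auto intro!: derivative_eq_intros)
        show "(\<zeta> * s, \<zeta>^2 * p) \<in> symm_bidisc" using that by (simp add: U_def)
      qed (simp add: f0_def f1_def f2_def algebra_simps)
    qed
    then have "eventually (\<lambda>\<zeta>. deriv (\<lambda>\<zeta>. \<zeta> ^ m * H (\<zeta> * s, \<zeta>^2 * p)) \<zeta> = (f0 \<zeta> + f1 \<zeta>) + f2 \<zeta>) (nhds 0)"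
      using U by (intro eventually_mono[OF eventually_nhds_in_open[OF U]])
    then have "(deriv ^^ n) (deriv (\<lambda>\<zeta>. \<zeta> ^ m * H (\<zeta> * s, \<zeta>^2 * p))) 0 =
        (deriv ^^ n) (\<lambda>\<zeta>. (f0 \<zeta> + f1 \<zeta>) + f2 \<zeta>) 0"
      by (rule higher_deriv_cong_ev) simp
    also have "\<dots> = (deriv ^^ n) f0 0 + (deriv ^^ n) f1 0 + (deriv ^^ n) f2 0"
      using f U by (simp add: higher_deriv_add[of _ U] holomorphic_on_add)
    also have "(deriv ^^ n) f0 0 = of_nat m * bev q0 (s, p)"
      unfolding f0_def q0[symmetric]
      by (intro higher_deriv_cmult[where A = U] U holomorphic_intros hol Suc.prems)
    also have "(deriv ^^ n) f1 0 = s * bev q1 (s, p)"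
      unfolding f1_def q1[symmetric]
      by (intro higher_deriv_cmult[where A = U] U holomorphic_intros hol pd)
    also have "(deriv ^^ n) f2 0 = 2 * (p * bev q2 (s, p))"
      unfolding f2_def q2[symmetric] mult.assoc[symmetric]
      by (subst mult.assoc, intro higher_deriv_cmult[where A = U] U holomorphic_intros hol pd)
    finally show ?thesis by (simp only: funpow_Suc_right o_apply)
  qed
  then show ?case
    by (intro exI[of _ "Add (Add (Scl (of_nat m) q0) (MulS q1)) (Scl 2 (MulP q2))"]) simp
qed

text \<open>Along the curves through the origin the Cauchy estimates are uniform in (s, p), and
  evaluating at \<zeta> = r < 1 leaves a geometric tail. Hence one Taylor polynomial works on the
  whole domain for the dilate, although \<open>F\<close> itself may have no uniform polynomial
  approximation.\<close>

theorem bpoly_approximation: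
  assumes F: "holomorphic2_on F symm_bidisc" "\<And>x. x \<in> symm_bidisc \<Longrightarrow> norm (F x) \<le> 1"
    and r: "0 < r" "r < 1" and e: "e > 0"
  shows "\<exists>q. \<forall>(s, p)\<in>symm_bidisc. norm (bev q (s, p) - F (of_real r * s, (of_real r)^2 * p)) \<le> e"
proof -
  \<comment> \<open>Any radius strictly between \<open>r\<close> and 1 would do; the ratio
    \<open>x\<close> of the geometric bound is r / \<rho>.\<close>
  define \<rho> where "\<rho> = (1 + r) / 2"
  define x where "x = r / \<rho>"
  have \<rho>: "r < \<rho>" "\<rho> < 1" "\<rho> > 0" using r by (auto simp: \<rho>_def)
  then have x: "0 < x" "x < 1" using r by (auto simp: x_def)
  define a where "a n s p = (deriv ^^ n) (\<lambda>\<zeta>. F (\<zeta> * s, \<zeta>^2 * p)) 0 / fact n * of_real r ^ n" for n s p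
  have hol: "(\<lambda>\<zeta>. F (\<zeta> * s, \<zeta>^2 * p)) holomorphic_on cball 0 1" if "(s, p) \<in> symm_bidisc" for s p
    using holomorphic2_scale[OF F(1) symm_bidisc_scale[OF that]]
    unfolding holomorphic_on_def field_differentiable_def
    by (meson has_field_derivative_at_within mem_cball_0)
  have sums: "(\<lambda>n. a n s p) sums F (of_real r * s, (of_real r)^2 * p)" if "(s, p) \<in> symm_bidisc" for s p
    using holomorphic_power_series[of "\<lambda>\<zeta>. F (\<zeta> * s, \<zeta>^2 * p)" 0 1 "of_real r"]
      holomorphic_on_subset[OF hol[OF that] ball_subset_cball] r
    by (simp add: a_def)
  have bound: "norm (a n s p) \<le> x ^ n" if sp: "(s, p) \<in> symm_bidisc" for n s p
  proof -
    have "norm ((deriv ^^ n) (\<lambda>\<zeta>. F (\<zeta> * s, \<zeta>^2 * p)) 0) \<le> fact n * 1 / \<rho> ^ n"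
    proof (rule Cauchy_inequality)
      show "(\<lambda>\<zeta>. F (\<zeta> * s, \<zeta>^2 * p)) holomorphic_on ball 0 \<rho>"
        by (rule holomorphic_on_subset[OF hol[OF sp]]) (use \<rho> in auto)
      show "continuous_on (cball 0 \<rho>) (\<lambda>\<zeta>. F (\<zeta> * s, \<zeta>^2 * p))"
        by (intro holomorphic_on_imp_continuous_on holomorphic_on_subset[OF hol[OF sp]]) (use \<rho> in auto)
      show "norm (F (\<zeta> * s, \<zeta>^2 * p)) \<le> 1" if "norm (0 - \<zeta>) = \<rho>" for \<zeta>
        using that \<rho> by (intro F symm_bidisc_scale sp) auto
    qed (use \<rho> in simp)
    then have "norm ((deriv ^^ n) (\<lambda>\<zeta>. F (\<zeta> * s, \<zeta>^2 * p)) 0) / fact n \<le> 1 / \<rho> ^ n"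
      by (simp add: divide_le_eq mult.commute)
    then have "norm ((deriv ^^ n) (\<lambda>\<zeta>. F (\<zeta> * s, \<zeta>^2 * p)) 0) / fact n * r ^ n \<le> 1 / \<rho> ^ n * r ^ n"
      using r by (intro mult_right_mono) auto
    then show ?thesis
      using r by (simp add: a_def norm_mult norm_divide norm_power x_def power_divide)
  qed
  have "(\<lambda>n. x ^ n / (1 - x)) \<longlonglongrightarrow> 0 / (1 - x)"
    using x by (intro tendsto_divide LIMSEQ_power_zero tendsto_const) auto
  then have "eventually (\<lambda>n. x ^ n / (1 - x) < e) sequentially"
    using e by (auto dest: order_tendstoD)
  then obtain N where N: "x ^ N / (1 - x) < e" by (auto simp: eventually_sequentially)
  have "\<exists>q. \<forall>s p. (\<Sum>n<N. a n s p) = bev q (s, p)"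
  proof (induction N)
    case 0
    show ?case by (intro exI[of _ "Scl 0 One"]) simp
  next
    case (Suc n)
    then obtain q where "\<And>s p. (\<Sum>n<n. a n s p) = bev q (s, p)" by blast
    moreover obtain q' where "\<And>s p. (deriv ^^ n) (\<lambda>\<zeta>. \<zeta> ^ 0 * F (\<zeta> * s, \<zeta>^2 * p)) 0 = bev q' (s, p)"
      using taylor_coeff_bpoly[OF F(1)] by blast
    ultimately show ?case
      by (intro exI[of _ "Add q (Scl (of_real r ^ n / fact n) q')"]) (simp add: a_def)
  qed
  then obtain q where q: "\<And>s p. (\<Sum>n<N. a n s p) = bev q (s, p)" by blast
  show ?thesis
  proof (intro exI[of _ q] ballI, clarify)
    fix s p assume sp: "(s, p) \<in> symm_bidisc"
    have "(\<lambda>n. a (n + N) s p) sums (F (of_real r * s, (of_real r)^2 * p) - bev q (s, p))"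
      using sums_split_initial_segment[OF sums[OF sp], of N] by (simp add: q)
    moreover have "(\<lambda>n. x ^ (n + N)) sums (x ^ N / (1 - x))"
      using sums_mult[OF geometric_sums[of x], of "x ^ N"] x by (simp add: power_add mult.commute)
    ultimately have "norm (F (of_real r * s, (of_real r)^2 * p) - bev q (s, p)) \<le> x ^ N / (1 - x)"
      using bound[OF sp] norm_suminf_le[of "\<lambda>n. a (n + N) s p" "\<lambda>n. x ^ (n + N)"]
      by (simp add: sums_iff)
    then show "norm (bev q (s, p) - F (of_real r * s, (of_real r)^2 * p)) \<le> e"
      using N by (simp add: norm_minus_commute)
  qed
qed

section \<open>Removable singularities of bounded quotients\<close>

named_theorems holomorphic2_intros

lemma holomorphic2_onI:
  "(\<And>x. x \<in> S \<Longrightarrow> (f has_derivative (\<lambda>h. a x * fst h + b x * snd h)) (at x)) \<Longrightarrow> holomorphic2_on f S"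
  unfolding holomorphic2_on_def by blast

lemma holomorphic2_on_const [holomorphic2_intros]: "holomorphic2_on (\<lambda>x. c) S"
  by (rule holomorphic2_onI[of _ _ "\<lambda>_. 0" "\<lambda>_. 0"]) simp

lemma holomorphic2_on_fst [holomorphic2_intros]: "holomorphic2_on fst S"
  by (rule holomorphic2_onI[of _ _ "\<lambda>_. 1" "\<lambda>_. 0"]) (auto intro!: derivative_eq_intros)

lemma holomorphic2_on_snd [holomorphic2_intros]: "holomorphic2_on snd S"
  by (rule holomorphic2_onI[of _ _ "\<lambda>_. 0" "\<lambda>_. 1"]) (auto intro!: derivative_eq_intros)

lemma has_derivative_add_pd:
  assumes "holomorphic2_on f S" "holomorphic2_on g S" "x \<in> S"
  shows "((\<lambda>x. f x + g x) has_derivative (\<lambda>h. (pd1 f x + pd1 g x) * fst h + (pd2 f x + pd2 g x) * snd h)) (at x)"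
  using has_derivative_add[OF assms(1,2)[THEN holomorphic2_has_derivative, OF assms(3)]]
  by (simp add: algebra_simps)

lemma has_derivative_mult_pd:
  assumes "holomorphic2_on f S" "holomorphic2_on g S" "x \<in> S"
  shows "((\<lambda>x. f x * g x) has_derivative
      (\<lambda>h. (f x * pd1 g x + pd1 f x * g x) * fst h + (f x * pd2 g x + pd2 f x * g x) * snd h)) (at x)"
  using has_derivative_mult[OF assms(1,2)[THEN holomorphic2_has_derivative, OF assms(3)]]
  by (simp add: algebra_simps)

lemma holomorphic2_on_add [holomorphic2_intros]:
  "holomorphic2_on f S \<Longrightarrow> holomorphic2_on g S \<Longrightarrow> holomorphic2_on (\<lambda>x. f x + g x) S"
  by (rule holomorphic2_onI[OF has_derivative_add_pd])

lemma holomorphic2_on_mult [holomorphic2_intros]: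
  "holomorphic2_on f S \<Longrightarrow> holomorphic2_on g S \<Longrightarrow> holomorphic2_on (\<lambda>x. f x * g x) S"
  by (rule holomorphic2_onI[OF has_derivative_mult_pd])

lemma holomorphic2_on_diff [holomorphic2_intros]:
  assumes "holomorphic2_on f S" "holomorphic2_on g S"
  shows "holomorphic2_on (\<lambda>x. f x - g x) S"
  using holomorphic2_on_add[OF assms(1) holomorphic2_on_mult[OF holomorphic2_on_const[of "-1"] assms(2)]]
  by simp

lemma holomorphic2_on_divide [holomorphic2_intros]:
  assumes "holomorphic2_on f S" "holomorphic2_on g S" and nz: "\<And>x. x \<in> S \<Longrightarrow> g x \<noteq> 0"
  shows "holomorphic2_on (\<lambda>x. f x / g x) S"
proof (rule holomorphic2_onI)
  fix x assume x: "x \<in> S"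
  have eq: "((pd1 f x * fst h + pd2 f x * snd h) * g x - f x * (pd1 g x * fst h + pd2 g x * snd h)) / (g x * g x) =
      ((pd1 f x * g x - f x * pd1 g x) / (g x * g x)) * fst h + ((pd2 f x * g x - f x * pd2 g x) / (g x * g x)) * snd h" for h
    by (simp add: add_divide_distrib diff_divide_distrib algebra_simps)
  from has_derivative_divide'[OF holomorphic2_has_derivative[OF assms(1) x] holomorphic2_has_derivative[OF assms(2) x] nz[OF x]]
  show "((\<lambda>x. f x / g x) has_derivative
      (\<lambda>h. ((pd1 f x * g x - f x * pd1 g x) / (g x * g x)) * fst h + ((pd2 f x * g x - f x * pd2 g x) / (g x * g x)) * snd h)) (at x)"
    unfolding eq .
qed

definition cscale :: "complex \<Rightarrow> complex \<times> complex \<Rightarrow> complex \<times> complex" where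
  "cscale \<zeta> e = (\<zeta> * fst e, \<zeta> * snd e)"

lemma norm_cscale: "norm (cscale \<zeta> e) = norm \<zeta> * norm e"
proof -
  have "(norm \<zeta> * norm (fst e))^2 + (norm \<zeta> * norm (snd e))^2 = (norm \<zeta>)^2 * ((norm (fst e))^2 + (norm (snd e))^2)"
    by (simp add: power_mult_distrib algebra_simps)
  then show ?thesis
    by (simp add: cscale_def norm_prod_def norm_mult real_sqrt_mult)
qed

lemma cscale_0 [simp]: "cscale 0 e = 0"
  by (simp add: cscale_def zero_prod_def)

lemma holomorphic_on_cscale:
  assumes "holomorphic2_on f S" "\<And>\<zeta>. \<zeta> \<in> D \<Longrightarrow> y + cscale \<zeta> e \<in> S"
  shows "(\<lambda>\<zeta>. f (y + cscale \<zeta> e)) holomorphic_on D"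
  unfolding holomorphic_on_def field_differentiable_def
proof
  fix \<zeta> assume "\<zeta> \<in> D"
  then have "(fst y + \<zeta> * fst e, snd y + \<zeta> * snd e) \<in> S"
    using assms(2) by (simp add: cscale_def plus_prod_def)
  from holomorphic2_line[OF assms(1) this]
  show "\<exists>f'. ((\<lambda>\<zeta>. f (y + cscale \<zeta> e)) has_field_derivative f') (at \<zeta> within D)"
    by (auto simp: cscale_def plus_prod_def intro: has_field_derivative_at_within)
qed

lemma locally_nonzero_slice:
  assumes g: "g holomorphic_on ball 0 R" and z: "z \<in> ball 0 R" "g z \<noteq> 0"
  obtains r where "0 < r" "r \<le> R" "\<And>\<zeta>. 0 < norm \<zeta> \<Longrightarrow> norm \<zeta> < r \<Longrightarrow> g \<zeta> \<noteq> (0 :: complex)"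
proof -
  have R: "0 < R" using z(1) le_less_trans[OF norm_ge_zero] by simp
  then have "eventually (\<lambda>\<zeta>. g \<zeta> \<noteq> 0 \<and> \<zeta> \<in> ball 0 R) (at 0)"
    by (intro non_zero_neighbour_alt[OF g _ _ _ z]) auto
  then obtain r where r: "r > 0" "\<And>\<zeta>. \<zeta> \<noteq> 0 \<Longrightarrow> dist \<zeta> 0 < r \<Longrightarrow> g \<zeta> \<noteq> 0"
    unfolding eventually_at by blast
  show thesis
    by (rule that[of "min r R"]) (use r R in auto)
qed

text \<open>The local extension at a zero of \<^term>\<open>\<psi>\<close> is the mean of the quotient over a circle, in a
  complex line on which \<^term>\<open>\<psi>\<close> does not vanish identically.\<close>
lemma bounded_quotient_local:
  assumes S: "open S" and f: "holomorphic2_on f S" and \<psi>: "holomorphic2_on \<psi> S" and x: "x \<in> S"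
    and bnd: "d > 0" "\<And>y. y \<in> S \<Longrightarrow> dist y x < d \<Longrightarrow> \<psi> y \<noteq> 0 \<Longrightarrow> norm (f y / \<psi> y) \<le> B"
    and nz: "\<And>\<delta>. \<delta> > 0 \<Longrightarrow> \<exists>\<zeta>. norm \<zeta> < \<delta> \<and> \<psi> (x + cscale \<zeta> e) \<noteq> 0"
  obtains U t where "open U" "x \<in> U" "U \<subseteq> S" "holomorphic2_on t U"
    "\<And>y. y \<in> U \<Longrightarrow> \<psi> y \<noteq> 0 \<Longrightarrow> t y = f y / \<psi> y"
proof -
  obtain \<epsilon>0 where \<epsilon>0: "\<epsilon>0 > 0" "ball x \<epsilon>0 \<subseteq> S" "\<epsilon>0 \<le> d"
  proof -
    obtain \<epsilon>1 where "\<epsilon>1 > 0" "ball x \<epsilon>1 \<subseteq> S" using S x by (meson openE)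
    then show thesis using bnd(1) by (intro that[of "min \<epsilon>1 d"]) auto
  qed
  define R where "R = \<epsilon>0 / (2 * (norm e + 1))"
  have R: "R > 0" using \<epsilon>0 by (simp add: R_def add_nonneg_pos)
  have small: "norm (cscale \<zeta> e) < \<epsilon>0 / 2" if "norm \<zeta> < R" for \<zeta>
  proof -
    have "norm \<zeta> * norm e \<le> norm \<zeta> * (norm e + 1)" by (simp add: mult_left_mono)
    also have "\<dots> < R * (norm e + 1)" using that by (simp add: add_nonneg_pos)
    also have "\<dots> = \<epsilon>0 / 2" by (simp add: R_def add_nonneg_eq_0_iff field_simps add_pos_nonneg)
    finally show ?thesis by (simp add: norm_cscale)
  qed
  have inB: "dist (y + cscale \<zeta> e) x < \<epsilon>0" if "dist y x < \<epsilon>0 / 2" "norm \<zeta> < R" for y \<zeta>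
  proof -
    have "dist (y + cscale \<zeta> e) x \<le> dist y x + norm (cscale \<zeta> e)"
      using norm_triangle_ineq[of "y - x" "cscale \<zeta> e"] by (simp add: dist_norm algebra_simps)
    then show ?thesis using that small[of \<zeta>] by simp
  qed
  have inS: "y + cscale \<zeta> e \<in> S" if "dist y x < \<epsilon>0 / 2" "norm \<zeta> < R" for y \<zeta>
    using inB[OF that] by (intro subsetD[OF \<epsilon>0(2)]) (simp add: dist_commute)
  have hol\<psi>: "(\<lambda>\<zeta>. \<psi> (y + cscale \<zeta> e)) holomorphic_on ball 0 R" if "dist y x < \<epsilon>0 / 2" for y
    by (rule holomorphic_on_cscale[OF \<psi>]) (use that in \<open>auto intro: inS\<close>)
  have holf: "(\<lambda>\<zeta>. f (y + cscale \<zeta> e)) holomorphic_on ball 0 R" if "dist y x < \<epsilon>0 / 2" for y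
    by (rule holomorphic_on_cscale[OF f]) (use that in \<open>auto intro: inS\<close>)
  obtain z where z: "norm z < R" "\<psi> (x + cscale z e) \<noteq> 0" using nz[OF R] by blast
  obtain r0 where r0: "0 < r0" "r0 \<le> R" "\<And>\<zeta>. 0 < norm \<zeta> \<Longrightarrow> norm \<zeta> < r0 \<Longrightarrow> \<psi> (x + cscale \<zeta> e) \<noteq> 0"
    using locally_nonzero_slice[OF hol\<psi>[of x], of z] z \<epsilon>0 by auto
  define r where "r = r0 / 2"
  have r: "r > 0" "r < R" "r < r0" using r0 by (auto simp: r_def)
  define \<gamma> where "\<gamma> t = cscale (of_real r * unitexp t) e" for t
  have cont\<gamma>: "continuous_on {0..1} \<gamma>"
    unfolding \<gamma>_def cscale_def by (intro continuous_intros)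
  define W where "W = S \<inter> \<psi> -` (- {0})"
  have W: "open W"
    unfolding W_def
    by (intro continuous_open_preimage holomorphic2_continuous[OF \<psi>] S) auto
  \<comment> \<open>The circle around \<open>x\<close> avoids the zeros of \<psi> and is compact, so
    its translates to nearby centres avoid them too; the mean of the quotient over the translates is
    then holomorphic in the centre.\<close>
  have "compact ((\<lambda>t. x + \<gamma> t) ` {0..1})"
    by (intro compact_continuous_image continuous_intros cont\<gamma>) auto
  moreover have "(\<lambda>t. x + \<gamma> t) ` {0..1} \<subseteq> W"
    using r r0(3) \<epsilon>0 by (auto simp: W_def \<gamma>_def norm_mult intro!: inS)
  ultimately obtain \<epsilon>1 where \<epsilon>1: "\<epsilon>1 > 0" "(\<Union>k\<in>(\<lambda>t. x + \<gamma> t) ` {0..1}. ball k \<epsilon>1) \<subseteq> W"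
    using compact_subset_open_imp_ball_epsilon_subset[OF _ W] by metis
  define U where "U = ball x (min \<epsilon>1 (\<epsilon>0 / 2))"
  have U: "open U" "x \<in> U" using \<epsilon>0 \<epsilon>1 by (auto simp: U_def)
  have Ux: "dist y x < \<epsilon>0 / 2" if "y \<in> U" for y using that by (simp add: U_def dist_commute)
  have US: "U \<subseteq> S" using inS[OF Ux, of _ 0] R by auto
  have UW: "y + \<gamma> t \<in> W" if "y \<in> U" "t \<in> {0..1}" for y t
  proof -
    have "y + \<gamma> t \<in> ball (x + \<gamma> t) \<epsilon>1" using that by (simp add: U_def dist_norm)
    then show ?thesis using \<epsilon>1(2) that(2) by blast
  qed
  define t0 where "t0 y = integral {0..1} (\<lambda>t. 1 * (f (y + \<gamma> t) / \<psi> (y + \<gamma> t)))" for y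
  have "holomorphic2_on (\<lambda>y. f y / \<psi> y) W"
    by (intro holomorphic2_intros holomorphic2_subset[OF f] holomorphic2_subset[OF \<psi>]) (auto simp: W_def)
  then have hol: "holomorphic2_on t0 U"
    unfolding t0_def
    by (rule holomorphic2_integral[OF W _ cont\<gamma> _ U(1) UW, where g = "\<lambda>y. f y / \<psi> y"]) auto
  have "t0 y = f y / \<psi> y" if y: "y \<in> U" "\<psi> y \<noteq> 0" for y
  proof -
    define h where "h \<zeta> = f (y + cscale \<zeta> e) / \<psi> (y + cscale \<zeta> e)" for \<zeta>
    \<comment> \<open>Zeros of \<psi> in the slice through \<open>y\<close>: finitely many because
      \<psi> does not vanish at \<open>y\<close>, off the boundary circle, and removable for
      \<open>h\<close> because the quotient is bounded. Therefore the circle mean of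
      \<open>h\<close> is \<open>h 0\<close>.\<close>
    define X where "X = {\<zeta> \<in> cball 0 r. \<psi> (y + cscale \<zeta> e) = 0}"
    have "finite X"
    proof (cases "(\<lambda>\<zeta>. \<psi> (y + cscale \<zeta> e)) constant_on ball 0 R")
      case True
      then have "\<psi> (y + cscale \<zeta> e) = \<psi> (y + cscale 0 e)" if "\<zeta> \<in> ball 0 R" for \<zeta>
        using R that unfolding constant_on_def by (metis centre_in_ball)
      then have "X = {}" using y r by (auto simp: X_def)
      then show ?thesis by simp
    next
      case False
      show ?thesis
        unfolding X_def
        by (rule holomorphic_compact_finite_zeros[OF hol\<psi>[OF Ux[OF y(1)]] _ _ _ _ False]) (use r in auto)
    qed
    moreover have sphere: "\<zeta> \<notin> X" if "norm \<zeta> = r" for \<zeta>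
    proof -
      have "\<zeta> \<in> path_image (circlepath 0 r)" using that r by simp
      then obtain t where t: "t \<in> {0..1}" "\<zeta> = of_real r * unitexp t"
        unfolding path_image_def circlepath unitexp_def by auto
      then show ?thesis using UW[OF y(1) t(1)] by (auto simp: X_def W_def \<gamma>_def)
    qed
    then have "X \<subseteq> interior (cball 0 r)"
      using r by (auto simp: X_def) (metis order_le_less)
    moreover have "h holomorphic_on (cball 0 r - X)"
      unfolding h_def
      by (intro holomorphic_on_divide holomorphic_on_subset[OF holf[OF Ux[OF y(1)]]]
            holomorphic_on_subset[OF hol\<psi>[OF Ux[OF y(1)]]]) (use r in \<open>auto simp: X_def\<close>)
    moreover have "h \<in> O[at z](\<lambda>_. 1)" if "z \<in> X" for z
    proof (rule bigoI[of _ "max B 0"])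
      have "norm z < R" using that r by (auto simp: X_def)
      then have "eventually (\<lambda>w. w \<in> ball 0 R) (at z)"
        by (intro eventually_at_in_open') auto
      then show "eventually (\<lambda>w. norm (h w) \<le> max B 0 * norm (1 :: complex)) (at z)"
      proof (rule eventually_mono)
        fix w :: complex assume w: "w \<in> ball 0 R"
        show "norm (h w) \<le> max B 0 * norm (1 :: complex)"
        proof (cases "\<psi> (y + cscale w e) = 0")
          case False
          then show ?thesis
            using bnd(2)[OF inS[OF Ux[OF y(1)], of w] _ False] inB[OF Ux[OF y(1)], of w] w \<epsilon>0(3)
            by (simp add: h_def)
        qed (simp add: h_def)
      qed
    qed
    ultimately obtain g where g: "g holomorphic_on cball 0 r" "\<And>z. z \<in> cball 0 r - X \<Longrightarrow> g z = h z"
      using removable_singularities[of X "cball 0 r" h] by blast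
    have "t0 y = integral {0..1} (\<lambda>t. g (0 + of_real r * unitexp t))"
      unfolding t0_def
    proof (rule integral_cong)
      fix t :: real
      have n: "norm (of_real r * unitexp t) = r" using r by (simp add: norm_mult)
      then show "1 * (f (y + \<gamma> t) / \<psi> (y + \<gamma> t)) = g (0 + of_real r * unitexp t)"
        using g(2)[of "of_real r * unitexp t"] sphere[OF n] r by (simp add: h_def \<gamma>_def)
    qed
    also have "\<dots> = g 0" using cauchy_mean_value[OF g(1)] r by simp
    also have "\<dots> = h 0" using y r by (intro g(2)) (auto simp: X_def)
    finally show ?thesis by (simp add: h_def)
  qed
  then show thesis using that[OF U US hol] by blast
qed

lemma line_in_open:
  assumes "open S" "l \<in> S"
  obtains R where "R > 0" "\<And>\<zeta>. norm \<zeta> \<le> R \<Longrightarrow> l + cscale \<zeta> v \<in> S"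
proof -
  obtain e where e: "e > 0" "ball l e \<subseteq> S" using assms by (meson openE)
  define R where "R = e / (2 * (norm v + 1))"
  have v: "norm v + 1 > 0" by (simp add: add_nonneg_pos)
  have R: "R > 0" using e v by (simp add: R_def)
  have "l + cscale \<zeta> v \<in> S" if "norm \<zeta> \<le> R" for \<zeta>
  proof -
    have "norm \<zeta> * norm v \<le> R * (norm v + 1)" using that R by (intro mult_mono) auto
    also have "\<dots> = e / 2" using v by (simp add: R_def field_simps)
    finally have "norm (cscale \<zeta> v) < e" using e by (simp add: norm_cscale)
    then show ?thesis using e(2) by (auto simp: dist_norm)
  qed
  then show thesis using that R by blast
qed

text \<open>A closed condition passes to a limit along one complex line. This carries identities and
  estimates across the zeros of a denominator.\<close>

lemma le_on_closure_line:
  assumes S: "open S" and h: "continuous_on S h" and x: "x \<in> S"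
    and nz: "\<And>\<delta>. \<delta> > 0 \<Longrightarrow> \<exists>\<zeta>. norm \<zeta> < \<delta> \<and> P (x + cscale \<zeta> e)"
    and le: "\<And>y. y \<in> S \<Longrightarrow> P y \<Longrightarrow> h y \<le> (0 :: real)"
  shows "h x \<le> 0"
proof (rule ccontr)
  assume "\<not> h x \<le> 0"
  then have "x \<in> S \<inter> h -` {0<..}" using x by simp
  moreover have "open (S \<inter> h -` {0<..})"
    by (intro continuous_open_preimage h S) simp
  ultimately obtain R where R: "R > 0" "\<And>\<zeta>. norm \<zeta> \<le> R \<Longrightarrow> x + cscale \<zeta> e \<in> S \<inter> h -` {0<..}"
    using line_in_open[of "S \<inter> h -` {0<..}" x e] by metis
  obtain \<zeta> where "norm \<zeta> < R" "P (x + cscale \<zeta> e)" using nz[OF R(1)] by blast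
  then show False using R(2)[of \<zeta>] le[of "x + cscale \<zeta> e"] by fastforce
qed

text \<open>Riemann's extension theorem in two variables. Local extensions agree where \<psi> is
  nonzero, hence by density on overlaps, and the diagonal choice \<open>T x x\<close> glues
  them.\<close>

theorem bounded_quotient_extension:
  assumes S: "open S" and f: "holomorphic2_on f S" and \<psi>: "holomorphic2_on \<psi> S"
    and bnd: "\<And>x. x \<in> S \<Longrightarrow> \<exists>d>0. \<exists>B. \<forall>y\<in>S. dist y x < d \<longrightarrow> \<psi> y \<noteq> 0 \<longrightarrow> norm (f y / \<psi> y) \<le> B"
    and nz: "\<And>x. x \<in> S \<Longrightarrow> \<exists>e. \<forall>\<delta>>0. \<exists>\<zeta>. norm \<zeta> < \<delta> \<and> \<psi> (x + cscale \<zeta> e) \<noteq> 0"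
  obtains t where "holomorphic2_on t S" "\<And>x. x \<in> S \<Longrightarrow> \<psi> x \<noteq> 0 \<Longrightarrow> t x = f x / \<psi> x"
proof -
  have "\<forall>x. \<exists>U t. x \<in> S \<longrightarrow> open U \<and> x \<in> U \<and> U \<subseteq> S \<and> holomorphic2_on t U \<and>
      (\<forall>y. y \<in> U \<longrightarrow> \<psi> y \<noteq> 0 \<longrightarrow> t y = f y / \<psi> y)"
  proof
    fix x
    show "\<exists>U t. x \<in> S \<longrightarrow> open U \<and> x \<in> U \<and> U \<subseteq> S \<and> holomorphic2_on t U \<and>
      (\<forall>y. y \<in> U \<longrightarrow> \<psi> y \<noteq> 0 \<longrightarrow> t y = f y / \<psi> y)"
    proof (cases "x \<in> S")
      case True
      obtain d B where d: "d > 0"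
        and B: "\<And>y. y \<in> S \<Longrightarrow> dist y x < d \<Longrightarrow> \<psi> y \<noteq> 0 \<Longrightarrow> norm (f y / \<psi> y) \<le> B"
        using bnd[OF True] by blast
      obtain e where e: "\<And>\<delta>. \<delta> > 0 \<Longrightarrow> \<exists>\<zeta>. norm \<zeta> < \<delta> \<and> \<psi> (x + cscale \<zeta> e) \<noteq> 0"
        using nz[OF True] by blast
      show ?thesis
        by (rule bounded_quotient_local[OF S f \<psi> True d B e]) blast+
    qed simp
  qed
  then obtain U T where UT: "\<And>x. x \<in> S \<Longrightarrow> open (U x) \<and> x \<in> U x \<and> U x \<subseteq> S \<and> holomorphic2_on (T x) (U x) \<and>
      (\<forall>y. y \<in> U x \<longrightarrow> \<psi> y \<noteq> 0 \<longrightarrow> T x y = f y / \<psi> y)"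
    unfolding choice_iff by blast
  have agree: "T x y = T y y" if x: "x \<in> S" and y: "y \<in> U x" for x y
  proof -
    have yS: "y \<in> S" using UT[OF x] y by blast
    obtain e where e: "\<And>\<delta>. \<delta> > 0 \<Longrightarrow> \<exists>\<zeta>. norm \<zeta> < \<delta> \<and> \<psi> (y + cscale \<zeta> e) \<noteq> 0"
      using nz[OF yS] by blast
    have "norm (T x y - T y y) \<le> 0"
    proof (rule le_on_closure_line[of "U x \<inter> U y" "\<lambda>z. norm (T x z - T y z)" y "\<lambda>z. \<psi> z \<noteq> 0" e])
      show "continuous_on (U x \<inter> U y) (\<lambda>z. norm (T x z - T y z))"
        using UT[OF x] UT[OF yS]
        by (intro continuous_intros continuous_on_subset[OF holomorphic2_continuous]) auto
    next
      fix z assume z: "z \<in> U x \<inter> U y" "\<psi> z \<noteq> 0"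
      have "T x z = f z / \<psi> z" using UT[OF x] z by blast
      moreover have "T y z = f z / \<psi> z" using UT[OF yS] z by blast
      ultimately show "norm (T x z - T y z) \<le> 0" by simp
    qed (use UT[OF x] UT[OF yS] y e in \<open>simp_all add: open_Int\<close>)
    then show ?thesis by simp
  qed
  show thesis
  proof (rule that[of "\<lambda>x. T x x"])
    show "holomorphic2_on (\<lambda>x. T x x) S"
      unfolding holomorphic2_on_def
    proof
      fix x assume x: "x \<in> S"
      show "\<exists>a b. ((\<lambda>x. T x x) has_derivative (\<lambda>h. a * fst h + b * snd h)) (at x)"
        by (rule holomorphic2_cong[of "U x" x "T x"]) (use UT[OF x] agree[OF x] in auto)
    qed
    show "T x x = f x / \<psi> x" if "x \<in> S" "\<psi> x \<noteq> 0" for x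
      using UT[OF that(1)] that(2) by blast
  qed
qed

section \<open>Caratheodory extremals\<close>

lemma symm_bidisc_fst: "(s, p) \<in> symm_bidisc \<Longrightarrow> norm s < 2"
  by (auto simp: symm_bidisc_def intro!: norm_triangle_lt)

lemma Phi_denominator:
  assumes "(s, p) \<in> symm_bidisc" "norm \<omega> = 1"
  shows "2 - \<omega> * s \<noteq> 0"
proof
  assume "2 - \<omega> * s = 0"
  then have "norm (\<omega> * s) = norm (2 :: complex)" by simp
  then show False using symm_bidisc_fst[OF assms(1)] assms(2) by (simp add: norm_mult)
qed

text \<open>By the parallelogram law 4 - |s|^2 = 4 - 2|z|^2 - 2|w|^2 + |z - w|^2, and |s^2 - 4p| =
  |z - w|^2; the rest is \<open>norm_sum_defect_le\<close> with |z|, |w| < 1. It keeps the values of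
  \<open>Phi \<omega>\<close> inside the disc and the denominator of the final bound
  positive.\<close>

lemma Phi_radius:
  assumes "(s, p) \<in> symm_bidisc"
  shows "2 * norm (s - cnj s * p) + norm (s^2 - 4 * p) < 4 - (norm s)^2"
proof -
  obtain z w where zw: "s = z + w" "p = z * w" "norm z < 1" "norm w < 1"
    using assms by (auto simp: symm_bidisc_def)
  define a b where "a = norm z" and "b = norm w"
  have ab: "0 \<le> a" "a < 1" "0 \<le> b" "b < 1" using zw by (auto simp: a_def b_def)
  then have ab2: "a^2 < 1" "b^2 < 1" by (simp_all add: power_less_one_iff)
  have "norm (s - cnj s * p) \<le> a * (1 - b^2) + b * (1 - a^2)"
    using norm_sum_defect_le[OF zw(3,4)] unfolding zw(1,2) a_def b_def .
  also have "\<dots> < 1 * (1 - b^2) + 1 * (1 - a^2)"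
    using ab ab2 by (intro add_strict_mono mult_strict_right_mono) auto
  finally have 1: "2 * norm (s - cnj s * p) < 4 - 2 * a^2 - 2 * b^2" by simp
  have "s^2 - 4 * p = (z - w)^2" by (simp add: zw algebra_simps power2_eq_square)
  then have 2: "norm (s^2 - 4 * p) = (norm (z - w))^2" by (simp add: norm_power)
  have 3: "(norm (z + w))^2 + (norm (z - w))^2 = 2 * a^2 + 2 * b^2"
    unfolding a_def b_def cmod_power2 by (simp add: power2_eq_square algebra_simps)
  show ?thesis using 1 2 3 zw(1) by simp
qed

text \<open>The circle \<^term>\<open>{Phi \<omega> (s, p) | \<omega>. norm \<omega> = 1}\<close> has centre
  $-2(s - \bar s p)/(4 - |s|^2)$ and radius $|s^2 - 4p|/(4-|s|^2)$.\<close>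
lemma norm_Phi_le:
  assumes sp: "(s, p) \<in> symm_bidisc" and \<omega>: "norm \<omega> = 1"
  shows "norm (Phi \<omega> (s, p)) \<le> (2 * norm (s - cnj s * p) + norm (s^2 - 4 * p)) / (4 - (norm s)^2)"
proof -
  define d where "d = 4 - (norm s)^2"
  have "(norm s)^2 < 2^2" using symm_bidisc_fst[OF sp] by (intro power_strict_mono) auto
  then have d: "d > 0" by (simp add: d_def)
  have dc: "complex_of_real d = 4 - s * cnj s" using complex_norm_square[of s] by (simp add: d_def)
  have den: "2 - \<omega> * s \<noteq> 0" using Phi_denominator[OF sp \<omega>] .
  \<comment> \<open>Makes the quotient of these two numbers unimodular, so the second summand below
    has the modulus of 4p - s^2.\<close>
  have norms: "norm (2 * \<omega> - cnj s) = norm (2 - \<omega> * s)"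
  proof -
    have "\<omega> * cnj (2 - \<omega> * s) = 2 * \<omega> - (\<omega> * cnj \<omega>) * cnj s" by (simp add: algebra_simps)
    also have "\<omega> * cnj \<omega> = 1" using \<omega> complex_norm_square[of \<omega>] by simp
    finally have "norm (2 * \<omega> - cnj s) = norm (\<omega> * cnj (2 - \<omega> * s))" by simp
    also have "\<dots> = norm (2 - \<omega> * s)" unfolding norm_mult complex_mod_cnj by (simp add: \<omega>)
    finally show ?thesis .
  qed
  have "Phi \<omega> (s, p) * of_real d = - 2 * (s - cnj s * p) + (4 * p - s^2) * (2 * \<omega> - cnj s) / (2 - \<omega> * s)"
    using den unfolding Phi_def dc by (simp add: field_simps power2_eq_square)
  then have "norm (Phi \<omega> (s, p)) * d =
      norm (- 2 * (s - cnj s * p) + (4 * p - s^2) * (2 * \<omega> - cnj s) / (2 - \<omega> * s))"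
    using d by (metis abs_of_pos norm_mult norm_of_real)
  also have "\<dots> \<le> norm (- 2 * (s - cnj s * p)) + norm ((4 * p - s^2) * (2 * \<omega> - cnj s) / (2 - \<omega> * s))"
    by (rule norm_triangle_ineq)
  also have "\<dots> = 2 * norm (s - cnj s * p) + norm (4 * p - s^2)"
  proof -
    have "norm (- 2 * (s - cnj s * p)) = 2 * norm (s - cnj s * p)"
      unfolding norm_mult by simp
    moreover have "norm ((4 * p - s^2) * (2 * \<omega> - cnj s) / (2 - \<omega> * s)) = norm (4 * p - s^2)"
      using den unfolding norm_divide norm_mult norms by simp
    ultimately show ?thesis by (simp only:)
  qed
  finally show ?thesis
    using d by (simp add: pos_le_divide_eq flip: d_def) (simp add: norm_minus_commute)
qed

lemma norm_Phi_less_1: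
  assumes sp: "x \<in> symm_bidisc" and \<omega>: "norm \<omega> = 1"
  shows "norm (Phi \<omega> x) < 1"
proof -
  obtain s p where x: "x = (s, p)" by fastforce
  have lt: "2 * norm (s - cnj s * p) + norm (s^2 - 4 * p) < 4 - (norm s)^2"
    using Phi_radius sp by (simp add: x)
  then have "0 < 4 - (norm s)^2"
    by (smt (verit) norm_ge_zero)
  then have "(2 * norm (s - cnj s * p) + norm (s^2 - 4 * p)) / (4 - (norm s)^2) < 1"
    using lt by (simp add: divide_less_eq_1)
  then show ?thesis using norm_Phi_le[OF sp[unfolded x] \<omega>] by (simp add: x)
qed

lemma holomorphic2_Phi: "norm \<omega> = 1 \<Longrightarrow> holomorphic2_on (Phi \<omega>) symm_bidisc"
  unfolding Phi_def case_prod_unfold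
  by (intro holomorphic2_intros) (use Phi_denominator in auto)

lemma Phi_in_Hol: "norm \<omega> = 1 \<Longrightarrow> Phi \<omega> \<in> Hol_symm_bidisc_disc"
  unfolding Hol_symm_bidisc_disc_def using holomorphic2_Phi norm_Phi_less_1 by auto

section \<open>Directional derivatives and the Schwarz-Pick inequality\<close>

definition tderiv :: "(complex \<times> complex \<Rightarrow> complex) \<Rightarrow> complex \<times> complex \<Rightarrow> complex \<times> complex \<Rightarrow> complex" where
  "tderiv F l v = pd1 F l * fst v + pd2 F l * snd v"

lemma tderiv_eqI:
  assumes "(F has_derivative (\<lambda>h. a * fst h + b * snd h)) (at l)"
  shows "tderiv F l v = a * fst v + b * snd v"
  using has_derivative_pd[OF assms] by (simp add: tderiv_def)

lemma tderiv_mult: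
  assumes "holomorphic2_on f S" "holomorphic2_on g S" "l \<in> S"
  shows "tderiv (\<lambda>x. f x * g x) l v = f l * tderiv g l v + tderiv f l v * g l"
  using tderiv_eqI[OF has_derivative_mult_pd[OF assms]] by (simp add: tderiv_def algebra_simps)

lemma tderiv_add:
  assumes "holomorphic2_on f S" "holomorphic2_on g S" "l \<in> S"
  shows "tderiv (\<lambda>x. f x + g x) l v = tderiv f l v + tderiv g l v"
  using tderiv_eqI[OF has_derivative_add_pd[OF assms]] by (simp add: tderiv_def algebra_simps)

lemma tderiv_affine: "tderiv (\<lambda>x. c + a * fst x + b * snd x) l v = a * fst v + b * snd v"
  by (rule tderiv_eqI) (auto intro!: derivative_eq_intros)

lemma tderiv_cong_open:
  assumes "holomorphic2_on f S" "open S" "l \<in> S" "\<And>x. x \<in> S \<Longrightarrow> f x = g x"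
  shows "tderiv g l v = tderiv f l v"
proof -
  have "(g has_derivative (\<lambda>h. pd1 f l * fst h + pd2 f l * snd h)) (at l)"
    using has_derivative_transform_within_open[OF holomorphic2_has_derivative[OF assms(1,3)] assms(2,3)] assms(4) by simp
  from tderiv_eqI[OF this] show ?thesis by (simp add: tderiv_def)
qed

lemma tderiv_line:
  assumes "holomorphic2_on F S" "l \<in> S"
  shows "((\<lambda>t. F (l + cscale t v)) has_field_derivative tderiv F l v) (at 0)"
  using holomorphic2_line[of F S "fst l" 0 "fst v" "snd l" "snd v"] assms
  by (simp add: tderiv_def cscale_def plus_prod_def)

lemma dir_deriv_eq:
  assumes "holomorphic2_on F S" "l \<in> S"
  shows "dir_deriv F l v = tderiv F l v"
  using DERIV_imp_deriv[OF tderiv_line[OF assms, of v]]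
  by (simp add: dir_deriv_def cscale_def plus_prod_def)

lemma one_minus_cnj_mult_nonzero:
  assumes "norm a < 1" "norm w < 1"
  shows "1 - cnj a * w \<noteq> 0"
proof
  assume "1 - cnj a * w = 0"
  then have "norm (cnj a * w) = 1" by simp
  moreover have "norm a * norm w < 1 * 1" using assms by (intro mult_strict_mono') auto
  ultimately show False by (simp add: norm_mult)
qed

lemma norm_moebius_defect:
  "(norm (1 - cnj a * w))^2 - (norm (w - a))^2 = (1 - (norm a)^2) * (1 - (norm w)^2)"
  unfolding cmod_power2 by (simp add: power2_eq_square algebra_simps)

lemma schwarz_pick_centre:
  assumes f: "f holomorphic_on ball 0 R" and R: "R > 0" and bnd: "\<And>z. norm z < R \<Longrightarrow> norm (f z) < 1"
  shows "norm (deriv f 0) \<le> (1 - (norm (f 0))^2) / R"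
proof -
  define a where "a = f 0"
  define g where "g z = (f (of_real R * z) - a) / (1 - cnj a * f (of_real R * z))" for z
  have a: "norm a < 1" using bnd R by (simp add: a_def)
  have in1: "norm (of_real R * z) < R" if "norm z < 1" for z :: complex
    using that R by (simp add: norm_mult)
  note den = one_minus_cnj_mult_nonzero[OF a]
  have holf: "(\<lambda>z. f (of_real R * z)) holomorphic_on ball 0 1"
    by (rule holomorphic_on_compose_gen[OF _ f, unfolded o_def]) (auto intro!: holomorphic_intros in1)
  have "g holomorphic_on ball 0 1"
    unfolding g_def by (intro holomorphic_intros holf) (use den bnd in1 in auto)
  moreover have "g 0 = 0" by (simp add: g_def a_def)
  moreover have "norm (g z) < 1" if z: "norm z < 1" for z
  proof -
    have "(1 - (norm a)^2) * (1 - (norm (f (of_real R * z)))^2) > 0"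
      using a bnd[OF in1[OF z]] by (simp add: power_less_one_iff)
    then have "(norm (f (of_real R * z) - a))^2 < (norm (1 - cnj a * f (of_real R * z)))^2"
      by (simp flip: norm_moebius_defect)
    then have "norm (f (of_real R * z) - a) < norm (1 - cnj a * f (of_real R * z))"
      by (rule power2_less_imp_less) simp
    then show ?thesis
      using den[OF bnd[OF in1[OF z]]] by (simp add: g_def norm_divide divide_less_eq_1)
  qed
  ultimately have "norm (deriv g 0) \<le> 1"
    using Schwarz_Lemma(2)[of g 0] by simp
  moreover have "deriv g 0 = of_real R * deriv f 0 / of_real (1 - (norm a)^2)"
  proof (rule DERIV_imp_deriv)
    have "(f has_field_derivative deriv f 0) (at (of_real R * 0))"
      using holomorphic_derivI[OF f, of 0] R by simp
    from DERIV_chain2[OF this DERIV_cmult_Id] 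
    have d: "((\<lambda>z. f (of_real R * z)) has_field_derivative deriv f 0 * of_real R) (at 0)" .
    have den0: "1 - cnj a * f (of_real R * 0) \<noteq> 0" using den[OF a] by (simp add: a_def)
    have n: "1 - cnj a * a = of_real (1 - (norm a)^2)" "1 - cnj a * a \<noteq> 0"
      using complex_norm_square[of a] den[OF a] by (simp_all add: mult.commute)
    have "(g has_field_derivative
        (deriv f 0 * of_real R * (1 - cnj a * f (of_real R * 0)) -
          (f (of_real R * 0) - a) * (- (cnj a * (deriv f 0 * of_real R)))) /
        ((1 - cnj a * f (of_real R * 0)) * (1 - cnj a * f (of_real R * 0)))) (at 0)"
      unfolding g_def by (intro DERIV_divide den0) (auto intro!: derivative_eq_intros d)
    then show "(g has_field_derivative of_real R * deriv f 0 / of_real (1 - (norm a)^2)) (at 0)"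
      unfolding n(1)[symmetric] using n(2) by (simp add: a_def[symmetric] mult.commute)
  qed
  moreover have "1 - (norm a)^2 > 0" using a by (simp add: power_less_one_iff)
  ultimately have "R * norm (deriv f 0) / (1 - (norm a)^2) \<le> 1"
    using R by (simp add: norm_divide norm_mult del: of_real_diff)
  then have "R * norm (deriv f 0) \<le> 1 - (norm a)^2"
    using \<open>1 - (norm a)^2 > 0\<close> by (simp only: divide_le_eq_1_pos)
  then show ?thesis using R by (simp add: pos_le_divide_eq mult.commute a_def)
qed

text \<open>The point is finiteness of the supremum: Schwarz-Pick on a disc of radius R in the line
  through \<open>l\<close> bounds every quotient by 1 / R.\<close>

lemma car_quotient_le:
  assumes l: "l \<in> symm_bidisc" and F: "F \<in> Hol_symm_bidisc_disc"
  shows "car_quotient F (l, v) \<le> car_norm (l, v)"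
proof -
  obtain R where R: "R > 0" "\<And>\<zeta>. norm \<zeta> \<le> R \<Longrightarrow> l + cscale \<zeta> v \<in> symm_bidisc"
    using line_in_open[OF open_symm_bidisc l] by metis
  have "car_quotient F (l, v) \<le> 1 / R" if F: "F \<in> Hol_symm_bidisc_disc" for F
  proof -
    have hol: "holomorphic2_on F symm_bidisc" and bnd: "\<And>x. x \<in> symm_bidisc \<Longrightarrow> norm (F x) < 1"
      using F by (auto simp: Hol_symm_bidisc_disc_def)
    have "(\<lambda>\<zeta>. F (l + cscale \<zeta> v)) holomorphic_on ball 0 R"
      by (rule holomorphic_on_cscale[OF hol]) (use R in auto)
    from schwarz_pick_centre[OF this R(1)] 
    have "norm (deriv (\<lambda>\<zeta>. F (l + cscale \<zeta> v)) 0) \<le> (1 - (norm (F l))^2) / R"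
      using bnd R by auto
    moreover have "deriv (\<lambda>\<zeta>. F (l + cscale \<zeta> v)) 0 = tderiv F l v"
      using DERIV_imp_deriv[OF tderiv_line[OF hol l]] .
    moreover have "1 - (norm (F l))^2 > 0" using bnd[OF l] by (simp add: power_less_one_iff)
    ultimately show ?thesis
      by (simp add: car_quotient_def dir_deriv_eq[OF hol l] divide_le_eq mult.commute)
  qed
  then have "bdd_above ((\<lambda>F. car_quotient F (l, v)) ` Hol_symm_bidisc_disc)"
    by (auto simp: bdd_above_def)
  then show ?thesis
    unfolding car_norm_def by (intro cSUP_upper F)
qed

section \<open>Three-point jets\<close>

text \<open>Multiplication by a function $f$ on the algebra of functions on the three points $l$,
  ``$l$ infinitesimally displaced'', $\mu$, where \<^term>\<open>a\<close>, \<^term>\<open>b\<close>, \<^term>\<open>y\<close> stand for $f(l)$, the directional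
  derivative of $f$ at $l$, and $f(\mu)$.\<close>
definition jet :: "complex \<Rightarrow> complex \<Rightarrow> complex \<Rightarrow> complex^3^3" where
  "jet a b y = vector [vector [a, 0, 0], vector [b, a, 0], vector [0, 0, y]]"

lemma vec3_eq_iff: "(x :: complex^3) = y \<longleftrightarrow> x $ 1 = y $ 1 \<and> x $ 2 = y $ 2 \<and> x $ 3 = y $ 3"
  by (simp add: vec_eq_iff forall_3)

lemma jet_vec:
  "(jet a b y *v x) $ 1 = a * x $ 1"
  "(jet a b y *v x) $ 2 = b * x $ 1 + a * x $ 2"
  "(jet a b y *v x) $ 3 = y * x $ 3"
  by (simp_all add: jet_def matrix_vector_mult_def sum_3)

lemma jet_mult: "jet a b y ** jet a' b' y' = jet (a * a') (b * a' + a * b') (y * y')"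
  by (rule mat_eqI) (simp add: vec3_eq_iff jet_vec algebra_simps flip: matrix_vector_mul_assoc)

lemma jet_add: "jet a b y + jet a' b' y' = jet (a + a') (b + b') (y + y')"
  by (rule mat_eqI) (simp add: vec3_eq_iff jet_vec algebra_simps)

lemma jet_mat: "mat c = jet c 0 c"
  by (rule mat_eqI) (simp add: vec3_eq_iff jet_vec mat_mult_vec)

lemma holomorphic2_bev: "holomorphic2_on (bev q) UNIV"
proof (induction q)
  case One
  then show ?case by (simp add: holomorphic2_on_const[of 1])
qed (simp_all add: holomorphic2_intros)

lemma bev_fun:
  "bev One = (\<lambda>x. 1)"
  "bev (MulS q) = (\<lambda>x. fst x * bev q x)"
  "bev (MulP q) = (\<lambda>x. snd x * bev q x)"
  "bev (Add q r) = (\<lambda>x. bev q x + bev r x)"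
  "bev (Scl c q) = (\<lambda>x. c * bev q x)"
  by auto

lemma tderiv_bev:
  "tderiv (bev One) l v = 0"
  "tderiv (bev (MulS q)) l v = fst l * tderiv (bev q) l v + fst v * bev q l"
  "tderiv (bev (MulP q)) l v = snd l * tderiv (bev q) l v + snd v * bev q l"
  "tderiv (bev (Add q r)) l v = tderiv (bev q) l v + tderiv (bev r) l v"
  "tderiv (bev (Scl c q)) l v = c * tderiv (bev q) l v"
  unfolding bev_fun tderiv_mult[OF holomorphic2_on_fst holomorphic2_bev UNIV_I]
    tderiv_mult[OF holomorphic2_on_snd holomorphic2_bev UNIV_I]
    tderiv_mult[OF holomorphic2_on_const holomorphic2_bev UNIV_I]
    tderiv_add[OF holomorphic2_bev holomorphic2_bev UNIV_I]
  using tderiv_affine[of _ 0 0 l v] tderiv_affine[of 0 1 0 l v] tderiv_affine[of 0 0 1 l v]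
  by simp_all

text \<open>Jets multiply by the product rule, so a polynomial in the two coordinate multiplications
  is multiplication by that polynomial.\<close>

lemma bop_jet:
  "bop q (jet (fst l) (fst v) (fst \<mu>)) (jet (snd l) (snd v) (snd \<mu>)) =
    jet (bev q l) (tderiv (bev q) l v) (bev q \<mu>)"
proof (induction q)
  case One
  show ?case unfolding bop.simps jet_mat tderiv_bev by simp
next
  case (MulS q)
  show ?case unfolding bop.simps MulS jet_mult tderiv_bev by (simp add: add.commute)
next
  case (MulP q)
  show ?case unfolding bop.simps MulP jet_mult tderiv_bev by (simp add: add.commute)
next
  case (Add q r)
  show ?case unfolding bop.simps Add jet_add tderiv_bev by simp
next
  case (Scl c q)
  show ?case unfolding bop.simps Scl jet_mat jet_mult tderiv_bev by simp
qed

lemma tendsto_herm: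
  assumes "(f \<longlongrightarrow> a) F" shows "((\<lambda>n. herm L (f n)) \<longlongrightarrow> herm L a) F"
  unfolding herm_def hdot_def matrix_vector_mult_def
  by (simp, intro tendsto_intros assms)

lemma tendsto_jet:
  assumes "(a \<longlongrightarrow> a') F" "(b \<longlongrightarrow> b') F" "(y \<longlongrightarrow> y') F"
  shows "((\<lambda>n. jet (a n) (b n) (y n) *v x) \<longlongrightarrow> jet a' b' y' *v x) F"
proof (rule vec_tendstoI)
  fix i :: 3
  have "i = 1 \<or> i = 2 \<or> i = 3" using exhaust_3 by blast
  then show "((\<lambda>n. (jet (a n) (b n) (y n) *v x) $ i) \<longlongrightarrow> (jet a' b' y' *v x) $ i) F"
    by (elim disjE) (auto simp: jet_vec intro!: tendsto_intros assms)
qed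

text \<open>Dilates of \<open>F\<close> with ratio tending to 1 are approximated uniformly; Cauchy's
  inequality on a disc of radius R in the line through \<open>l\<close> turns the error
  \<open>e n\<close> into (1 / R) \<open>e n\<close> for the derivative. The bounds
  \<open>C n\<close> exceed 1 by the approximation error.\<close>

lemma bpoly_jet_approximation:
  assumes F: "F \<in> Hol_symm_bidisc_disc" and l: "l \<in> symm_bidisc" and \<mu>: "\<mu> \<in> symm_bidisc"
  shows "\<exists>q C. (\<forall>n. \<forall>x\<in>symm_bidisc. norm (bev (q n) x) \<le> C n) \<and> C \<longlonglongrightarrow> 1 \<and>
    (\<lambda>n. bev (q n) l) \<longlonglongrightarrow> F l \<and> (\<lambda>n. bev (q n) \<mu>) \<longlonglongrightarrow> F \<mu> \<and>
    (\<lambda>n. tderiv (bev (q n)) l v) \<longlonglongrightarrow> tderiv F l v"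
proof -
  have hol: "holomorphic2_on F symm_bidisc" and bnd: "\<And>x. x \<in> symm_bidisc \<Longrightarrow> norm (F x) \<le> 1"
    using F by (auto simp: Hol_symm_bidisc_disc_def less_imp_le)
  define r where "r n = 1 - 1 / real (n + 2)" for n
  define e where "e n = 1 / real (n + 1)" for n
  have r: "0 < r n" "r n < 1" "e n > 0" for n by (simp_all add: r_def e_def field_simps)
  have r1: "r \<longlonglongrightarrow> 1" and e0: "e \<longlonglongrightarrow> 0"
    unfolding r_def e_def by real_asymp+
  define sc where "sc n x = (of_real (r n) * fst x, (of_real (r n))^2 * snd x :: complex)" for n and x :: "complex \<times> complex"
  have sc_in: "sc n x \<in> symm_bidisc" if "x \<in> symm_bidisc" for n x
    using symm_bidisc_scale[of "fst x" "snd x" "of_real (r n)"] that r[of n] by (simp add: sc_def)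
  have "\<exists>q. \<forall>x\<in>symm_bidisc. norm (bev q x - F (sc n x)) \<le> e n" for n
    using bpoly_approximation[OF hol bnd r(1,2,3)[of n]] by (simp add: sc_def split_beta)
  then have "\<exists>q. \<forall>n. \<forall>x\<in>symm_bidisc. norm (bev (q n) x - F (sc n x)) \<le> e n"
    by (intro choice allI)
  then obtain q where q: "\<And>n x. x \<in> symm_bidisc \<Longrightarrow> norm (bev (q n) x - F (sc n x)) \<le> e n"
    by blast
  have sc_lim: "(\<lambda>n. sc n x) \<longlonglongrightarrow> x" for x
  proof -
    have "(\<lambda>n. sc n x) \<longlonglongrightarrow> (of_real 1 * fst x, (of_real 1)^2 * snd x)"
      unfolding sc_def by (intro tendsto_intros r1)
    then show ?thesis by simp
  qed
  have lim: "(\<lambda>n. h (sc n x)) \<longlonglongrightarrow> h x" if "continuous_on symm_bidisc h" "x \<in> symm_bidisc"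
    for h :: "complex \<times> complex \<Rightarrow> complex" and x
    by (rule continuous_on_tendsto_compose[OF that(1) sc_lim that(2)]) (simp add: sc_in that)
  have close: "(\<lambda>n. f n - g n) \<longlonglongrightarrow> 0" if "\<And>n. norm (f n - g n) \<le> K * e n" for f g :: "nat \<Rightarrow> complex" and K
    by (rule Lim_null_comparison[OF _ tendsto_mult_right_zero[OF e0, of K]]) (simp add: that)
  have val: "(\<lambda>n. bev (q n) x) \<longlonglongrightarrow> F x" if x: "x \<in> symm_bidisc" for x
  proof -
    have "(\<lambda>n. bev (q n) x - F (sc n x)) \<longlonglongrightarrow> 0"
      by (rule close[of _ _ 1]) (simp add: q[OF x])
    from tendsto_add[OF this lim[OF holomorphic2_continuous[OF hol] x]] show ?thesis by simp
  qed
  obtain R where R: "R > 0" "\<And>\<zeta>. norm \<zeta> \<le> R \<Longrightarrow> l + cscale \<zeta> v \<in> symm_bidisc"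
    using line_in_open[OF open_symm_bidisc l] by metis
  define d where "d n = pd1 F (sc n l) * (of_real (r n) * fst v) + pd2 F (sc n l) * ((of_real (r n))^2 * snd v)" for n
  have "d \<longlonglongrightarrow> pd1 F l * (of_real 1 * fst v) + pd2 F l * ((of_real 1)^2 * snd v)"
    unfolding d_def
    by (intro tendsto_intros r1 lim continuous_on_pd1_holomorphic2 continuous_on_pd2_holomorphic2 open_symm_bidisc hol l)
  then have dlim: "d \<longlonglongrightarrow> tderiv F l v" by (simp add: tderiv_def)
  have "norm (tderiv (bev (q n)) l v - d n) \<le> (1 / R) * e n" for n
  proof -
    define g where "g \<zeta> = bev (q n) (l + cscale \<zeta> v) - F (sc n (l + cscale \<zeta> v))" for \<zeta>
    have line: "sc n (l + cscale \<zeta> v) =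
        (of_real (r n) * fst l + \<zeta> * (of_real (r n) * fst v), (of_real (r n))^2 * snd l + \<zeta> * ((of_real (r n))^2 * snd v))" for \<zeta>
      by (simp add: sc_def cscale_def algebra_simps)
    have g1: "((\<lambda>\<zeta>. F (sc n (l + cscale \<zeta> v))) has_field_derivative
        (pd1 F (sc n (l + cscale \<zeta> v)) * (of_real (r n) * fst v) + pd2 F (sc n (l + cscale \<zeta> v)) * ((of_real (r n))^2 * snd v))) (at \<zeta>)"
      if "norm \<zeta> \<le> R" for \<zeta>
      unfolding line by (rule holomorphic2_line[OF hol]) (rule sc_in[OF R(2)[OF that], of n, unfolded line])
    have g2: "(\<lambda>\<zeta>. bev (q n) (l + cscale \<zeta> v)) holomorphic_on cball 0 R"
      by (rule holomorphic_on_cscale[OF holomorphic2_bev]) simp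
    have g3: "(\<lambda>\<zeta>. F (sc n (l + cscale \<zeta> v))) holomorphic_on cball 0 R"
      unfolding holomorphic_on_def field_differentiable_def
      using g1 by (meson has_field_derivative_at_within mem_cball_0)
    have g: "g holomorphic_on cball 0 R"
      unfolding g_def by (intro holomorphic_on_diff g2 g3)
    have "norm ((deriv ^^ 1) g 0) \<le> fact 1 * e n / R ^ 1"
    proof (rule Cauchy_inequality)
      show "norm (g \<zeta>) \<le> e n" if "norm (0 - \<zeta>) = R" for \<zeta>
        unfolding g_def using that by (intro q R) simp
    qed (use g R in \<open>auto intro: holomorphic_on_subset holomorphic_on_imp_continuous_on\<close>)
    moreover have "deriv g 0 = tderiv (bev (q n)) l v - d n"
    proof (rule DERIV_imp_deriv)
      show "(g has_field_derivative (tderiv (bev (q n)) l v - d n)) (at 0)"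
        unfolding g_def d_def
        using g1[of 0] R by (intro DERIV_diff tderiv_line[OF holomorphic2_bev]) auto
    qed
    ultimately show ?thesis by simp
  qed
  from tendsto_add[OF close[OF this] dlim]
  have td: "(\<lambda>n. tderiv (bev (q n)) l v) \<longlonglongrightarrow> tderiv F l v" by simp
  have C: "norm (bev (q n) x) \<le> 1 + e n" if "x \<in> symm_bidisc" for n x
    using norm_triangle_ineq2[of "bev (q n) x" "F (sc n x)"] q[OF that, of n] bnd[OF sc_in[OF that, of n]] by linarith
  have "(\<lambda>n. 1 + e n) \<longlonglongrightarrow> 1" using tendsto_add[OF tendsto_const[of 1] e0] by simp
  then show ?thesis
    by (intro exI[of _ q] exI[of _ "\<lambda>n. 1 + e n"] conjI allI ballI C val l \<mu> td)
qed

theorem three_jet_von_neumann: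
  assumes F: "F \<in> Hol_symm_bidisc_disc" and l: "l \<in> symm_bidisc" and \<mu>: "\<mu> \<in> symm_bidisc"
    and L: "pos_def L"
    and strict: "\<And>\<omega> x. norm \<omega> = 1 \<Longrightarrow> x \<noteq> 0 \<Longrightarrow>
      herm L ((2 * \<omega>) *s (jet (snd l) (snd v) (snd \<mu>) *v x) - jet (fst l) (fst v) (fst \<mu>) *v x)
        < herm L (2 *s x - \<omega> *s (jet (fst l) (fst v) (fst \<mu>) *v x))"
  shows "herm L (jet (F l) (tderiv F l v) (F \<mu>) *v x) \<le> herm L x"
proof -
  obtain q C where C: "\<And>n x. x \<in> symm_bidisc \<Longrightarrow> norm (bev (q n) x) \<le> C n" "C \<longlonglongrightarrow> 1"
    and q: "(\<lambda>n. bev (q n) l) \<longlonglongrightarrow> F l" "(\<lambda>n. bev (q n) \<mu>) \<longlonglongrightarrow> F \<mu>"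
    "(\<lambda>n. tderiv (bev (q n)) l v) \<longlonglongrightarrow> tderiv F l v"
    using bpoly_jet_approximation[OF F l \<mu>] by blast
  have "jet (fst l) (fst v) (fst \<mu>) ** jet (snd l) (snd v) (snd \<mu>) = jet (snd l) (snd v) (snd \<mu>) ** jet (fst l) (fst v) (fst \<mu>)"
    by (simp add: jet_mult mult_ac add_ac)
  from von_neumann_symm_bidisc[OF L this strict C(1)]
  have "herm L (jet (bev (q n) l) (tderiv (bev (q n)) l v) (bev (q n) \<mu>) *v x) \<le> (C n)^2 * herm L x" for n
    unfolding bop_jet .
  moreover have "(\<lambda>n. herm L (jet (bev (q n) l) (tderiv (bev (q n)) l v) (bev (q n) \<mu>) *v x))
      \<longlonglongrightarrow> herm L (jet (F l) (tderiv F l v) (F \<mu>) *v x)"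
    by (intro tendsto_herm tendsto_jet q)
  moreover have "(\<lambda>n. (C n)^2 * herm L x) \<longlonglongrightarrow> 1^2 * herm L x"
    by (intro tendsto_intros C)
  ultimately have "herm L (jet (F l) (tderiv F l v) (F \<mu>) *v x) \<le> 1^2 * herm L x"
    by (intro LIMSEQ_le) auto
  then show ?thesis by simp
qed

section \<open>Hermitian forms that certify jet inequalities\<close>

definition hmat :: "real \<Rightarrow> real \<Rightarrow> real \<Rightarrow> complex \<Rightarrow> complex \<Rightarrow> complex^3^3" where
  "hmat p q r A B = vector [vector [of_real p, 0, A], vector [0, of_real q, B], vector [cnj A, cnj B, of_real r]]"

lemma adj_hmat: "adj (hmat p q r A B) = hmat p q r A B"
  by (simp add: adj_def hmat_def vec_eq_iff forall_3)

lemma herm_hmat: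
  "herm (hmat p q r A B) x = p * (norm (x $ 1))^2 + q * (norm (x $ 2))^2 + r * (norm (x $ 3))^2
    + 2 * Re (A * cnj (x $ 1) * x $ 3) + 2 * Re (B * cnj (x $ 2) * x $ 3)"
  unfolding cmod_power2
  by (simp add: herm_def hdot_def hmat_def matrix_vector_mult_def sum_3 algebra_simps power2_eq_square)

text \<open>On the compact set where \<open>g \<le> 0\<close> the function \<open>f\<close> is
  positive, hence bounded below by some \<open>f x0 > 0\<close>, and a large multiple outweighs the
  minimum \<open>g x1\<close>. Where \<open>g > 0\<close> nothing is to be done.\<close>

lemma compact_perturbation:
  fixes f g :: "'a :: topological_space \<Rightarrow> real"
  assumes X: "compact X" and f: "continuous_on X f" and g: "continuous_on X g"
    and f0: "\<And>x. x \<in> X \<Longrightarrow> f x \<ge> 0" and g0: "\<And>x. x \<in> X \<Longrightarrow> f x = 0 \<Longrightarrow> g x > 0"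
  shows "\<exists>N0>0. \<forall>N\<ge>N0. \<forall>x\<in>X. N * f x + g x > 0"
proof (cases "X \<inter> g -` {..0} = {}")
  case True
  have "N * f x + g x > 0" if "N \<ge> 1" "x \<in> X" for N x
  proof -
    have "g x > 0" using True that by (auto simp: not_le)
    moreover have "N * f x \<ge> 0" using that f0 by simp
    ultimately show ?thesis by simp
  qed
  then show ?thesis by (intro exI[of _ 1]) auto
next
  case False
  have K: "compact (X \<inter> g -` {..0})"
  proof -
    obtain C where "closed C" "C \<inter> X = g -` {..0} \<inter> X"
      using continuous_on_closed_invariant g closed_atMost by metis
    then show ?thesis using compact_Int_closed[OF X, of C] by (simp add: Int_commute)
  qed
  obtain x0 where x0: "x0 \<in> X \<inter> g -` {..0}" "\<And>y. y \<in> X \<inter> g -` {..0} \<Longrightarrow> f x0 \<le> f y"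
    using continuous_attains_inf[OF K False continuous_on_subset[OF f]] by (metis inf_le1)
  obtain x1 where x1: "x1 \<in> X" "\<And>y. y \<in> X \<Longrightarrow> g x1 \<le> g y"
    using continuous_attains_inf[OF X _ g] False by blast
  have fx0: "f x0 > 0" using x0(1) f0[of x0] g0[of x0] by fastforce
  have gx1: "g x1 \<le> 0" using x1(2)[of x0] x0(1) by auto
  define N0 where "N0 = (1 - g x1) / f x0"
  have "N * f x + g x > 0" if N: "N \<ge> N0" and x: "x \<in> X" for N x
  proof (cases "g x > 0")
    case True
    moreover have "N0 \<ge> 0" using fx0 gx1 by (simp add: N0_def)
    then have "N * f x \<ge> 0" using N f0[OF x] by simp
    ultimately show ?thesis by simp
  next
    case False
    then have "f x \<ge> f x0" using x by (intro x0(2)) auto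
    have "1 - g x1 = N0 * f x0" using fx0 by (simp add: N0_def)
    also have "\<dots> \<le> N * f x"
      using N \<open>f x \<ge> f x0\<close> fx0 gx1 by (intro mult_mono) (auto simp: N0_def intro: order_trans[of _ "N0"])
    finally show ?thesis using x1(2)[OF x] by linarith
  qed
  moreover have "N0 > 0" using fx0 gx1 by (simp add: N0_def)
  ultimately show ?thesis by blast
qed

text \<open>The form \<^term>\<open>\<bar>x\<^sub>1\<bar>\<^sup>2 + \<bar>x\<^sub>2\<bar>\<^sup>2\<close> certifies the Schwarz-Pick inequality for a jet.\<close>
lemma jet_defect:
  assumes a: "norm a < 1" and b: "norm b \<le> 1 - (norm a)^2"
  shows "herm (hmat 1 1 0 0 0) (jet a b y *v u) \<le> herm (hmat 1 1 0 0 0) u"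
    and "norm b < 1 - (norm a)^2 \<Longrightarrow> herm (hmat 1 1 0 0 0) (jet a b y *v u) = herm (hmat 1 1 0 0 0) u \<Longrightarrow>
      u $ 1 = 0 \<and> u $ 2 = 0"
proof -
  define \<alpha> \<beta> \<xi> \<eta> where "\<alpha> = norm a" and "\<beta> = 1 - (norm a)^2" and "\<xi> = norm (u $ 1)" and "\<eta> = norm (u $ 2)"
  have nn: "\<alpha> \<ge> 0" "\<beta> > 0" "\<xi> \<ge> 0" "\<eta> \<ge> 0"
    using a by (auto simp: \<alpha>_def \<beta>_def \<xi>_def \<eta>_def power_less_one_iff)
  have \<beta>: "\<beta> = 1 - \<alpha>^2" by (simp add: \<alpha>_def \<beta>_def)
  have tri: "norm (b * u $ 1 + a * u $ 2) \<le> norm b * \<xi> + \<alpha> * \<eta>"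
    using norm_triangle_ineq[of "b * u $ 1" "a * u $ 2"] by (simp add: norm_mult \<alpha>_def \<xi>_def \<eta>_def)
  have sq: "(norm (b * u $ 1 + a * u $ 2))^2 \<le> (norm b * \<xi> + \<alpha> * \<eta>)^2"
    using tri by (intro power_mono) auto
  have sq2: "(norm b * \<xi> + \<alpha> * \<eta>)^2 \<le> (\<beta> * \<xi> + \<alpha> * \<eta>)^2"
    using nn b by (intro power_mono add_right_mono mult_right_mono) (auto simp: \<beta>_def)
  \<comment> \<open>At the largest admissible value \<beta> of \<open>norm b\<close> the worst-case
    defect is \<beta> times a square; a smaller \<open>norm b\<close> only helps.\<close>
  have id: "\<xi>^2 + \<eta>^2 - \<alpha>^2 * \<xi>^2 - (\<beta> * \<xi> + \<alpha> * \<eta>)^2 = \<beta> * (\<alpha> * \<xi> - \<eta>)^2"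
    unfolding \<beta> by (simp add: power2_eq_square algebra_simps)
  have h: "herm (hmat 1 1 0 0 0) (jet a b y *v u) = \<alpha>^2 * \<xi>^2 + (norm (b * u $ 1 + a * u $ 2))^2"
    "herm (hmat 1 1 0 0 0) u = \<xi>^2 + \<eta>^2"
    by (simp_all add: herm_hmat jet_vec norm_mult power_mult_distrib \<alpha>_def \<xi>_def \<eta>_def)
  have nnid: "\<beta> * (\<alpha> * \<xi> - \<eta>)^2 \<ge> 0" using nn by simp
  show "herm (hmat 1 1 0 0 0) (jet a b y *v u) \<le> herm (hmat 1 1 0 0 0) u"
    unfolding h using sq sq2 id nnid by linarith
  assume lt: "norm b < 1 - (norm a)^2"
    and eq: "herm (hmat 1 1 0 0 0) (jet a b y *v u) = herm (hmat 1 1 0 0 0) u"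
  have \<xi>0: "\<xi> = 0"
  proof (rule ccontr)
    assume "\<xi> \<noteq> 0"
    then have "norm b * \<xi> < \<beta> * \<xi>" using lt nn by (simp add: \<beta>_def)
    then have "(norm b * \<xi> + \<alpha> * \<eta>)^2 < (\<beta> * \<xi> + \<alpha> * \<eta>)^2"
      using nn by (intro power_strict_mono) auto
    then show False using eq sq id nnid unfolding h by linarith
  qed
  have "\<beta> * \<eta>^2 \<le> 0"
    using eq sq id unfolding h by (simp add: \<xi>0 \<beta> algebra_simps power_mult_distrib)
  then have "\<eta> = 0" using nn by (simp add: mult_le_0_iff)
  with \<xi>0 show "u $ 1 = 0 \<and> u $ 2 = 0" by (simp add: \<xi>_def \<eta>_def)
qed

text \<open>The vector version of \<open>norm_moebius_defect\<close>: for \<open>w = T u\<close> it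
  relates the defect of \<open>T\<close> to that of its Moebius transform. Definiteness is not
  assumed, as the perturbation form may be indefinite.\<close>

lemma moebius_defect:
  assumes M: "adj M = M"
  shows "herm M (u - cnj \<alpha> *s w) - herm M (w - \<alpha> *s u) = (1 - (norm \<alpha>)^2) * (herm M u - herm M w)"
proof -
  have 1: "u - cnj \<alpha> *s w = u + (- cnj \<alpha>) *s w" and 2: "w - \<alpha> *s u = w + (- \<alpha>) *s u"
    by simp_all
  have "hdot (M *v w) u = cnj (hdot (M *v u) w)"
    using M by (simp add: hdot_adj cnj_hdot)
  then have 3: "Re (hdot (M *v w) ((- \<alpha>) *s u)) = Re (hdot (M *v u) ((- cnj \<alpha>) *s w))"
    unfolding hdot_scale_right by simp
  show ?thesis
    unfolding 1 2 herm_add[OF M] herm_scale 3 by (simp add: algebra_simps)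
qed

text \<open>If the jet of $\Phi$ is extremal, it is a Moebius transform of a jet with value $0$ and derivative $1$.\<close>
lemma extremal_jet_defect:
  assumes \<alpha>: "norm \<alpha> < 1" and c: "norm c = 1" and y: "norm y < 1"
    and z: "z = c * ((y - \<alpha>) / (1 - cnj \<alpha> * y))"
    and AB: "(norm (A - B * z))^2 < 1 - (norm z)^2"
    and b: "b = cnj c * of_real (1 - (norm \<alpha>)^2)" and u: "u \<noteq> 0"
    and eq: "herm (hmat 1 1 0 0 0) (jet \<alpha> b y *v u) = herm (hmat 1 1 0 0 0) u"
  shows "herm (hmat 1 0 1 A B) (jet \<alpha> b y *v u) < herm (hmat 1 0 1 A B) u"
proof -
  define w where "w = jet \<alpha> b y *v u"
  \<comment> \<open>Writing T for the jet, \<open>h\<close> is (1 - cnj \<alpha> T) u. The Moebius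
    transform of T is \<open>jet 0 1 z\<close>, and it sends \<open>h\<close> to a unimodular
    multiple of \<open>w - \<alpha> *s u\<close>.\<close>
  define h where "h = u - cnj \<alpha> *s w"
  define k where "k = 1 - (norm \<alpha>)^2"
  have k: "k > 0" "complex_of_real k = 1 - \<alpha> * cnj \<alpha>"
    using \<alpha> complex_norm_square[of \<alpha>] by (simp_all add: k_def power_less_one_iff)
  have cc: "c * cnj c = 1" using c complex_norm_square[of c] by simp
  note den = one_minus_cnj_mult_nonzero[OF \<alpha> y]
  have h1: "h $ 1 = of_real k * u $ 1" by (simp add: h_def w_def jet_vec k algebra_simps)
  have h2: "h $ 2 = of_real k * u $ 2 - cnj \<alpha> * b * u $ 1" by (simp add: h_def w_def jet_vec k algebra_simps)
  have h3: "h $ 3 = (1 - cnj \<alpha> * y) * u $ 3" by (simp add: h_def w_def jet_vec algebra_simps)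
  have w: "w - \<alpha> *s u = cnj c *s (jet 0 1 z *v h)"
  proof -
    have "cnj c * (c * ((y - \<alpha>) / (1 - cnj \<alpha> * y)) * ((1 - cnj \<alpha> * y) * u $ 3)) = (y - \<alpha>) * u $ 3"
      using den cc by (simp add: mult_ac)
    then show ?thesis
      by (simp add: vec3_eq_iff jet_vec w_def h1 h3 z b k_def[symmetric] algebra_simps)
  qed
  have def: "herm M h - herm M (jet 0 1 z *v h) = k * (herm M u - herm M w)" if "adj M = M" for M
    using moebius_defect[OF that, of u \<alpha> w] unfolding h_def[symmetric] w herm_scale by (simp add: c k_def)
  \<comment> \<open>\<open>jet 0 1 z\<close> moves the first coordinate to the second, so its defect
    for \<open>hmat 1 1 0 0 0\<close> is just \<open>(norm (h $ 2))^2\<close>, and \<open>eq\<close>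
    makes it zero.\<close>
  have h20: "h $ 2 = 0"
    using def[OF adj_hmat, of 1 1 0 0 0] eq unfolding w_def[symmetric] by (simp add: herm_hmat jet_vec)
  have hne: "h $ 1 \<noteq> 0 \<or> h $ 3 \<noteq> 0"
  proof (rule ccontr)
    assume "\<not> ?thesis"
    then have "u $ 1 = 0" "u $ 3 = 0" using h1 h3 k(1) den by auto
    moreover then have "u $ 2 = 0" using h2 h20 k(1) by simp
    ultimately show False using u by (simp add: vec3_eq_iff)
  qed
  have "herm (hmat 1 0 1 A B) h - herm (hmat 1 0 1 A B) (jet 0 1 z *v h) =
      (norm (h $ 1))^2 + (1 - (norm z)^2) * (norm (h $ 3))^2 + 2 * Re ((A - B * z) * cnj (h $ 1) * h $ 3)"
    by (simp add: herm_hmat jet_vec h20 norm_mult power_mult_distrib algebra_simps)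
  also have "\<dots> > 0"
  proof -
    define \<sigma> where "\<sigma> = norm (A - B * z)"
    define \<xi> \<eta> where "\<xi> = norm (h $ 1)" and "\<eta> = norm (h $ 3)"
    have "\<bar>Re ((A - B * z) * cnj (h $ 1) * h $ 3)\<bar> \<le> \<sigma> * \<xi> * \<eta>"
      using abs_Re_le_cmod[of "(A - B * z) * cnj (h $ 1) * h $ 3"] by (simp add: norm_mult \<sigma>_def \<xi>_def \<eta>_def)
    \<comment> \<open>Completion of the square; the coefficient left over is positive by
      \<open>AB\<close>.\<close>
    moreover have "(\<xi> - \<sigma> * \<eta>)^2 + (1 - (norm z)^2 - \<sigma>^2) * \<eta>^2 > 0"
    proof (cases "\<eta> = 0")
      case True
      then show ?thesis using hne by (simp add: \<xi>_def \<eta>_def)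
    next
      case False
      then have "(1 - (norm z)^2 - \<sigma>^2) * \<eta>^2 > 0" using AB by (simp add: \<sigma>_def)
      then show ?thesis by (smt (verit) zero_le_power2)
    qed
    moreover have "(\<xi> - \<sigma> * \<eta>)^2 + (1 - (norm z)^2 - \<sigma>^2) * \<eta>^2 = \<xi>^2 + (1 - (norm z)^2) * \<eta>^2 - 2 * (\<sigma> * \<xi> * \<eta>)"
      by (simp add: power2_eq_square algebra_simps)
    ultimately show ?thesis by (simp only: \<xi>_def[symmetric] \<eta>_def[symmetric])
  qed
  finally have "k * (herm (hmat 1 0 1 A B) u - herm (hmat 1 0 1 A B) w) > 0"
    using def[OF adj_hmat] by simp
  then show ?thesis using k(1) by (simp add: zero_less_mult_iff w_def)
qed

text \<open>Clearing the denominator of \<open>Phi \<omega>\<close> is an identity between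
  functions, hence between jets. It turns the strict hypothesis of
  \<open>three_jet_von_neumann\<close> into a statement about the jet of \<open>Phi \<omega>\<close>
  on vectors that are again nonzero.\<close>

lemma Phi_jet:
  fixes v :: "complex \<times> complex"
  assumes l: "l \<in> symm_bidisc" and \<mu>: "\<mu> \<in> symm_bidisc" and \<omega>: "norm \<omega> = 1"
  defines "S \<equiv> jet (fst l) (fst v) (fst \<mu>)" and "P \<equiv> jet (snd l) (snd v) (snd \<mu>)"
  shows "(2 * \<omega>) *s (P *v x) - S *v x =
    jet (Phi \<omega> l) (tderiv (Phi \<omega>) l v) (Phi \<omega> \<mu>) *v (2 *s x - \<omega> *s (S *v x))"
    and "x \<noteq> 0 \<Longrightarrow> 2 *s x - \<omega> *s (S *v x) \<noteq> 0"
proof -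
  have eq: "Phi \<omega> x * (2 + (- \<omega>) * fst x + 0 * snd x) = 0 + (- 1) * fst x + 2 * \<omega> * snd x"
    if "x \<in> symm_bidisc" for x
    using Phi_denominator[of "fst x" "snd x" \<omega>] that \<omega>
    by (simp add: Phi_def split_beta)
  have aff: "holomorphic2_on (\<lambda>x. k + a * fst x + b * snd x) symm_bidisc" for k a b
    by (intro holomorphic2_intros)
  have "tderiv (\<lambda>x. Phi \<omega> x * (2 + (- \<omega>) * fst x + 0 * snd x)) l v =
      tderiv (\<lambda>x. 0 + (- 1) * fst x + 2 * \<omega> * snd x) l v"
    by (rule tderiv_cong_open[OF aff open_symm_bidisc l]) (simp only: eq)
  then have D: "Phi \<omega> l * (- \<omega> * fst v) + tderiv (Phi \<omega>) l v * (2 - \<omega> * fst l) = - fst v + 2 * \<omega> * snd v"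
    unfolding tderiv_mult[OF holomorphic2_Phi[OF \<omega>] aff l] tderiv_affine by simp
  have E: "Phi \<omega> l * (2 - \<omega> * fst l) = 2 * \<omega> * snd l - fst l"
    "Phi \<omega> \<mu> * (2 - \<omega> * fst \<mu>) = 2 * \<omega> * snd \<mu> - fst \<mu>"
    using eq[OF l] eq[OF \<mu>] by simp_all
  show "(2 * \<omega>) *s (P *v x) - S *v x =
    jet (Phi \<omega> l) (tderiv (Phi \<omega>) l v) (Phi \<omega> \<mu>) *v (2 *s x - \<omega> *s (S *v x))"
  proof -
    have "2 * \<omega> * (snd l * x $ 1) - fst l * x $ 1 = Phi \<omega> l * (2 * x $ 1 - \<omega> * (fst l * x $ 1))"
      using arg_cong[OF E(1), of "\<lambda>t. t * x $ 1"] by (simp add: algebra_simps)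
    moreover have "2 * \<omega> * (snd v * x $ 1 + snd l * x $ 2) - (fst v * x $ 1 + fst l * x $ 2) =
        tderiv (Phi \<omega>) l v * (2 * x $ 1 - \<omega> * (fst l * x $ 1)) +
        Phi \<omega> l * (2 * x $ 2 - \<omega> * (fst v * x $ 1 + fst l * x $ 2))"
    proof -
      have "tderiv (Phi \<omega>) l v * (2 * x $ 1 - \<omega> * (fst l * x $ 1)) +
          Phi \<omega> l * (2 * x $ 2 - \<omega> * (fst v * x $ 1 + fst l * x $ 2)) =
          (Phi \<omega> l * (2 - \<omega> * fst l)) * x $ 2 +
          (Phi \<omega> l * (- \<omega> * fst v) + tderiv (Phi \<omega>) l v * (2 - \<omega> * fst l)) * x $ 1"
        by (simp add: algebra_simps)
      also have "\<dots> = 2 * \<omega> * (snd v * x $ 1 + snd l * x $ 2) - (fst v * x $ 1 + fst l * x $ 2)"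
        unfolding E(1) D by (simp add: algebra_simps)
      finally show ?thesis by simp
    qed
    moreover have "2 * \<omega> * (snd \<mu> * x $ 3) - fst \<mu> * x $ 3 = Phi \<omega> \<mu> * (2 * x $ 3 - \<omega> * (fst \<mu> * x $ 3))"
      using arg_cong[OF E(2), of "\<lambda>t. t * x $ 3"] by (simp add: algebra_simps)
    ultimately show ?thesis
      unfolding vec3_eq_iff S_def P_def by (simp add: jet_vec)
  qed
  show "2 *s x - \<omega> *s (S *v x) \<noteq> 0" if "x \<noteq> 0"
  proof
    assume "2 *s x - \<omega> *s (S *v x) = 0"
    then have 0: "(2 - \<omega> * fst l) * x $ 1 = 0" "(2 - \<omega> * fst l) * x $ 2 = \<omega> * fst v * x $ 1"
      "(2 - \<omega> * fst \<mu>) * x $ 3 = 0"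
      by (simp_all add: vec3_eq_iff S_def jet_vec algebra_simps)
    have "2 - \<omega> * fst l \<noteq> 0" "2 - \<omega> * fst \<mu> \<noteq> 0"
      using Phi_denominator[of "fst l" "snd l" \<omega>] Phi_denominator[of "fst \<mu>" "snd \<mu>" \<omega>] l \<mu> \<omega> by simp_all
    then have "x $ 1 = 0 \<and> x $ 2 = 0 \<and> x $ 3 = 0" using 0 by simp
    then show False using that by (simp add: vec3_eq_iff)
  qed
qed

text \<open>Here the direction is meant to be scaled to Caratheodory norm 1, so that
  \<open>le\<close> is the Schwarz-Pick bound. Assumption \<open>D\<close> says that
  \<open>c j\<close> is the phase for which the Moebius transform of \<open>Phi (\<omega> j)\<close>
  has value 0 and derivative 1.\<close>

locale jet_extremals =
  fixes l v :: "complex \<times> complex" and J :: "nat set" and \<omega> c \<alpha> :: "nat \<Rightarrow> complex"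
  assumes l: "l \<in> symm_bidisc"
    and le: "\<And>\<zeta>. norm \<zeta> = 1 \<Longrightarrow> norm (tderiv (Phi \<zeta>) l v) \<le> 1 - (norm (Phi \<zeta> l))^2"
    and less: "\<And>\<zeta>. norm \<zeta> = 1 \<Longrightarrow> \<zeta> \<notin> \<omega> ` J \<Longrightarrow> norm (tderiv (Phi \<zeta>) l v) < 1 - (norm (Phi \<zeta> l))^2"
    and \<omega>: "\<And>j. j \<in> J \<Longrightarrow> norm (\<omega> j) = 1" and c: "\<And>j. j \<in> J \<Longrightarrow> norm (c j) = 1"
    and \<alpha>: "\<And>j. j \<in> J \<Longrightarrow> Phi (\<omega> j) l = \<alpha> j"
    and D: "\<And>j. j \<in> J \<Longrightarrow> tderiv (Phi (\<omega> j)) l v = cnj (c j) * of_real (1 - (norm (\<alpha> j))^2)"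
begin

text \<open>For large \<^term>\<open>N\<close> the form \<^term>\<open>N * (\<bar>x\<^sub>1\<bar>\<^sup>2 + \<bar>x\<^sub>2\<bar>\<^sup>2)\<close> dominates except in the directions in which
  some \<^term>\<open>Phi \<zeta>\<close> is extremal; by extremality of \<^term>\<open>F\<close> it drops out of the conclusion.\<close>
lemma three_jet_inequality:
  assumes \<mu>: "\<mu> \<in> symm_bidisc" and F: "F \<in> Hol_symm_bidisc_disc" "F l = 0" "tderiv F l v = 1"
    and z: "\<And>j. j \<in> J \<Longrightarrow> z j = c j * ((Phi (\<omega> j) \<mu> - \<alpha> j) / (1 - cnj (\<alpha> j) * Phi (\<omega> j) \<mu>))"
    and AB: "\<And>j. j \<in> J \<Longrightarrow> (norm (A - B * z j))^2 < 1 - (norm (z j))^2"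
  shows "(norm (A - B * F \<mu>))^2 \<le> 1 - (norm (F \<mu>))^2"
proof -
  define S P where "S = jet (fst l) (fst v) (fst \<mu>)" and "P = jet (snd l) (snd v) (snd \<mu>)"
  define u w where "u \<zeta> x = 2 *s x - \<zeta> *s (S *v x)" and "w \<zeta> x = (2 * \<zeta>) *s (P *v x) - S *v x" for \<zeta> x
  define H0 H1 where "H0 = hmat 1 1 0 0 0" and "H1 = hmat 1 0 1 A B"
  define X where "X = sphere (0 :: complex) 1 \<times> sphere (0 :: complex^3) 1"
  have w: "w \<zeta> x = jet (Phi \<zeta> l) (tderiv (Phi \<zeta>) l v) (Phi \<zeta> \<mu>) *v u \<zeta> x" if "norm \<zeta> = 1" for \<zeta> x
    unfolding u_def w_def S_def P_def by (rule Phi_jet[OF l \<mu> that])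
  have u0: "u \<zeta> x \<noteq> 0" if "norm \<zeta> = 1" "x \<noteq> 0" for \<zeta> x
    unfolding u_def S_def by (rule Phi_jet(2)[OF l \<mu> that])
  have contM: "continuous_on X (\<lambda>x. M *v snd x)" for M :: "complex^3^3"
    unfolding matrix_vector_mult_def
    by (intro continuous_on_vec_lambda continuous_intros)
  have contu: "continuous_on X (\<lambda>x. u (fst x) (snd x))"
    unfolding u_def vector_scalar_mult_def
    by (intro continuous_intros continuous_on_vec_lambda contM)
  have contw: "continuous_on X (\<lambda>x. w (fst x) (snd x))"
    unfolding w_def vector_scalar_mult_def
    by (intro continuous_intros continuous_on_vec_lambda contM)
  have "\<exists>N0>0. \<forall>N\<ge>N0. \<forall>x\<in>X. N * (herm H0 (u (fst x) (snd x)) - herm H0 (w (fst x) (snd x))) +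
      (herm H1 (u (fst x) (snd x)) - herm H1 (w (fst x) (snd x))) > 0"
  proof (rule compact_perturbation)
    show "compact X" unfolding X_def by (intro compact_Times compact_sphere)
    show "continuous_on X (\<lambda>x. herm H0 (u (fst x) (snd x)) - herm H0 (w (fst x) (snd x)))"
      "continuous_on X (\<lambda>x. herm H1 (u (fst x) (snd x)) - herm H1 (w (fst x) (snd x)))"
      by (intro continuous_intros contu contw)+
    fix x assume x: "x \<in> X"
    define \<zeta> y where "\<zeta> = fst x" and "y = snd x"
    have \<zeta>: "norm \<zeta> = 1" "y \<noteq> 0" using x by (auto simp: X_def \<zeta>_def y_def)
    show "0 \<le> herm H0 (u (fst x) (snd x)) - herm H0 (w (fst x) (snd x))"
      using jet_defect(1)[OF norm_Phi_less_1[OF l \<zeta>(1)] le[OF \<zeta>(1)]]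
      unfolding \<zeta>_def[symmetric] y_def[symmetric] w[OF \<zeta>(1)] H0_def by simp
    assume "herm H0 (u (fst x) (snd x)) - herm H0 (w (fst x) (snd x)) = 0"
    then have eq: "herm H0 (jet (Phi \<zeta> l) (tderiv (Phi \<zeta>) l v) (Phi \<zeta> \<mu>) *v u \<zeta> y) = herm H0 (u \<zeta> y)"
      unfolding \<zeta>_def[symmetric] y_def[symmetric] w[OF \<zeta>(1)] by simp
    have "herm H1 (u \<zeta> y) - herm H1 (w \<zeta> y) > 0"
    proof (cases "\<zeta> \<in> \<omega> ` J")
      case True
      then obtain j where j: "j \<in> J" "\<zeta> = \<omega> j" by blast
      have "herm H1 (jet (\<alpha> j) (tderiv (Phi \<zeta>) l v) (Phi \<zeta> \<mu>) *v u \<zeta> y) < herm H1 (u \<zeta> y)"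
        unfolding H1_def
      proof (rule extremal_jet_defect[OF _ c[OF j(1)] _ _ AB[OF j(1)]])
        show "norm (\<alpha> j) < 1" using norm_Phi_less_1[OF l \<omega>[OF j(1)]] by (simp add: \<alpha>[OF j(1)])
        show "norm (Phi \<zeta> \<mu>) < 1" by (rule norm_Phi_less_1[OF \<mu> \<zeta>(1)])
        show "z j = c j * ((Phi \<zeta> \<mu> - \<alpha> j) / (1 - cnj (\<alpha> j) * Phi \<zeta> \<mu>))"
          unfolding j(2) by (rule z[OF j(1)])
        show "tderiv (Phi \<zeta>) l v = cnj (c j) * of_real (1 - (norm (\<alpha> j))^2)"
          unfolding j(2) by (rule D[OF j(1)])
        show "u \<zeta> y \<noteq> 0" by (rule u0[OF \<zeta>])
        show "herm (hmat 1 1 0 0 0) (jet (\<alpha> j) (tderiv (Phi \<zeta>) l v) (Phi \<zeta> \<mu>) *v u \<zeta> y) = herm (hmat 1 1 0 0 0) (u \<zeta> y)"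
          using eq by (simp add: H0_def j(2) \<alpha>[OF j(1)])
      qed
      then show ?thesis unfolding w[OF \<zeta>(1)] by (simp add: j(2) \<alpha>[OF j(1)])
    next
      case False
      \<comment> \<open>For a non-extremal \<zeta>, equality leaves only the third coordinate, where
        \<open>H1\<close> has the positive defect 1 - |Phi \<zeta> \<mu>|^2.\<close>
      have "u \<zeta> y $ 1 = 0 \<and> u \<zeta> y $ 2 = 0"
        using jet_defect(2)[OF norm_Phi_less_1[OF l \<zeta>(1)] le[OF \<zeta>(1)] less[OF \<zeta>(1) False]] eq
        unfolding H0_def by blast
      moreover from this have "u \<zeta> y $ 3 \<noteq> 0" using u0[OF \<zeta>] by (simp add: vec3_eq_iff)
      moreover have "(norm (Phi \<zeta> \<mu>))^2 < 1"
        using norm_Phi_less_1[OF \<mu> \<zeta>(1)] by (simp add: power_less_one_iff)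
      ultimately show ?thesis
        unfolding w[OF \<zeta>(1)] H1_def by (simp add: herm_hmat jet_vec norm_mult power_mult_distrib)
    qed
    then show "0 < herm H1 (u (fst x) (snd x)) - herm H1 (w (fst x) (snd x))"
      by (simp add: \<zeta>_def y_def)
  qed
  then obtain N0 where N0: "\<And>N x. N \<ge> N0 \<Longrightarrow> x \<in> X \<Longrightarrow>
      N * (herm H0 (u (fst x) (snd x)) - herm H0 (w (fst x) (snd x))) +
      (herm H1 (u (fst x) (snd x)) - herm H1 (w (fst x) (snd x))) > 0" by blast
  \<comment> \<open>A second compactness argument, because the combined form has to be positive
    definite itself.\<close>
  have "\<exists>N1>0. \<forall>N\<ge>N1. \<forall>x\<in>sphere 0 1. N * herm H0 x + herm H1 x > 0"
  proof (rule compact_perturbation)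
    fix x :: "complex^3" assume x: "x \<in> sphere 0 1"
    show "herm H0 x \<ge> 0" by (simp add: H0_def herm_hmat)
    assume "herm H0 x = 0"
    then have "(norm (x $ 1))^2 + (norm (x $ 2))^2 = 0" by (simp add: H0_def herm_hmat)
    then have "x $ 1 = 0" "x $ 2 = 0" by (simp_all add: sum_power2_eq_zero_iff)
    moreover have "x \<noteq> 0" using x by auto
    then have "x $ 3 \<noteq> 0" using \<open>x $ 1 = 0\<close> \<open>x $ 2 = 0\<close> by (simp add: vec3_eq_iff)
    ultimately show "herm H1 x > 0" by (simp add: H1_def herm_hmat)
  qed (auto intro!: continuous_intros)
  then obtain N1 where "\<forall>N\<ge>N1. \<forall>x\<in>sphere 0 1. N * herm H0 x + herm H1 x > 0" by blast
  then have N1: "N * herm H0 x + herm H1 x > 0" if "N \<ge> N1" "norm x = 1" for N x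
    using that by simp
  define N where "N = max N0 N1"
  define L where "L = hmat (N + 1) N 1 A B"
  have hL: "herm L x = N * herm H0 x + herm H1 x" for x
    by (simp add: L_def H0_def H1_def herm_hmat algebra_simps)
  have unit: "\<exists>y. norm y = 1 \<and> x = complex_of_real (norm x) *s y" if "x \<noteq> 0" for x :: "complex^3"
  proof (intro exI conjI)
    show "norm ((1 / norm x) *\<^sub>R x) = 1" using that by simp
    show "x = complex_of_real (norm x) *s ((1 / norm x) *\<^sub>R x)"
      unfolding scaleR_eq_smult vector_smult_assoc using that by (simp flip: of_real_mult)
  qed
  have "pos_def L"
    unfolding pos_def_def
  proof (intro conjI allI impI)
    show "adj L = L" by (simp add: L_def adj_hmat)
    fix x :: "complex^3" assume x: "x \<noteq> 0"
    obtain y where y: "norm y = 1" "x = complex_of_real (norm x) *s y" using unit[OF x] by blast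
    have "herm L x = (norm x)^2 * herm L y" by (subst y(2)) (simp add: herm_scale)
    moreover have "herm L y > 0" unfolding hL using N1[of N y] y by (simp add: N_def)
    ultimately show "herm L x > 0" using x by simp
  qed
  moreover have "herm L (w \<zeta> x) < herm L (u \<zeta> x)" if \<zeta>: "norm \<zeta> = 1" and x: "x \<noteq> 0" for \<zeta> x
  proof -
    obtain y where y: "norm y = 1" "x = complex_of_real (norm x) *s y" using unit[OF x] by blast
    have "u \<zeta> x = complex_of_real (norm x) *s u \<zeta> y" "w \<zeta> x = complex_of_real (norm x) *s w \<zeta> y"
      unfolding u_def w_def
      by (subst y(2), simp add: vector_scalar_commute vector_ssub_ldistrib mult_ac)+
    then have "herm L (u \<zeta> x) = (norm x)^2 * herm L (u \<zeta> y)" "herm L (w \<zeta> x) = (norm x)^2 * herm L (w \<zeta> y)"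
      by (simp_all add: herm_scale)
    moreover have "herm L (w \<zeta> y) < herm L (u \<zeta> y)"
      unfolding hL using N0[of N "(\<zeta>, y)"] y \<zeta> by (simp add: N_def X_def algebra_simps)
    ultimately show ?thesis using x by simp
  qed
  ultimately have vN: "herm L (jet (F l) (tderiv F l v) (F \<mu>) *v x) \<le> herm L x" for x
    using three_jet_von_neumann[OF F(1) l \<mu>, of L v x] unfolding u_def w_def S_def P_def by blast
  define E k where "E = A - B * F \<mu>" and "k = 1 - (norm (F \<mu>))^2"
  have "norm (F \<mu>) < 1" using F(1) \<mu> by (auto simp: Hol_symm_bidisc_disc_def)
  then have k: "k > 0" by (simp add: k_def power_less_one_iff)
  \<comment> \<open>On the test vector (1, 0, y) the jet of \<open>F\<close> moves the entry 1 from
    the slot with weight \<open>N + 1\<close> to the slot with weight \<open>N\<close>; only the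
    difference 1 survives.\<close>
  have pos: "0 \<le> 1 + k * (norm y)^2 + 2 * Re (E * y)" for y
    using vN[of "vector [1, 0, y]"]
    by (simp add: L_def herm_hmat jet_vec F E_def k_def norm_mult power_mult_distrib algebra_simps)
  \<comment> \<open>The quadratic in \<open>y\<close> is evaluated at its minimiser.\<close>
  have "0 \<le> 1 - (norm E)^2 / k"
  proof -
    have "E * (- cnj E / of_real k) = - of_real ((norm E)^2 / k)"
      using complex_norm_square[of E] by simp
    then have "Re (E * (- cnj E / of_real k)) = - ((norm E)^2 / k)"
      by (simp only: Re_complex_of_real uminus_complex.sel)
    moreover have "k * (norm (- cnj E / of_real k))^2 = (norm E)^2 / k"
      using k by (simp add: norm_divide power_divide power2_eq_square)
    ultimately show ?thesis using pos[of "- cnj E / of_real k"] by linarith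
  qed
  then have "(norm E)^2 \<le> k" using k by (simp add: divide_le_eq_1_pos)
  then show ?thesis by (simp add: E_def k_def)
qed

theorem extremal_value_region:
  assumes J: "J = {1, 2}" and \<mu>: "\<mu> \<in> symm_bidisc"
    and F: "F \<in> Hol_symm_bidisc_disc" "F l = 0" "tderiv F l v = 1"
    and z: "\<And>j. j \<in> J \<Longrightarrow> z j = c j * ((Phi (\<omega> j) \<mu> - \<alpha> j) / (1 - cnj (\<alpha> j) * Phi (\<omega> j) \<mu>))"
    and z1: "\<And>j. j \<in> J \<Longrightarrow> norm (z j) < 1" and ne: "z 1 \<noteq> z 2"
    and t: "F \<mu> = t * z 1 + (1 - t) * z 2"
  shows "(norm t * sqrt (1 - (norm (z 1))^2) + norm (1 - t) * sqrt (1 - (norm (z 2))^2))^2 \<le> 1 - (norm (F \<mu>))^2"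
proof (rule field_le_mult_one_interval)
  fix q :: real assume q: "0 < q" "q < 1"
  define r where "r j = sqrt (1 - (norm (z j))^2)" for j
  have r: "(r j)^2 = 1 - (norm (z j))^2" "r j > 0" if "j \<in> J" for j
    using z1[OF that] by (auto simp: r_def power_less_one_iff abs_le_square_iff power_le_one_iff less_imp_le)
  have phase: "\<exists>e. norm e = 1 \<and> x * e = of_real (norm x)" for x :: complex
  proof (cases "x = 0")
    case False
    have "x * (cnj x / of_real (norm x)) = of_real (norm x)"
      using False complex_norm_square[of x] by (simp add: field_simps power2_eq_square)
    then show ?thesis using False by (intro exI[of _ "cnj x / of_real (norm x)"]) (simp add: norm_divide)
  qed (auto intro: exI[of _ 1])
  obtain e1 where e1: "norm e1 = 1" "t * e1 = of_real (norm t)" using phase by blast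
  obtain e2 where e2: "norm e2 = 1" "(1 - t) * e2 = of_real (norm (1 - t))" using phase by blast
  \<comment> \<open>Scaling by \<theta> puts the squared moduli of \<open>A1\<close> and
    \<open>A2\<close> at \<open>q\<close> times their limiting values, which gives the strict
    inequalities required. \<open>A\<close> and \<open>B\<close> then solve A - B z_j = A_j.\<close>
  define \<theta> where "\<theta> = sqrt q"
  define A1 A2 where "A1 = of_real (\<theta> * r 1) * e1" and "A2 = of_real (\<theta> * r 2) * e2"
  define B where "B = (A2 - A1) / (z 1 - z 2)"
  define A where "A = A1 + B * z 1"
  have A12: "A - B * z 1 = A1" "A - B * z 2 = A2"
  proof -
    have "B * (z 1 - z 2) = A2 - A1" using ne by (simp add: B_def)
    then show "A - B * z 1 = A1" "A - B * z 2 = A2" by (simp_all add: A_def algebra_simps)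
  qed
  have norms: "(norm A1)^2 = q * (r 1)^2" "(norm A2)^2 = q * (r 2)^2"
    using q e1 e2 by (simp_all add: A1_def A2_def norm_mult \<theta>_def power_mult_distrib del: of_real_mult)
  have "(norm (A - B * F \<mu>))^2 \<le> 1 - (norm (F \<mu>))^2"
  proof (rule three_jet_inequality[OF \<mu> F z])
    show "(norm (A - B * z j))^2 < 1 - (norm (z j))^2" if "j \<in> J" for j
    proof -
      have "(r j)^2 > 0" using r(2)[OF that] by simp
      then have "q * (r j)^2 < (r j)^2" using q by simp
      then have lt: "q * (r j)^2 < 1 - (norm (z j))^2" using r(1)[OF that] by linarith
      from that J consider "j = 1" | "j = 2" by auto
      then show ?thesis
      proof cases
        case 1
        show ?thesis using lt unfolding 1 A12 norms .
      next
        case 2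
        show ?thesis using lt unfolding 2 A12 norms .
      qed
    qed
  qed
  also have "A - B * F \<mu> = t * (A - B * z 1) + (1 - t) * (A - B * z 2)"
    unfolding t by (simp add: algebra_simps)
  also have "\<dots> = of_real (\<theta> * r 1) * (t * e1) + of_real (\<theta> * r 2) * ((1 - t) * e2)"
    unfolding A12 A1_def A2_def by (simp add: mult_ac)
  also have "\<dots> = of_real (\<theta> * (norm t * r 1 + norm (1 - t) * r 2))"
    unfolding e1 e2 by (simp add: algebra_simps)
  also have "(norm (complex_of_real (\<theta> * (norm t * r 1 + norm (1 - t) * r 2))))^2 = q * (norm t * r 1 + norm (1 - t) * r 2)^2"
    using q by (simp add: \<theta>_def power_mult_distrib norm_mult del: of_real_mult of_real_add)
  finally show "q * (norm t * sqrt (1 - (norm (z 1))^2) + norm (1 - t) * sqrt (1 - (norm (z 2))^2))^2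
      \<le> 1 - (norm (F \<mu>))^2"
    by (simp add: r_def)
qed

end

section \<open>Moebius weights and the zero set of the difference of the two extremals\<close>

lemma moebius_disc:
  assumes \<alpha>: "norm \<alpha> < 1" and y: "norm y < 1" and c: "norm c = 1"
    and z: "z = c * ((y - \<alpha>) / (1 - cnj \<alpha> * y))"
  shows "1 - cnj \<alpha> * y \<noteq> 0" and "norm z < 1" and "1 + cnj \<alpha> * cnj c * z \<noteq> 0"
    and "(norm (1 + cnj \<alpha> * cnj c * z))^2 * (1 - (norm y)^2) = (1 - (norm \<alpha>)^2) * (1 - (norm z)^2)"
proof -
  define k m where "k = 1 - (norm \<alpha>)^2" and "m = norm (1 - cnj \<alpha> * y)"
  have k: "k > 0" "complex_of_real k = 1 - \<alpha> * cnj \<alpha>"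
    using \<alpha> complex_norm_square[of \<alpha>] by (simp_all add: k_def power_less_one_iff)
  have cc: "cnj c * c = 1" using c complex_norm_square[of c] by (simp add: mult.commute)
  show den: "1 - cnj \<alpha> * y \<noteq> 0" by (rule one_minus_cnj_mult_nonzero[OF \<alpha> y])
  then have m: "m > 0" by (simp add: m_def)
  note norm_moebius_defect[of \<alpha> y]
  moreover have nz: "norm z * m = norm (y - \<alpha>)"
    using den by (simp add: z norm_mult norm_divide c m_def)
  ultimately have 1: "m^2 * (1 - (norm z)^2) = k * (1 - (norm y)^2)"
    by (simp add: k_def flip: m_def) (simp add: power_mult_distrib algebra_simps flip: nz)
  have "k * (1 - (norm y)^2) > 0" using k y by (simp add: power_less_one_iff)
  then have "1 - (norm z)^2 > 0" using m unfolding 1[symmetric] by (simp add: zero_less_mult_iff)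
  then show "norm z < 1" by (simp add: power_less_one_iff)
  \<comment> \<open>The weight 1 + cnj \<alpha> cnj c z and the Moebius denominator are reciprocal
    up to the constant \<open>k\<close>; this is what links the weights to
    \<open>Phi\<close>.\<close>
  have "(1 + cnj \<alpha> * cnj c * z) * (1 - cnj \<alpha> * y) = 1 - cnj \<alpha> * y + cnj \<alpha> * (cnj c * c) * (y - \<alpha>)"
    using den by (simp add: z field_simps)
  also have "\<dots> = of_real k" unfolding cc k by (simp add: algebra_simps)
  finally have e: "(1 + cnj \<alpha> * cnj c * z) * (1 - cnj \<alpha> * y) = of_real k" .
  then show "1 + cnj \<alpha> * cnj c * z \<noteq> 0" using k(1) by auto
  have "norm (1 + cnj \<alpha> * cnj c * z) * m = k"
    using arg_cong[OF e, of norm] k(1) by (simp add: norm_mult m_def)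
  then have "m^2 * ((norm (1 + cnj \<alpha> * cnj c * z))^2 * (1 - (norm y)^2)) = k * (k * (1 - (norm y)^2))"
    by (metis (no_types, lifting) mult.assoc mult.commute power2_eq_square power_mult_distrib)
  also have "\<dots> = m^2 * (k * (1 - (norm z)^2))" unfolding 1[symmetric] by simp
  finally show "(norm (1 + cnj \<alpha> * cnj c * z))^2 * (1 - (norm y)^2) = (1 - (norm \<alpha>)^2) * (1 - (norm z)^2)"
    using m by (simp add: k_def)
qed

text \<open>Divided by the two denominators, \<open>Q\<close> is A X Y + B X + C Y + E with X and Y
  the values of Phi at \<omega>1 and \<omega>2. Vanishing near \<open>x\<close> on all lines makes
  the polynomial \<open>Q\<close> identically zero; its values at the origin and at (0, 1), (0, -1),
  (1, 0), (-1, 0) then give B (\<omega>1 - \<omega>2) = 0.\<close>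

lemma conic_nonvanishing:
  fixes A B C E \<omega>1 \<omega>2 :: complex and x :: "complex \<times> complex"
  defines "Q \<equiv> \<lambda>y. A * ((2 * \<omega>1 * snd y - fst y) * (2 * \<omega>2 * snd y - fst y)) +
      B * ((2 * \<omega>1 * snd y - fst y) * (2 - \<omega>2 * fst y)) +
      C * ((2 - \<omega>1 * fst y) * (2 * \<omega>2 * snd y - fst y)) +
      E * ((2 - \<omega>1 * fst y) * (2 - \<omega>2 * fst y))"
  assumes ne: "\<omega>1 \<noteq> \<omega>2" and B: "B \<noteq> 0"
  shows "\<exists>e. \<forall>\<delta>>0. \<exists>\<zeta>. norm \<zeta> < \<delta> \<and> Q (x + cscale \<zeta> e) \<noteq> 0"
proof (rule ccontr)
  assume neg: "\<not> ?thesis"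
  have Q0: "Q y = 0" for y
  proof -
    define e where "e = y - x"
    define n where "n \<omega> = [:2 * \<omega> * snd x - fst x, 2 * \<omega> * snd e - fst e:]" for \<omega>
    define d where "d \<omega> = [:2 - \<omega> * fst x, - \<omega> * fst e:]" for \<omega>
    define q where "q = smult A (n \<omega>1 * n \<omega>2) + smult B (n \<omega>1 * d \<omega>2) + smult C (d \<omega>1 * n \<omega>2) + smult E (d \<omega>1 * d \<omega>2)"
    have n: "poly (n \<omega>) \<zeta> = 2 * \<omega> * snd (x + cscale \<zeta> e) - fst (x + cscale \<zeta> e)" for \<omega> \<zeta>
      by (simp add: n_def cscale_def algebra_simps)
    have d: "poly (d \<omega>) \<zeta> = 2 - \<omega> * fst (x + cscale \<zeta> e)" for \<omega> \<zeta>
      by (simp add: d_def cscale_def algebra_simps)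
    have q: "poly q \<zeta> = Q (x + cscale \<zeta> e)" for \<zeta>
      by (simp only: q_def Q_def poly_add poly_smult poly_mult n d)
    obtain \<delta> where \<delta>: "\<delta> > 0" "\<And>\<zeta>. norm \<zeta> < \<delta> \<Longrightarrow> Q (x + cscale \<zeta> e) = 0"
      using neg by blast
    have "infinite (ball (0 :: complex) \<delta>)" by (rule uncountable_infinite[OF uncountable_ball[OF \<delta>(1)]])
    moreover have "ball 0 \<delta> \<subseteq> {\<zeta>. poly q \<zeta> = 0}" using \<delta>(2) by (auto simp: q)
    ultimately have "infinite {\<zeta>. poly q \<zeta> = 0}" using finite_subset by blast
    then have "q = 0" using poly_roots_finite by blast
    then have "Q (x + cscale 1 e) = 0" by (simp flip: q)
    moreover have "x + cscale 1 e = y" by (simp add: prod_eq_iff e_def cscale_def)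
    ultimately show ?thesis by simp
  qed
  have E0: "E = 0" using Q0[of "(0, 0)"] by (simp add: Q_def)
  have "Q (0, 1) = 4 * (A * (\<omega>1 * \<omega>2)) + 4 * (B * \<omega>1 + C * \<omega>2)"
    and "Q (0, -1) = 4 * (A * (\<omega>1 * \<omega>2)) - 4 * (B * \<omega>1 + C * \<omega>2)"
    and "Q (1, 0) = A - (B * (2 - \<omega>2) + C * (2 - \<omega>1))"
    and "Q (-1, 0) = A + (B * (2 + \<omega>2) + C * (2 + \<omega>1))"
    by (simp_all add: Q_def E0 algebra_simps)
  note eqs = this[unfolded Q0]
  have 3: "B * \<omega>1 + C * \<omega>2 = 0" using eqs(1,2) by algebra
  have 4: "B + C = 0" using eqs(3,4) by algebra
  have "B * (\<omega>1 - \<omega>2) = 0" using 3 4 by algebra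
  then show False using ne B by simp
qed

lemma well_aligned_tderiv:
  assumes wa: "well_aligned F (l, v)" and l: "l \<in> symm_bidisc"
  shows "F \<in> Hol_symm_bidisc_disc" "F l = 0" "car_norm (l, v) > 0"
    "tderiv F l v = of_real (car_norm (l, v))"
proof -
  show F: "F \<in> Hol_symm_bidisc_disc" and F0: "F l = 0"
    using wa by (auto simp: well_aligned_def car_extremal_def)
  have dd: "dir_deriv F l v = tderiv F l v"
    using F l by (intro dir_deriv_eq) (auto simp: Hol_symm_bidisc_disc_def)
  have real: "tderiv F l v \<in> \<real>" "Re (tderiv F l v) > 0"
    using wa by (simp_all add: well_aligned_def dd)
  have "norm (tderiv F l v) = car_norm (l, v)"
    using wa by (simp add: well_aligned_def car_extremal_def car_quotient_def dd F0)
  then show "car_norm (l, v) > 0" "tderiv F l v = of_real (car_norm (l, v))"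
    using real by (auto elim!: Reals_cases)
qed

lemma tderiv_cscale: "tderiv F l (cscale k v) = k * tderiv F l v"
  by (simp add: tderiv_def cscale_def algebra_simps)

text \<open>The relation \<phi> (1 - cnj \<alpha> Phi) = c (Phi - \<alpha>) is differentiated in
  product form; \<phi> vanishes at \<open>l\<close>, which removes one of the terms.\<close>

lemma moebius_Phi_tderiv:
  assumes l: "l \<in> symm_bidisc" and \<omega>: "norm \<omega> = 1" and c: "norm c = 1" and \<alpha>: "norm \<alpha> < 1"
    and \<phi>: "\<And>x. x \<in> symm_bidisc \<Longrightarrow> \<phi> x = c * ((Phi \<omega> x - \<alpha>) / (1 - cnj \<alpha> * Phi \<omega> x))"
    and hol: "holomorphic2_on \<phi> symm_bidisc" and \<phi>0: "\<phi> l = 0"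
  shows "Phi \<omega> l = \<alpha>" "tderiv (Phi \<omega>) l v = cnj c * of_real (1 - (norm \<alpha>)^2) * tderiv \<phi> l v"
proof -
  have den: "1 - cnj \<alpha> * Phi \<omega> x \<noteq> 0" if "x \<in> symm_bidisc" for x
    by (rule moebius_disc(1)[OF \<alpha> norm_Phi_less_1[OF that \<omega>] c refl])
  have c0: "c \<noteq> 0" using c by auto
  show \<alpha>l: "Phi \<omega> l = \<alpha>" using \<phi>[OF l] \<phi>0 den[OF l] c0 by simp
  have cc: "cnj c * c = 1" using c complex_norm_square[of c] by (simp add: mult.commute)
  note P = holomorphic2_Phi[OF \<omega>]
  have const: "tderiv (\<lambda>_. k) l v = 0" for k using tderiv_affine[of k 0 0 l v] by simp
  have aff: "tderiv (\<lambda>x. a + b * Phi \<omega> x) l v = b * tderiv (Phi \<omega>) l v" for a b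
    unfolding tderiv_add[OF holomorphic2_on_const holomorphic2_on_mult[OF holomorphic2_on_const P] l]
      tderiv_mult[OF holomorphic2_on_const P l] const by simp
  have affhol: "holomorphic2_on (\<lambda>x. a + b * Phi \<omega> x) symm_bidisc" for a b
    by (intro holomorphic2_intros P)
  have "tderiv (\<lambda>x. \<phi> x * (1 + (- cnj \<alpha>) * Phi \<omega> x)) l v = tderiv (\<lambda>x. (- c * \<alpha>) + c * Phi \<omega> x) l v"
  proof (rule tderiv_cong_open[OF affhol open_symm_bidisc l])
    fix x assume "x \<in> symm_bidisc"
    then show "(- c * \<alpha>) + c * Phi \<omega> x = \<phi> x * (1 + (- cnj \<alpha>) * Phi \<omega> x)"
    proof -
      have "\<phi> x * (1 - cnj \<alpha> * Phi \<omega> x) = c * (Phi \<omega> x - \<alpha>)"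
        using den[OF \<open>x \<in> symm_bidisc\<close>] by (simp add: \<phi>[OF \<open>x \<in> symm_bidisc\<close>])
      then show ?thesis by (simp add: algebra_simps)
    qed
  qed
  then have "tderiv \<phi> l v * (1 - cnj \<alpha> * \<alpha>) = c * tderiv (Phi \<omega>) l v"
    unfolding tderiv_mult[OF hol affhol l] aff by (simp add: \<phi>0 \<alpha>l)
  moreover have "1 - cnj \<alpha> * \<alpha> = of_real (1 - (norm \<alpha>)^2)"
    using complex_norm_square[of \<alpha>] by (simp add: mult.commute)
  ultimately have "cnj c * (of_real (1 - (norm \<alpha>)^2) * tderiv \<phi> l v) = (cnj c * c) * tderiv (Phi \<omega>) l v"
    by (simp add: mult_ac)
  then show "tderiv (Phi \<omega>) l v = cnj c * of_real (1 - (norm \<alpha>)^2) * tderiv \<phi> l v"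
    unfolding cc by (simp add: mult_ac)
qed

theorem theorem3p3:
  fixes \<delta> :: tangent
    and \<omega> c \<alpha> :: "nat \<Rightarrow> complex"
    and m :: "nat \<Rightarrow> complex \<Rightarrow> complex"
    and \<phi> :: "nat \<Rightarrow> complex \<times> complex \<Rightarrow> complex"
    and F :: "complex \<times> complex \<Rightarrow> complex"
  assumes "purely_balanced \<delta>"
    and "\<omega> 1 \<noteq> \<omega> 2"
    and "{\<zeta> \<in> sphere 0 1. car_extremal (Phi \<zeta>) \<delta>} = {\<omega> 1, \<omega> 2}"
    and "\<And>j. j \<in> {1, 2} \<Longrightarrow> m j \<in> Aut_disc"
    and "\<And>j. j \<in> {1, 2} \<Longrightarrow> \<phi> j = m j \<circ> Phi (\<omega> j)"
    and "\<And>j. j \<in> {1, 2} \<Longrightarrow> well_aligned (\<phi> j) \<delta>"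
    and "\<And>j. j \<in> {1, 2} \<Longrightarrow> norm (c j) = 1"
    and "\<And>j. j \<in> {1, 2} \<Longrightarrow> \<alpha> j \<in> ball 0 1"
    and "\<And>j z. j \<in> {1, 2} \<Longrightarrow> z \<in> ball 0 1 \<Longrightarrow>
           m j z = c j * ((z - \<alpha> j) / (1 - cnj (\<alpha> j) * z))"
    and "well_aligned F \<delta>"
  shows "\<exists>u :: nat \<Rightarrow> complex \<times> complex \<Rightarrow> complex.
      (\<forall>j\<in>{1, 2}. holomorphic2_on (u j) symm_bidisc) \<and>
      (\<forall>s p. (s, p) \<in> symm_bidisc \<longrightarrow>
         (\<Sum>j\<in>{1, 2}. complex_of_real (sqrt (1 - (norm (\<alpha> j))\<^sup>2)) * u j (s, p) /
                       (1 + cnj (\<alpha> j) * cnj (c j) * \<phi> j (s, p))) = 1 \<and>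
         (norm (u 1 (s, p)))\<^sup>2 + (norm (u 2 (s, p)))\<^sup>2 \<le>
           (4 - (norm s)\<^sup>2)\<^sup>2 /
           ((4 - (norm s)\<^sup>2)\<^sup>2 - (2 * norm (s - cnj s * p) + norm (s\<^sup>2 - 4 * p))\<^sup>2) \<and>
         F (s, p) =
           (\<Sum>j\<in>{1, 2}. complex_of_real (sqrt (1 - (norm (\<alpha> j))\<^sup>2)) * \<phi> j (s, p) * u j (s, p) /
                         (1 + cnj (\<alpha> j) * cnj (c j) * \<phi> j (s, p))))"
proof -
  obtain l v where \<delta>: "\<delta> = (l, v)" by (cases \<delta>)
  have l: "l \<in> symm_bidisc"
    using assms(1) by (simp add: purely_balanced_def is_tangent_def \<delta>)
  have J: "j = 1 \<or> j = 2" if "j \<in> {1, 2}" for j :: nat using that by auto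
  have \<omega>: "norm (\<omega> j) = 1" if "j \<in> {1, 2}" for j
    using assms(3) J[OF that] by auto
  have c: "norm (c j) = 1" if "j \<in> {1, 2}" for j using assms(7) that .
  have \<alpha>: "norm (\<alpha> j) < 1" if "j \<in> {1, 2}" for j using assms(8)[OF that] by simp
  have \<phi>: "\<phi> j x = c j * ((Phi (\<omega> j) x - \<alpha> j) / (1 - cnj (\<alpha> j) * Phi (\<omega> j) x))"
    if "j \<in> {1, 2}" "x \<in> symm_bidisc" for j x
    using assms(5)[OF that(1)] assms(9)[OF that(1), of "Phi (\<omega> j) x"] norm_Phi_less_1[OF that(2) \<omega>[OF that(1)]]
    by simp
  note wa = well_aligned_tderiv[OF assms(6)[unfolded \<delta>] l]
  note waF = well_aligned_tderiv[OF assms(10)[unfolded \<delta>] l]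
  have \<phi>hol: "holomorphic2_on (\<phi> j) symm_bidisc" and \<phi>1: "\<And>x. x \<in> symm_bidisc \<Longrightarrow> norm (\<phi> j x) < 1"
    if "j \<in> {1, 2}" for j
    using wa(1)[OF that] by (auto simp: Hol_symm_bidisc_disc_def)
  have Fhol: "holomorphic2_on F symm_bidisc"
    using waF(1) by (auto simp: Hol_symm_bidisc_disc_def)
  define \<kappa> where "\<kappa> = car_norm (l, v)"
  have \<kappa>: "\<kappa> > 0" using waF(3) by (simp add: \<kappa>_def)
  have mob: "Phi (\<omega> j) l = \<alpha> j"
    "tderiv (Phi (\<omega> j)) l v = cnj (c j) * of_real (1 - (norm (\<alpha> j))^2) * of_real \<kappa>" if j: "j \<in> {1, 2}" for j
    using moebius_Phi_tderiv[OF l \<omega>[OF j] c[OF j] \<alpha>[OF j] \<phi>[OF j] \<phi>hol[OF j] wa(2)[OF j]] wa(4)[OF j]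
    by (simp_all add: \<kappa>_def)
  have md: "1 - cnj (\<alpha> j) * Phi (\<omega> j) x \<noteq> 0" "1 + cnj (\<alpha> j) * cnj (c j) * \<phi> j x \<noteq> 0"
    "(norm (1 + cnj (\<alpha> j) * cnj (c j) * \<phi> j x))^2 * (1 - (norm (Phi (\<omega> j) x))^2) =
      (1 - (norm (\<alpha> j))^2) * (1 - (norm (\<phi> j x))^2)"
    if j: "j \<in> {1, 2}" and x: "x \<in> symm_bidisc" for j x
    using moebius_disc[OF \<alpha>[OF j] norm_Phi_less_1[OF x \<omega>[OF j]] c[OF j] \<phi>[OF j x]] by simp_all
  \<comment> \<open>Rescaled to Caratheodory norm 1: along \<open>v'\<close> both \<phi>_j and
    \<open>F\<close> have value 0 and derivative 1.\<close>
  define v' where "v' = cscale (of_real (1 / \<kappa>)) v"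
  have quot: "norm (tderiv (Phi \<zeta>) l v') = car_quotient (Phi \<zeta>) (l, v) / \<kappa> * (1 - (norm (Phi \<zeta> l))^2)"
    and pos: "1 - (norm (Phi \<zeta> l))^2 > 0" if "norm \<zeta> = 1" for \<zeta>
  proof -
    show pos: "1 - (norm (Phi \<zeta> l))^2 > 0"
      using norm_Phi_less_1[OF l that] by (simp add: power_less_one_iff)
    show "norm (tderiv (Phi \<zeta>) l v') = car_quotient (Phi \<zeta>) (l, v) / \<kappa> * (1 - (norm (Phi \<zeta> l))^2)"
      using pos \<kappa> by (simp add: v'_def tderiv_cscale car_quotient_def dir_deriv_eq[OF holomorphic2_Phi[OF that] l]
          norm_mult norm_divide)
  qed
  have le: "norm (tderiv (Phi \<zeta>) l v') \<le> 1 - (norm (Phi \<zeta> l))^2" if "norm \<zeta> = 1" for \<zeta>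
  proof -
    have "car_quotient (Phi \<zeta>) (l, v) / \<kappa> \<le> 1"
      using car_quotient_le[OF l Phi_in_Hol[OF that], of v] \<kappa> by (simp add: \<kappa>_def)
    from mult_right_mono[OF this, of "1 - (norm (Phi \<zeta> l))^2"] show ?thesis
      unfolding quot[OF that] using pos[OF that] by simp
  qed
  have less: "norm (tderiv (Phi \<zeta>) l v') < 1 - (norm (Phi \<zeta> l))^2" if "norm \<zeta> = 1" "\<zeta> \<notin> \<omega> ` {1, 2}" for \<zeta>
  proof -
    have "\<not> car_extremal (Phi \<zeta>) (l, v)" using assms(3) that by (auto simp: \<delta>)
    then have "car_quotient (Phi \<zeta>) (l, v) \<noteq> \<kappa>"
      using Phi_in_Hol[OF that(1)] by (simp add: car_extremal_def \<kappa>_def)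
    then have "car_quotient (Phi \<zeta>) (l, v) / \<kappa> < 1"
      using car_quotient_le[OF l Phi_in_Hol[OF that(1)], of v] \<kappa> by (simp add: \<kappa>_def)
    from mult_strict_right_mono[OF this pos[OF that(1)]] show ?thesis
      unfolding quot[OF that(1)] by simp
  qed
  have D: "tderiv (Phi (\<omega> j)) l v' = cnj (c j) * of_real (1 - (norm (\<alpha> j))^2)" if "j \<in> {1, 2}" for j
    using \<kappa> unfolding v'_def tderiv_cscale mob(2)[OF that] by simp
  have DF: "tderiv F l v' = 1"
    using \<kappa> unfolding v'_def tderiv_cscale waF(4) \<kappa>_def[symmetric] by simp
  have J12: "jet_extremals l v' {1, 2} \<omega> c \<alpha>"
    by (rule jet_extremals.intro) (fact l, fact le, fact less, fact \<omega>, fact c, fact mob(1), fact D)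
  define \<psi> where "\<psi> x = \<phi> 1 x - \<phi> 2 x" for x
  define f where "f x = F x - \<phi> 2 x" for x
  have \<psi>hol: "holomorphic2_on \<psi> symm_bidisc" and fhol: "holomorphic2_on f symm_bidisc"
    unfolding \<psi>_def f_def by (intro holomorphic2_intros \<phi>hol Fhol; simp)+
  \<comment> \<open>The cross term and |F|^2 are given up here; what remains separates into one term
    for each \<open>u j\<close>.\<close>
  have region: "(norm (f x / \<psi> x))^2 * (1 - (norm (\<phi> 1 x))^2) + (norm (1 - f x / \<psi> x))^2 * (1 - (norm (\<phi> 2 x))^2) \<le> 1"
    if x: "x \<in> symm_bidisc" and ne: "\<psi> x \<noteq> 0" for x
  proof -
    define t where "t = f x / \<psi> x"
    have "t * \<psi> x = f x" using ne by (simp add: t_def)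
    then have Fx: "F x = t * \<phi> 1 x + (1 - t) * \<phi> 2 x" by (simp add: f_def \<psi>_def algebra_simps)
    have r: "1 - (norm (\<phi> 1 x))^2 \<ge> 0" "1 - (norm (\<phi> 2 x))^2 \<ge> 0"
      using \<phi>1[of 1, OF _ x] \<phi>1[of 2, OF _ x] by (simp_all add: power_le_one_iff less_imp_le)
    have "(norm t * sqrt (1 - (norm (\<phi> 1 x))^2) + norm (1 - t) * sqrt (1 - (norm (\<phi> 2 x))^2))^2 \<le> 1 - (norm (F x))^2"
    proof (rule jet_extremals.extremal_value_region[OF J12 refl x waF(1,2) DF, where z = "\<lambda>j. \<phi> j x"])
      show "\<phi> j x = c j * ((Phi (\<omega> j) x - \<alpha> j) / (1 - cnj (\<alpha> j) * Phi (\<omega> j) x))" if "j \<in> {1, 2}" for j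
        by (rule \<phi>[OF that x])
      show "\<phi> 1 x \<noteq> \<phi> 2 x" using ne by (simp add: \<psi>_def)
    qed (use \<phi>1 x Fx in auto)
    moreover have "2 * (norm t * sqrt (1 - (norm (\<phi> 1 x))^2)) * (norm (1 - t) * sqrt (1 - (norm (\<phi> 2 x))^2)) \<ge> 0"
      using r by simp
    ultimately have "(norm t * sqrt (1 - (norm (\<phi> 1 x))^2))^2 + (norm (1 - t) * sqrt (1 - (norm (\<phi> 2 x))^2))^2 \<le> 1"
      unfolding power2_sum using zero_le_power2[of "norm (F x)"] by linarith
    then show ?thesis using r by (simp add: power_mult_distrib t_def)
  qed
  have nz: "\<exists>e. \<forall>\<epsilon>>0. \<exists>\<zeta>. norm \<zeta> < \<epsilon> \<and> \<psi> (x + cscale \<zeta> e) \<noteq> 0" if x: "x \<in> symm_bidisc" for x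
  proof -
    \<comment> \<open>The coefficients come from expanding c1 (X - \<alpha>1)(1 - cnj \<alpha>2 Y) -
      c2 (Y - \<alpha>2)(1 - cnj \<alpha>1 X), the numerator of \<psi> in terms of the two Phi
      values X and Y.\<close>
    define Q where "Q y = (c 2 * cnj (\<alpha> 1) - c 1 * cnj (\<alpha> 2)) * ((2 * \<omega> 1 * snd y - fst y) * (2 * \<omega> 2 * snd y - fst y)) +
      (c 1 - c 2 * \<alpha> 2 * cnj (\<alpha> 1)) * ((2 * \<omega> 1 * snd y - fst y) * (2 - \<omega> 2 * fst y)) +
      (c 1 * \<alpha> 1 * cnj (\<alpha> 2) - c 2) * ((2 - \<omega> 1 * fst y) * (2 * \<omega> 2 * snd y - fst y)) +
      (c 2 * \<alpha> 2 - c 1 * \<alpha> 1) * ((2 - \<omega> 1 * fst y) * (2 - \<omega> 2 * fst y))" for y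
    have "c 1 - c 2 * \<alpha> 2 * cnj (\<alpha> 1) \<noteq> 0"
    proof
      assume "c 1 - c 2 * \<alpha> 2 * cnj (\<alpha> 1) = 0"
      then have "norm (c 1) = norm (c 2 * \<alpha> 2 * cnj (\<alpha> 1))" by simp
      then have "norm (\<alpha> 2) * norm (\<alpha> 1) = 1" using c by (simp add: norm_mult)
      moreover have "norm (\<alpha> 2) * norm (\<alpha> 1) < 1 * 1" using \<alpha> by (intro mult_strict_mono') auto
      ultimately show False by simp
    qed
    then obtain e where e: "\<And>\<epsilon>. \<epsilon> > 0 \<Longrightarrow> \<exists>\<zeta>. norm \<zeta> < \<epsilon> \<and> Q (x + cscale \<zeta> e) \<noteq> 0"
      using conic_nonvanishing[OF assms(2)] unfolding Q_def by blast
    obtain R where R: "R > 0" "\<And>\<zeta>. norm \<zeta> \<le> R \<Longrightarrow> x + cscale \<zeta> e \<in> symm_bidisc"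
      using line_in_open[OF open_symm_bidisc x, of e] by blast
    have \<psi>Q: "\<psi> y \<noteq> 0" if y: "y \<in> symm_bidisc" and Qy: "Q y \<noteq> 0" for y
    proof
      assume "\<psi> y = 0"
      define n d p where "n j = 2 * \<omega> j * snd y - fst y" and "d j = 2 - \<omega> j * fst y" and "p j = Phi (\<omega> j) y" for j
      have n: "n j = p j * d j" if "j \<in> {1, 2}" for j
        using Phi_denominator[of "fst y" "snd y" "\<omega> j"] \<omega>[OF that] y by (simp add: n_def d_def p_def Phi_def split_beta)
      have q: "\<phi> j y * (1 - cnj (\<alpha> j) * p j) = c j * (p j - \<alpha> j)" if "j \<in> {1, 2}" for j
        using md(1)[OF that y] \<phi>[OF that y] by (simp add: p_def)
      have "Q y = d 1 * d 2 * (c 1 * (p 1 - \<alpha> 1) * (1 - cnj (\<alpha> 2) * p 2) - c 2 * (p 2 - \<alpha> 2) * (1 - cnj (\<alpha> 1) * p 1))"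
        unfolding Q_def n_def[symmetric] d_def[symmetric] using n[of 1] n[of 2] by (simp add: algebra_simps)
      also have "\<dots> = d 1 * d 2 * (1 - cnj (\<alpha> 1) * p 1) * (1 - cnj (\<alpha> 2) * p 2) * \<psi> y"
        unfolding q[OF insertI1, symmetric] q[OF insertI2[OF singletonI], symmetric] \<psi>_def
        by (simp add: algebra_simps)
      finally show False using Qy \<open>\<psi> y = 0\<close> by simp
    qed
    have "\<exists>\<zeta>. norm \<zeta> < \<epsilon> \<and> \<psi> (x + cscale \<zeta> e) \<noteq> 0" if \<epsilon>: "\<epsilon> > 0" for \<epsilon>
    proof -
      obtain \<zeta> where "norm \<zeta> < min \<epsilon> R" "Q (x + cscale \<zeta> e) \<noteq> 0" using e[of "min \<epsilon> R"] \<epsilon> R(1) by auto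
      then show ?thesis using \<psi>Q[OF R(2)] by (intro exI[of _ \<zeta>]) auto
    qed
    then show ?thesis by blast
  qed
  have bnd: "\<exists>d>0. \<exists>B. \<forall>y\<in>symm_bidisc. dist y x < d \<longrightarrow> \<psi> y \<noteq> 0 \<longrightarrow> norm (f y / \<psi> y) \<le> B"
    if x: "x \<in> symm_bidisc" for x
  proof -
    \<comment> \<open>A continuous, hence locally bounded, majorant: T^2 k \<le> 1 and k \<le> 1
      give T k \<le> 1.\<close>
    define h where "h y = 1 / (1 - (norm (\<phi> 1 y))^2)" for y
    have lt: "(norm (\<phi> 1 y))^2 < 1" if "y \<in> symm_bidisc" for y
      using \<phi>1[of 1 y] that by (simp add: power_less_one_iff)
    have "continuous_on symm_bidisc h"
      unfolding h_def by (intro continuous_intros holomorphic2_continuous \<phi>hol) (use lt in force)+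
    then obtain d where d: "d > 0" "\<And>y. y \<in> symm_bidisc \<Longrightarrow> dist y x < d \<Longrightarrow> dist (h y) (h x) < 1"
      using x unfolding continuous_on_iff by (meson zero_less_one)
    have "norm (f y / \<psi> y) \<le> h x + 1" if y: "y \<in> symm_bidisc" "dist y x < d" "\<psi> y \<noteq> 0" for y
    proof -
      define T k where "T = norm (f y / \<psi> y)" and "k = 1 - (norm (\<phi> 1 y))^2"
      have k: "k > 0" "k \<le> 1" using lt[OF y(1)] by (simp_all add: k_def)
      have "(norm (1 - f y / \<psi> y))^2 * (1 - (norm (\<phi> 2 y))^2) \<ge> 0"
        using \<phi>1[of 2, OF _ y(1)] by (simp add: power_le_one_iff less_imp_le)
      then have "T^2 * k \<le> 1" using region[OF y(1,3)] by (simp add: T_def k_def)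
      moreover have "(T * k)^2 = (T^2 * k) * k" by (simp add: power2_eq_square)
      ultimately have "(T * k)^2 \<le> 1^2" using k by (simp add: mult_le_one)
      then have "T * k \<le> 1" by (rule power2_le_imp_le) simp
      then have "T \<le> h y" using k unfolding h_def k_def[symmetric] by (simp add: pos_le_divide_eq)
      also have "h y \<le> h x + 1" using d(2)[OF y(1,2)] by (simp add: dist_real_def)
      finally show ?thesis by (simp add: T_def)
    qed
    then show ?thesis using d(1) by blast
  qed
  obtain t where thol: "holomorphic2_on t symm_bidisc"
    and t: "\<And>x. x \<in> symm_bidisc \<Longrightarrow> \<psi> x \<noteq> 0 \<Longrightarrow> t x = f x / \<psi> x"
    using bounded_quotient_extension[OF open_symm_bidisc fhol \<psi>hol bnd nz] by blast
  have extend: "h x \<le> 0"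
    if hc: "continuous_on symm_bidisc h" and hx: "x \<in> symm_bidisc" and hle: "\<And>y. y \<in> symm_bidisc \<Longrightarrow> \<psi> y \<noteq> 0 \<Longrightarrow> h y \<le> 0"
    for h :: "complex \<times> complex \<Rightarrow> real" and x
  proof -
    obtain e where "\<And>\<epsilon>. \<epsilon> > 0 \<Longrightarrow> \<exists>\<zeta>. norm \<zeta> < \<epsilon> \<and> \<psi> (x + cscale \<zeta> e) \<noteq> 0"
      using nz[OF hx] by blast
    then show ?thesis
      by (rule le_on_closure_line[OF open_symm_bidisc hc hx, of "\<lambda>y. \<psi> y \<noteq> 0"]) (assumption | rule hle)+
  qed
  have Ft: "F x = t x * \<phi> 1 x + (1 - t x) * \<phi> 2 x" if x: "x \<in> symm_bidisc" for x
  proof -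
    have "norm (f x - t x * \<psi> x) \<le> 0"
      by (rule extend[OF _ x]) (auto intro!: continuous_intros holomorphic2_continuous holomorphic2_intros fhol thol \<psi>hol simp: t)
    then show ?thesis by (simp add: f_def \<psi>_def algebra_simps)
  qed
  define tt where "tt j x = (if j = 1 then t x else 1 - t x)" for j :: nat and x
  define den where "den j x = 1 + cnj (\<alpha> j) * cnj (c j) * \<phi> j x" for j x
  \<comment> \<open>Chosen to cancel the weights, so that both sums of the theorem reduce to the
    coefficients t and 1 - t.\<close>
  define u where "u j x = tt j x * den j x / complex_of_real (sqrt (1 - (norm (\<alpha> j))^2))" for j x
  have k: "1 - (norm (\<alpha> j))^2 > 0" if "j \<in> {1, 2}" for j
    using \<alpha>[OF that] by (simp add: power_less_one_iff)
  have uhol: "holomorphic2_on (u j) symm_bidisc" if j: "j \<in> {1, 2}" for j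
  proof -
    have "holomorphic2_on (tt j) symm_bidisc"
      using J[OF j] by (auto simp: tt_def[abs_def] intro!: holomorphic2_intros thol)
    then show ?thesis
      unfolding u_def den_def using k[OF j] by (intro holomorphic2_intros \<phi>hol[OF j]) auto
  qed
  have cancel: "complex_of_real (sqrt (1 - (norm (\<alpha> j))^2)) * y * u j x / den j x = y * tt j x"
    if j: "j \<in> {1, 2}" and x: "x \<in> symm_bidisc" for j x y
  proof -
    have "den j x \<noteq> 0" unfolding den_def by (rule md(2)[OF j x])
    moreover have "complex_of_real (sqrt (1 - (norm (\<alpha> j))^2)) \<noteq> 0" using k[OF j] by simp
    ultimately show ?thesis by (simp add: u_def)
  qed
  have norm_u: "(norm (u j x))^2 * (1 - (norm (Phi (\<omega> j) x))^2) = (norm (tt j x))^2 * (1 - (norm (\<phi> j x))^2)"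
    if j: "j \<in> {1, 2}" and x: "x \<in> symm_bidisc" for j x
  proof -
    have "(norm (u j x))^2 = (norm (tt j x))^2 * (norm (den j x))^2 / (1 - (norm (\<alpha> j))^2)"
      using k[OF j] by (simp add: u_def norm_mult norm_divide power_mult_distrib power_divide)
    then have "(norm (u j x))^2 * (1 - (norm (Phi (\<omega> j) x))^2) =
        (norm (tt j x))^2 * ((norm (den j x))^2 * (1 - (norm (Phi (\<omega> j) x))^2)) / (1 - (norm (\<alpha> j))^2)"
      by simp
    also have "\<dots> = (norm (tt j x))^2 * (1 - (norm (\<phi> j x))^2)"
      unfolding den_def md(3)[OF j x] using k[OF j] by simp
    finally show ?thesis .
  qed
  define d n where "d x = 4 - (norm (fst x))^2"
    and "n x = 2 * norm (fst x - cnj (fst x) * snd x) + norm ((fst x)^2 - 4 * snd x)"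
    for x :: "complex \<times> complex"
  have dn: "0 \<le> n x" "n x < d x" if "x \<in> symm_bidisc" for x
    using Phi_radius[of "fst x" "snd x"] that by (simp_all add: d_def n_def)
  \<comment> \<open>Free of denominators, the estimate is a closed condition between continuous
    functions, and \<open>extend\<close> carries it over to the zeros of \<psi>.\<close>
  have bound: "((norm (u 1 x))^2 + (norm (u 2 x))^2) * ((d x)^2 - (n x)^2) - (d x)^2 \<le> 0"
    if x: "x \<in> symm_bidisc" for x
  proof (rule extend[OF _ x])
    show "continuous_on symm_bidisc (\<lambda>x. ((norm (u 1 x))^2 + (norm (u 2 x))^2) * ((d x)^2 - (n x)^2) - (d x)^2)"
      unfolding d_def n_def by (intro continuous_intros holomorphic2_continuous uhol) auto
  next
    fix y assume y: "y \<in> symm_bidisc" "\<psi> y \<noteq> 0"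
    have term_le: "(norm (u j y))^2 * ((d y)^2 - (n y)^2) \<le> (d y)^2 * ((norm (tt j y))^2 * (1 - (norm (\<phi> j y))^2))"
      if j: "j \<in> {1, 2}" for j
    proof -
      have "norm (Phi (\<omega> j) y) \<le> n y / d y"
        using norm_Phi_le[of "fst y" "snd y" "\<omega> j"] \<omega>[OF j] y(1) by (simp add: n_def d_def)
      then have "norm (Phi (\<omega> j) y) * d y \<le> n y" using dn[OF y(1)] by (simp add: pos_le_divide_eq)
      then have "(norm (Phi (\<omega> j) y) * d y)^2 \<le> (n y)^2" using dn[OF y(1)] by (intro power_mono) auto
      then have "(d y)^2 - (n y)^2 \<le> (d y)^2 * (1 - (norm (Phi (\<omega> j) y))^2)"
        by (simp add: power_mult_distrib algebra_simps)
      from mult_left_mono[OF this, of "(norm (u j y))^2"]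
      have "(norm (u j y))^2 * ((d y)^2 - (n y)^2) \<le> (d y)^2 * ((norm (u j y))^2 * (1 - (norm (Phi (\<omega> j) y))^2))"
        by (simp add: mult_ac)
      then show ?thesis unfolding norm_u[OF j y(1)] .
    qed
    have "(d y)^2 * ((norm (tt 1 y))^2 * (1 - (norm (\<phi> 1 y))^2) + (norm (tt 2 y))^2 * (1 - (norm (\<phi> 2 y))^2)) \<le> (d y)^2 * 1"
      using region[OF y] by (intro mult_left_mono) (simp_all add: tt_def t[OF y])
    then show "((norm (u 1 y))^2 + (norm (u 2 y))^2) * ((d y)^2 - (n y)^2) - (d y)^2 \<le> 0"
      using term_le[of 1] term_le[of 2] unfolding distrib_left distrib_right by simp
  qed
  have sum12: "(\<Sum>j\<in>{1, 2}. g j) = g 1 + g 2" for g :: "nat \<Rightarrow> complex" by simp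
  show ?thesis
  proof (intro exI[of _ u] conjI ballI allI impI)
    show "holomorphic2_on (u j) symm_bidisc" if "j \<in> {1, 2}" for j by (rule uhol[OF that])
  next
    fix s p assume sp: "(s, p) \<in> symm_bidisc"
    show "(\<Sum>j\<in>{1, 2}. complex_of_real (sqrt (1 - (norm (\<alpha> j))^2)) * u j (s, p) /
                       (1 + cnj (\<alpha> j) * cnj (c j) * \<phi> j (s, p))) = 1"
      using cancel[of 1 "(s, p)" 1] cancel[of 2 "(s, p)" 1] sp
      unfolding sum12 den_def by (simp add: tt_def)
    show "F (s, p) =
           (\<Sum>j\<in>{1, 2}. complex_of_real (sqrt (1 - (norm (\<alpha> j))^2)) * \<phi> j (s, p) * u j (s, p) /
                         (1 + cnj (\<alpha> j) * cnj (c j) * \<phi> j (s, p)))"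
      using cancel[of 1 "(s, p)" "\<phi> 1 (s, p)"] cancel[of 2 "(s, p)" "\<phi> 2 (s, p)"] sp Ft[OF sp]
      unfolding sum12 den_def by (simp add: tt_def mult.commute)
    have "(d (s, p))^2 - (n (s, p))^2 > 0"
      using dn[OF sp] power_strict_mono[of "n (s, p)" "d (s, p)" 2] by simp
    then have "(norm (u 1 (s, p)))^2 + (norm (u 2 (s, p)))^2 \<le> (d (s, p))^2 / ((d (s, p))^2 - (n (s, p))^2)"
      using bound[OF sp] by (simp add: pos_le_divide_eq)
    then show "(norm (u 1 (s, p)))^2 + (norm (u 2 (s, p)))^2 \<le>
           (4 - (norm s)^2)^2 /
           ((4 - (norm s)^2)^2 - (2 * norm (s - cnj s * p) + norm (s^2 - 4 * p))^2)"
      by (simp add: d_def n_def)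
  qed
qed

end
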